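(* Let $V$ be a subgroup of $S([4]^2)$. Then the following conditions are equivalent: (i) $V$ is a bicompatible subgroup of $S([4]^2)$ and is isomorphic to $S_4$; (ii) $V$ is one of the following groups: - a subgroup isomorphic to $S_4$ of one of the groups $N_{i,j}$, $1\le i<j\le 4$ (there are $24$ such subgroups in total); - $V=S_4\otimes1$, or $V=1\otimes S_4$; - one of the $6$ groups $\widetilde T_{a,b}$, with $a,b\in\{2,3,4\}$, $a\ne b$.
   Context: $[n]=\{1,\dots,n\}$; $S(A)$ is the symmetric group on $A$, $S_n=S([n])$; permutations are in disjoint cycle form, composed right to left. For $u\in S([n]^t)$, $v\in S([n]^r)$, $u\otimes v\in S([n]^{t+r})$ is $(u\otimes v)(\alpha,\beta)=(u(\alpha),v(\beta))$; $1$ is the identity of $S_n$. $S_4\otimes1=\{\sigma\otimes1:\sigma\in S_4\}$ and $1\otimes S_4=\{1\otimes\sigma:\sigma\in S_4\}$, subgroups of $S([4]^2)$. For $u,v\in S([n]^2)$, $u$ is compatible with $v$ if $(v\otimes1)(1\otimes u)=(1\otimes u)(v\otimes1)$ in $S([n]^3)$; $u$ and $v$ are bicompatible if each is compatible with the other. A subgroup $S\le S([n]^2)$ is bicompatible if $u$ and $v$ are bicompatible for all $u,v\in S$ (including $u=v$). For $i\ne j$ in $[4]$, with $\{h,k\}=[4]\setminus\{i,j\}$, $N_{i,j}$ is the subgroup of $S([4]^2)$ generated by $((i,h),(i,k))$, $((j,h),(j,k))$, $((i,h),(j,h))$, $((i,i),(j,i))((i,j),(j,j))$ and $((h,h),(h,k))((k,h),(k,k))$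 (so $N_{i,j}=N_{j,i}$). For $a\ne b$ in $\{2,3,4\}$, with $\{c\}=\{2,3,4\}\setminus\{a,b\}$, $\widetilde T_{a,b}$ is the subgroup of $S([4]^2)$ generated by $$s_1=((1,1),(1,b))\,((b,1),(b,b))\,((1,a),(1,c))\,((b,a),(b,c)),$$ $$s_2=((1,b),(a,b))\,((b,b),(c,b))\,((1,c),(a,c))\,((b,c),(c,c)),$$ $$s_3=((a,1),(a,b))\,((c,1),(c,b))\,((a,a),(a,c))\,((c,a),(c,c)).$$ *)

theory Defs
  imports "HOL-Algebra.Generated_Groups" "HOL-Algebra.Sym_Groups"
begin

text \<open>The set \<open>[n]\<^sup>t\<close> is modelled as the words of length \<open>t\<close> over \<open>{1..n}\<close>, so that
  \<open>[n]\<^sup>t \<times> [n]\<^sup>r = [n]\<^sup>t\<^sup>+\<^sup>r\<close> is concatenation and \<open>[n]\<close> is identified with \<open>[n]\<^sup>1\<close>.\<close>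

definition words :: "nat \<Rightarrow> nat \<Rightarrow> nat list set" where
  "words n t = {w. length w = t \<and> set w \<subseteq> {1..n}}"

text \<open>\<open>S([n]\<^sup>t)\<close>, in the style of \<^const>\<open>sym_group\<close>: permutations are the identity outside
  \<open>[n]\<^sup>t\<close>, and the product is composition from right to left.\<close>

definition Sw :: "nat \<Rightarrow> nat \<Rightarrow> (nat list \<Rightarrow> nat list) monoid" where
  "Sw n t = \<lparr> carrier = {p. p permutes words n t}, mult = (\<circ>), one = id \<rparr>"

text \<open>\<open>tensor n t r u v\<close> is \<open>u \<otimes> v\<close> for \<open>u \<in> S([n]\<^sup>t)\<close> and \<open>v \<in> S([n]\<^sup>r)\<close>.
  The identity \<open>1\<close> of \<open>S\<^sub>n\<close> is \<^const>\<open>id\<close>.\<close>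

definition tensor :: "nat \<Rightarrow> nat \<Rightarrow> nat \<Rightarrow> (nat list \<Rightarrow> nat list) \<Rightarrow> (nat list \<Rightarrow> nat list)
    \<Rightarrow> nat list \<Rightarrow> nat list" where
  "tensor n t r u v =
    (\<lambda>w. if w \<in> words n (t + r) then u (take t w) @ v (drop t w) else w)"

definition compatible ::
    "nat \<Rightarrow> (nat list \<Rightarrow> nat list) \<Rightarrow> (nat list \<Rightarrow> nat list) \<Rightarrow> bool" where
  "compatible n u v \<longleftrightarrow>
    tensor n 2 1 v id \<circ> tensor n 1 2 id u = tensor n 1 2 id u \<circ> tensor n 2 1 v id"

definition bicompatible ::
    "nat \<Rightarrow> (nat list \<Rightarrow> nat list) \<Rightarrow> (nat list \<Rightarrow> nat list) \<Rightarrow> bool" where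
  "bicompatible n u v \<longleftrightarrow> compatible n u v \<and> compatible n v u"

definition bicompatible_subgroup :: "nat \<Rightarrow> (nat list \<Rightarrow> nat list) set \<Rightarrow> bool" where
  "bicompatible_subgroup n U \<longleftrightarrow>
    subgroup U (Sw n 2) \<and> (\<forall>u\<in>U. \<forall>v\<in>U. bicompatible n u v)"

definition S4_tensor_1 :: "(nat list \<Rightarrow> nat list) set" where
  "S4_tensor_1 = {tensor 4 1 1 \<sigma> id | \<sigma>. \<sigma> \<in> carrier (Sw 4 1)}"

definition one_tensor_S4 :: "(nat list \<Rightarrow> nat list) set" where
  "one_tensor_S4 = {tensor 4 1 1 id \<sigma> | \<sigma>. \<sigma> \<in> carrier (Sw 4 1)}"

text \<open>Interchanging \<open>h\<close> and \<open>k\<close> does not change the generated subgroup, so the choice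
  \<open>h < k\<close> is immaterial.\<close>

definition N_group :: "nat \<Rightarrow> nat \<Rightarrow> (nat list \<Rightarrow> nat list) set" where
  "N_group i j =
    (let h = Min ({1..4} - {i, j}); k = Max ({1..4} - {i, j}) in
     generate (Sw 4 2)
      {transpose [i, h] [i, k],
       transpose [j, h] [j, k],
       transpose [i, h] [j, h],
       transpose [i, i] [j, i] \<circ> transpose [i, j] [j, j],
       transpose [h, h] [h, k] \<circ> transpose [k, h] [k, k]})"

definition T_group :: "nat \<Rightarrow> nat \<Rightarrow> (nat list \<Rightarrow> nat list) set" where
  "T_group a b =
    (let c = the_elem ({2, 3, 4} - {a, b}) in
     generate (Sw 4 2)
      {transpose [1, 1] [1, b] \<circ> transpose [b, 1] [b, b]
         \<circ> transpose [1, a] [1, c] \<circ> transpose [b, a] [b, c],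
       transpose [1, b] [a, b] \<circ> transpose [b, b] [c, b]
         \<circ> transpose [1, c] [a, c] \<circ> transpose [b, c] [c, c],
       transpose [a, 1] [a, b] \<circ> transpose [c, 1] [c, b]
         \<circ> transpose [a, a] [a, c] \<circ> transpose [c, a] [c, c]})"

definition S4_subgroups_of_N :: "nat \<Rightarrow> nat \<Rightarrow> (nat list \<Rightarrow> nat list) set set" where
  "S4_subgroups_of_N i j =
    {U. subgroup U (Sw 4 2 \<lparr>carrier := N_group i j\<rparr>) \<and>
        Sw 4 2 \<lparr>carrier := U\<rparr> \<cong> sym_group 4}"

end

theory Submission
  imports Defs
begin

text \<open>Write \<open>v(x, y) = (f\<^sub>v(x, y), g\<^sub>v(x, y))\<close>. Bicompatibility says that \<open>f\<^sub>v\<close> depends on its second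
  argument only up to the equivalence \<open>R\<close> generated by \<open>x ~ f\<^sub>u(x, y)\<close>, that \<open>g\<^sub>v\<close> depends on its first
  argument only up to the equivalence \<open>C\<close> generated by \<open>y ~ g\<^sub>u(x, y)\<close>, and that the maps \<open>f\<^sub>v(\<cdot>, z)\<close>
  commute with the maps \<open>g\<^sub>u(x, \<cdot>)\<close>. The group acts on each block (an \<open>R\<close>-class times a
  \<open>C\<close>-class). Squares commute in \<open>S\<^sub>3\<close>, in the dihedral group of order \<open>8\<close> and in abelian groups, but not
  in \<open>S\<^sub>4\<close>, so some block must carry an action violating \<open>a\<^sup>2b\<^sup>2 = b\<^sup>2a\<^sup>2\<close>. Running through the pairs of
  partitions \<open>(R, C)\<close> of \<open>[4]\<close>, this leaves four types: one of \<open>R\<close>, \<open>C\<close> trivial and the other total,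
  which gives \<open>1 \<otimes> S\<^sub>4\<close> and \<open>S\<^sub>4 \<otimes> 1\<close>; \<open>R = ij|h|k\<close> and \<open>C = i|j|hk\<close>, which gives \<open>V \<le> N\<^sub>i\<^sub>j\<close>; and
  two transversal partitions into pairs, which give \<open>T\<^sub>a\<^sub>b\<close>. Finally
  \<open>N\<^sub>i\<^sub>j \<cong> S\<^sub>4 \<times> \<int>\<^sub>2 \<times> \<int>\<^sub>2\<close>, whose subgroups isomorphic to \<open>S\<^sub>4\<close> are the four graphs of homomorphisms
  \<open>S\<^sub>4 \<rightarrow> \<int>\<^sub>2 \<times> \<int>\<^sub>2\<close>.\<close>

section \<open>Commuting squares in small permutation groups\<close>

text \<open>The obstacle is that \<open>V\<close> is given only up to isomorphism: it acts on each
  block through some quotient, and no block is singled out on which the action is faithful. A group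
  law avoids classifying these quotients and the ways they fit together. A law that fails in
  \<open>V\<close> fails at some single word, so one block has to violate it, and every pair of
  partitions whose blocks all obey it is discarded. The elimination stays short because the letters
  with a singleton R-class form a union of C-classes, and conversely: this excludes most pairs of
  partitions before any block is inspected. A surviving pair confines \<open>V\<close> to an
  explicit overgroup. In three of the four types this overgroup has 24 elements, so counting
  identifies \<open>V\<close> with it. Only N_ij is larger, and the freedom left there is one sign
  character or the trivial one in each of the two central factors: 4 subgroups for each of 6 pairs,
  hence 24.\<close>

lemma squares_commute_card_le_3:
  assumes "finite Y" "card Y \<le> 3" and y: "y \<in> Y"
    and a: "inj_on \<alpha> Y" "\<alpha> ` Y \<subseteq> Y" and b: "inj_on \<beta> Y" "\<beta> ` Y \<subseteq> Y"
  shows "\<alpha> (\<alpha> (\<beta> (\<beta> y))) = \<beta> (\<beta> (\<alpha> (\<alpha> y)))"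
proof -
  have "card Y = 0 \<or> card Y = 1 \<or> card Y = 2 \<or> card Y = 3" using assms(2) by auto
  then consider p where "Y = {p}" | p q where "Y = {p, q}" "p \<noteq> q"
    | p q r where "Y = {p, q, r}" "p \<noteq> q" "p \<noteq> r" "q \<noteq> r"
    using y assms(1) by (auto simp: card_1_singleton_iff card_2_iff card_3_iff)
  then show ?thesis
  proof cases
    case 1 then show ?thesis using y a b by auto
  next
    case 2
    have sq: "\<gamma> (\<gamma> x) = x" if "inj_on \<gamma> Y" "\<gamma> ` Y \<subseteq> Y" "x \<in> Y" for \<gamma> x
      using that unfolding 2 by (auto simp: 2(2) dest: inj_onD)
    have "\<alpha> y \<in> Y" "\<beta> y \<in> Y" using y a b by auto
    then show ?thesis using sq[OF a] sq[OF b] y by metis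
  next
    case 3
    \<comment> \<open>A permutation of three points is an involution, the identity or a 3-cycle, so
      all squares lie in the cyclic group of order 3.\<close>
    have sq: "(\<gamma> (\<gamma> p) = p \<and> \<gamma> (\<gamma> q) = q \<and> \<gamma> (\<gamma> r) = r)
      \<or> (\<gamma> p = q \<and> \<gamma> q = r \<and> \<gamma> r = p) \<or> (\<gamma> p = r \<and> \<gamma> q = p \<and> \<gamma> r = q)"
      if "inj_on \<gamma> Y" "\<gamma> ` Y \<subseteq> Y" for \<gamma>
    proof -
      have "\<gamma> p \<noteq> \<gamma> q" "\<gamma> p \<noteq> \<gamma> r" "\<gamma> q \<noteq> \<gamma> r" using that 3 by (auto simp: inj_on_def)
      moreover have "\<gamma> p \<in> {p, q, r}" "\<gamma> q \<in> {p, q, r}" "\<gamma> r \<in> {p, q, r}" using that 3 by auto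
      ultimately show ?thesis by auto
    qed
    have in': "\<alpha> x \<in> {p,q,r}" "\<beta> x \<in> {p,q,r}" if "x \<in> {p,q,r}" for x using a b 3 that by auto
    show ?thesis using y unfolding 3
      by (elim insertE emptyE; insert sq[OF a] sq[OF b] in' 3(2-4); elim disjE conjE; simp)
  qed
qed

text \<open>Maps respecting the fibres {i, j} and {h, k} of \<open>\<pi>\<close> generate at most
  the dihedral group of order 8, in which a square is the identity or the central element (i j)(h
  k).\<close>

lemma squares_commute_blocks:
  assumes Y: "Y = {i, j, h, k}" "distinct [i, j, h, k]" and y: "y \<in> Y"
    and p: "\<pi> i = \<pi> j" "\<pi> h = \<pi> k" "\<pi> i \<noteq> \<pi> h"
    and a: "inj_on \<alpha> Y" "\<alpha> ` Y \<subseteq> Y" "\<And>x x'. x \<in> Y \<Longrightarrow> x' \<in> Y \<Longrightarrow> \<pi> x = \<pi> x' \<Longrightarrow> \<pi> (\<alpha> x) = \<pi> (\<alpha> x')"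
    and b: "inj_on \<beta> Y" "\<beta> ` Y \<subseteq> Y" "\<And>x x'. x \<in> Y \<Longrightarrow> x' \<in> Y \<Longrightarrow> \<pi> x = \<pi> x' \<Longrightarrow> \<pi> (\<beta> x) = \<pi> (\<beta> x')"
  shows "\<alpha> (\<alpha> (\<beta> (\<beta> y))) = \<beta> (\<beta> (\<alpha> (\<alpha> y)))"
proof -
  have sq: "(\<gamma> (\<gamma> i) = i \<and> \<gamma> (\<gamma> j) = j \<and> \<gamma> (\<gamma> h) = h \<and> \<gamma> (\<gamma> k) = k) \<or>
    (\<gamma> (\<gamma> i) = j \<and> \<gamma> (\<gamma> j) = i \<and> \<gamma> (\<gamma> h) = k \<and> \<gamma> (\<gamma> k) = h)" (is "?D \<gamma>")
    if "inj_on \<gamma> Y" "\<gamma> ` Y \<subseteq> Y" "\<And>x x'. x \<in> Y \<Longrightarrow> x' \<in> Y \<Longrightarrow> \<pi> x = \<pi> x' \<Longrightarrow> \<pi> (\<gamma> x) = \<pi> (\<gamma> x')"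
    for \<gamma>
  proof -
    have ne: "\<gamma> i \<noteq> \<gamma> j" "\<gamma> i \<noteq> \<gamma> h" "\<gamma> i \<noteq> \<gamma> k" "\<gamma> j \<noteq> \<gamma> h" "\<gamma> j \<noteq> \<gamma> k" "\<gamma> h \<noteq> \<gamma> k"
      using that(1) Y by (auto simp: inj_on_def)
    have m: "\<gamma> i \<in> {i, j, h, k}" "\<gamma> j \<in> {i, j, h, k}" "\<gamma> h \<in> {i, j, h, k}" "\<gamma> k \<in> {i, j, h, k}"
      using that(2) Y by auto
    have "\<pi> (\<gamma> i) = \<pi> (\<gamma> j)" "\<pi> (\<gamma> h) = \<pi> (\<gamma> k)" using that(3) Y p by auto
    then have b1: "{\<gamma> i, \<gamma> j} = {i, j} \<or> {\<gamma> i, \<gamma> j} = {h, k}"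
      using ne(1) m(1,2) p by auto
    have b2: "{\<gamma> h, \<gamma> k} = {i, j} \<or> {\<gamma> h, \<gamma> k} = {h, k}"
      using \<open>\<pi> (\<gamma> h) = \<pi> (\<gamma> k)\<close> ne(6) m(3,4) p by auto
    then have "\<gamma> i = i \<and> \<gamma> j = j \<or> \<gamma> i = j \<and> \<gamma> j = i \<or> \<gamma> i = h \<and> \<gamma> j = k \<or> \<gamma> i = k \<and> \<gamma> j = h"
      and "\<gamma> h = i \<and> \<gamma> k = j \<or> \<gamma> h = j \<and> \<gamma> k = i \<or> \<gamma> h = h \<and> \<gamma> k = k \<or> \<gamma> h = k \<and> \<gamma> k = h"
      using b1 b2 unfolding doubleton_eq_iff by blast+
    then show ?thesis using ne(2-5) Y(2) by (elim disjE conjE) simp_all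
  qed
  have A: "?D \<alpha>" by (rule sq) (use a in \<open>blast+\<close>)
  have B: "?D \<beta>" by (rule sq) (use b in \<open>blast+\<close>)
  show ?thesis using y A B unfolding Y by (elim insertE emptyE disjE) auto
qed

text \<open>If a map and its square each fix all points or none, transpositions and 3-cycles are
  excluded. What remains is the identity, the double transpositions and the 4-cycles, whose squares
  lie in the Klein four-group.\<close>

lemma squares_commute_semiregular:
  assumes Y: "Y = {i, j, h, k}" "distinct [i, j, h, k]" and y: "y \<in> Y"
    and a: "inj_on \<alpha> Y" "\<alpha> ` Y \<subseteq> Y" "\<And>x x'. \<lbrakk>x \<in> Y; x' \<in> Y; \<alpha> x = x\<rbrakk> \<Longrightarrow> \<alpha> x' = x'"
      "\<And>x x'. \<lbrakk>x \<in> Y; x' \<in> Y; \<alpha> (\<alpha> x) = x\<rbrakk> \<Longrightarrow> \<alpha> (\<alpha> x') = x'"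
    and b: "inj_on \<beta> Y" "\<beta> ` Y \<subseteq> Y" "\<And>x x'. \<lbrakk>x \<in> Y; x' \<in> Y; \<beta> x = x\<rbrakk> \<Longrightarrow> \<beta> x' = x'"
      "\<And>x x'. \<lbrakk>x \<in> Y; x' \<in> Y; \<beta> (\<beta> x) = x\<rbrakk> \<Longrightarrow> \<beta> (\<beta> x') = x'"
  shows "\<alpha> (\<alpha> (\<beta> (\<beta> y))) = \<beta> (\<beta> (\<alpha> (\<alpha> y)))"
proof -
  have sq: "(\<gamma> (\<gamma> i) = i \<and> \<gamma> (\<gamma> j) = j \<and> \<gamma> (\<gamma> h) = h \<and> \<gamma> (\<gamma> k) = k) \<or>
    (\<gamma> (\<gamma> i) = j \<and> \<gamma> (\<gamma> j) = i \<and> \<gamma> (\<gamma> h) = k \<and> \<gamma> (\<gamma> k) = h) \<or>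
    (\<gamma> (\<gamma> i) = h \<and> \<gamma> (\<gamma> j) = k \<and> \<gamma> (\<gamma> h) = i \<and> \<gamma> (\<gamma> k) = j) \<or>
    (\<gamma> (\<gamma> i) = k \<and> \<gamma> (\<gamma> j) = h \<and> \<gamma> (\<gamma> h) = j \<and> \<gamma> (\<gamma> k) = i)" (is "?D \<gamma>")
    if c: "inj_on \<gamma> Y" "\<gamma> ` Y \<subseteq> Y" "\<And>x x'. \<lbrakk>x \<in> Y; x' \<in> Y; \<gamma> x = x\<rbrakk> \<Longrightarrow> \<gamma> x' = x'"
      "\<And>x x'. \<lbrakk>x \<in> Y; x' \<in> Y; \<gamma> (\<gamma> x) = x\<rbrakk> \<Longrightarrow> \<gamma> (\<gamma> x') = x'" for \<gamma>
  proof (cases "\<gamma> (\<gamma> i) = i")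
    case True then show ?thesis using c(4) Y by auto
  next
    case False
    then have f2: "\<gamma> (\<gamma> x) \<noteq> x" if "x \<in> {i, j, h, k}" for x using c(4) that Y by auto
    then have f1: "\<gamma> x \<noteq> x" if "x \<in> {i, j, h, k}" for x using that by metis
    have ne: "\<gamma> i \<noteq> \<gamma> j" "\<gamma> i \<noteq> \<gamma> h" "\<gamma> i \<noteq> \<gamma> k" "\<gamma> j \<noteq> \<gamma> h" "\<gamma> j \<noteq> \<gamma> k" "\<gamma> h \<noteq> \<gamma> k"
      using that(1) Y by (auto simp: inj_on_def)
    have m: "\<gamma> i \<in> {i, j, h, k}" "\<gamma> j \<in> {i, j, h, k}" "\<gamma> h \<in> {i, j, h, k}" "\<gamma> k \<in> {i, j, h, k}"
      using that(2) Y by auto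
    show ?thesis using ne m f1[of i] f1[of j] f1[of h] f1[of k] f2[of i] f2[of j] f2[of h] f2[of k] Y(2)
      by (elim insertE emptyE) simp_all
  qed
  have A: "?D \<alpha>" by (rule sq) (use a in \<open>blast+\<close>)
  have B: "?D \<beta>" by (rule sq) (use b in \<open>blast+\<close>)
  show ?thesis using y A B unfolding Y by (elim insertE emptyE disjE) auto
qed

text \<open>The cases are the integer partitions of 4. Each records just enough pairs to determine
  the classes by symmetry and transitivity.\<close>

lemma equiv_card_4_cases:
  assumes "card X = 4" "refl_on X E" "sym E" "trans E"
  obtains (total) "\<forall>x\<in>X. \<forall>y\<in>X. (x, y) \<in> E"
    | (trivial) "\<forall>x\<in>X. \<forall>y\<in>X. (x, y) \<in> E \<longrightarrow> x = y"
    | (type31) i j h k where "X = {i, j, h, k}" "distinct [i, j, h, k]"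
        "(i, j) \<in> E" "(i, h) \<in> E" "(i, k) \<notin> E"
    | (type22) i j h k where "X = {i, j, h, k}" "distinct [i, j, h, k]"
        "(i, j) \<in> E" "(h, k) \<in> E" "(i, h) \<notin> E"
    | (type211) i j h k where "X = {i, j, h, k}" "distinct [i, j, h, k]"
        "(i, j) \<in> E" "(h, k) \<notin> E" "(i, h) \<notin> E" "(i, k) \<notin> E"
proof (cases "\<forall>x\<in>X. \<forall>y\<in>X. (x, y) \<in> E \<longrightarrow> x = y")
  case False
  then obtain i j where ij: "i \<in> X" "j \<in> X" "(i, j) \<in> E" "i \<noteq> j" by blast
  have "card (X - {i, j}) = 2" using ij assms(1) by (simp add: card_Diff_subset)
  then obtain h k where "X - {i, j} = {h, k}" "h \<noteq> k" by (auto simp: card_2_iff)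
  then have X: "X = {i, j, h, k}" "distinct [i, j, h, k]" using ij by auto
  show thesis
  proof (cases "(h, k) \<in> E")
    case hk: True
    show thesis
    proof (cases "(i, h) \<in> E")
      case True
      have "\<forall>x\<in>X. (i, x) \<in> E"
        using X(1) ij(1,3) hk True assms(2,4) by (auto dest: transD refl_onD)
      then have "\<forall>x\<in>X. \<forall>y\<in>X. (x, y) \<in> E" using assms(3,4) by (meson symD transD)
      then show thesis by (rule total)
    qed (use type22 X ij hk in blast)
  next
    case hk: False
    consider "(i, h) \<in> E" | "(i, k) \<in> E" | "(i, h) \<notin> E" "(i, k) \<notin> E" by blast
    then show thesis
    proof cases
      case 1
      then have "(i, k) \<notin> E" using hk assms(3,4) by (meson symD transD)
      then show thesis using type31[of i j h k] X ij 1 by blast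
    next
      case 2
      then have "(i, h) \<notin> E" using hk assms(3,4) by (meson symD transD)
      then show thesis using type31[of i j k h] X ij 2 by auto
    qed (use type211 X ij hk in blast)
  qed
qed (rule trivial)

section \<open>Bicompatible actions\<close>

text \<open>Closing under reflexivity and transitivity suffices, since symmetry comes from inverses
  in the group. The intersection removes the reflexive pairs outside \<open>X\<close>. The order of
  arguments of \<open>f\<close> is left open so that C is the same construction with the coordinates
  exchanged.\<close>

definition orbit_rel :: "('v, 'm) monoid_scheme \<Rightarrow> 'a set \<Rightarrow> ('v \<Rightarrow> 'a \<Rightarrow> 'a \<Rightarrow> 'a) \<Rightarrow> ('a \<times> 'a) set" where
  "orbit_rel G X f = {(x, f v x y) | v x y. v \<in> carrier G \<and> x \<in> X \<and> y \<in> X}\<^sup>* \<inter> X \<times> X"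

text \<open>The last three assumptions are the three components of \<open>(v \<otimes> 1)(1 \<otimes> u) = (1 \<otimes> u)(v \<otimes> 1)\<close> at
  \<open>(x, y, z)\<close>. Exchanging the two coordinates permutes the assumptions, so every result has a dual.\<close>

locale bicompatible_action = group G for G :: "('v, 'm) monoid_scheme" (structure) +
  fixes X :: "'a set" and f g :: "'v \<Rightarrow> 'a \<Rightarrow> 'a \<Rightarrow> 'a"
  assumes card_X: "card X = 4"
    and f_in: "\<lbrakk>v \<in> carrier G; x \<in> X; y \<in> X\<rbrakk> \<Longrightarrow> f v x y \<in> X"
    and g_in: "\<lbrakk>v \<in> carrier G; x \<in> X; y \<in> X\<rbrakk> \<Longrightarrow> g v x y \<in> X"
    and f_one: "\<lbrakk>x \<in> X; y \<in> X\<rbrakk> \<Longrightarrow> f \<one> x y = x"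
    and g_one: "\<lbrakk>x \<in> X; y \<in> X\<rbrakk> \<Longrightarrow> g \<one> x y = y"
    and f_mult: "\<lbrakk>u \<in> carrier G; v \<in> carrier G; x \<in> X; y \<in> X\<rbrakk>
      \<Longrightarrow> f (u \<otimes> v) x y = f u (f v x y) (g v x y)"
    and g_mult: "\<lbrakk>u \<in> carrier G; v \<in> carrier G; x \<in> X; y \<in> X\<rbrakk>
      \<Longrightarrow> g (u \<otimes> v) x y = g u (f v x y) (g v x y)"
    and f_f: "\<lbrakk>u \<in> carrier G; v \<in> carrier G; x \<in> X; y \<in> X; z \<in> X\<rbrakk> \<Longrightarrow> f v x (f u y z) = f v x y"
    and g_f: "\<lbrakk>u \<in> carrier G; v \<in> carrier G; x \<in> X; y \<in> X; z \<in> X\<rbrakk>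
      \<Longrightarrow> g v x (f u y z) = f u (g v x y) z"
    and g_g: "\<lbrakk>u \<in> carrier G; v \<in> carrier G; x \<in> X; y \<in> X; z \<in> X\<rbrakk> \<Longrightarrow> g u (g v x y) z = g u y z"
begin

abbreviation "R \<equiv> orbit_rel G X f"
abbreviation "C \<equiv> orbit_rel G X (\<lambda>v x y. g v y x)"

text \<open>The law is localised at one point so that different blocks can be treated by different
  arguments.\<close>

definition "squares_commute_at x y \<longleftrightarrow> (\<forall>a\<in>carrier G. \<forall>b\<in>carrier G.
  f (a \<otimes> a \<otimes> (b \<otimes> b)) x y = f (b \<otimes> b \<otimes> (a \<otimes> a)) x y \<and>
  g (a \<otimes> a \<otimes> (b \<otimes> b)) x y = g (b \<otimes> b \<otimes> (a \<otimes> a)) x y)"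

lemma dual: "bicompatible_action G X (\<lambda>v x y. g v y x) (\<lambda>v x y. f v y x)"
  by (unfold_locales) (simp_all add: card_X f_in g_in f_one g_one f_mult g_mult f_f g_f g_g)

lemma dual_squares_commute_at:
  "bicompatible_action.squares_commute_at G (\<lambda>v x y. g v y x) (\<lambda>v x y. f v y x) x y
    \<longleftrightarrow> squares_commute_at y x"
  unfolding bicompatible_action.squares_commute_at_def[OF dual] squares_commute_at_def by blast

section \<open>The orbit equivalences and how the action respects them\<close>

lemma R_subset: "(x, y) \<in> R \<Longrightarrow> x \<in> X \<and> y \<in> X"
  by (simp add: orbit_rel_def)

lemma R_refl: "refl_on X R"
  by (auto simp: orbit_rel_def refl_on_def)

lemma R_trans: "trans R"
  by (auto simp: orbit_rel_def trans_def)

lemma R_step: "\<lbrakk>v \<in> carrier G; x \<in> X; y \<in> X\<rbrakk> \<Longrightarrow> (x, f v x y) \<in> R"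
  by (auto simp: orbit_rel_def f_in)

lemma f_inv: "\<lbrakk>v \<in> carrier G; x \<in> X; y \<in> X\<rbrakk> \<Longrightarrow> f (inv v) (f v x y) (g v x y) = x"
  using f_mult[of "inv v" v x y] by (simp add: f_one)

text \<open>The step from x to f_v(x, y) is undone by the inverse of v, applied at the image point
  (f_v(x, y), g_v(x, y)) and not at (f_v(x, y), y).\<close>

lemma R_sym: "sym R"
proof -
  have "sym {(x, f v x y) | v x y. v \<in> carrier G \<and> x \<in> X \<and> y \<in> X}"
  proof (rule symI, clarify)
    fix v x y assume "v \<in> carrier G" "x \<in> X" "y \<in> X"
    then show "\<exists>v' x' y'. (f v x y, x) = (x', f v' x' y') \<and> v' \<in> carrier G \<and> x' \<in> X \<and> y' \<in> X"
      by (intro exI[of _ "inv v"] exI[of _ "f v x y"] exI[of _ "g v x y"]) (simp add: f_inv f_in g_in)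
  qed
  from sym_rtrancl[OF this] show ?thesis by (auto simp: orbit_rel_def sym_def)
qed

lemma R_induct [consumes 1, case_names refl step]:
  assumes "(x, x') \<in> R" "P x"
    and "\<And>y v z. \<lbrakk>y \<in> X; P y; v \<in> carrier G; z \<in> X\<rbrakk> \<Longrightarrow> P (f v y z)"
  shows "P x'"
proof -
  have "(x, x') \<in> {(x, f v x y) | v x y. v \<in> carrier G \<and> x \<in> X \<and> y \<in> X}\<^sup>*"
    using assms(1) by (simp add: orbit_rel_def)
  then show ?thesis by (induction rule: rtrancl_induct) (use assms(2,3) in auto)
qed

lemma f_cong_R:
  assumes "(y, y') \<in> R" "v \<in> carrier G" "x \<in> X"
  shows "f v x y = f v x y'"
  using assms(1) by (induction rule: R_induct) (simp_all add: f_f assms)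

text \<open>Since g_v(z, .) commutes with every f_u(., w), it carries each generating step of R to
  another such step. Hence the C-moves permute the R-classes.\<close>

lemma g_preserves_R:
  assumes "(x, x') \<in> R" "v \<in> carrier G" "z \<in> X"
  shows "(g v z x, g v z x') \<in> R"
proof -
  have "x \<in> X" using assms(1) R_subset by auto
  show ?thesis using assms(1)
  proof (induction rule: R_induct)
    case refl then show ?case using \<open>x \<in> X\<close> R_refl assms g_in by (auto dest: refl_onD)
  next
    case (step y u w)
    have "(g v z y, f u (g v z y) w) \<in> R" using step assms by (intro R_step) (auto intro: g_in)
    then show ?case using step assms by (simp add: g_f) (meson R_trans transD)
  qed
qed

definition fixed :: "'a \<Rightarrow> bool" where
  "fixed x \<longleftrightarrow> (\<forall>x'. (x, x') \<in> R \<longrightarrow> x' = x)"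

lemma fixed_iff: "x \<in> X \<Longrightarrow> fixed x \<longleftrightarrow> (\<forall>v\<in>carrier G. \<forall>y\<in>X. f v x y = x)"
proof
  assume "x \<in> X" "\<forall>v\<in>carrier G. \<forall>y\<in>X. f v x y = x"
  moreover have "x' = x" if "(x, x') \<in> R" for x'
    using that by (induction rule: R_induct) (use calculation in auto)
  ultimately show "fixed x" by (simp add: fixed_def)
qed (auto simp: fixed_def R_step)

text \<open>A common fixed point of the maps f_u(., w) is sent to a common fixed point by any map
  commuting with them. So the letters with singleton R-class form a union of C-classes, which is the
  main tool for excluding partitions.\<close>

lemma fixed_C:
  assumes "(x, x') \<in> C" "fixed x"
  shows "fixed x'"
proof -
  interpret d: bicompatible_action G X "\<lambda>v x y. g v y x" "\<lambda>v x y. f v y x" by (rule dual)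
  show ?thesis using assms
  proof (induction rule: d.R_induct)
    case (step y v z)
    then have "\<forall>u\<in>carrier G. \<forall>w\<in>X. f u (g v z y) w = g v z y"
      using g_f[of _ v z y] fixed_iff by fastforce
    then show ?case using fixed_iff step g_in by auto
  qed
qed

section \<open>Conditions on a block that force squares to commute\<close>

lemma hom_inj_on:
  assumes one: "\<And>y. y \<in> Y \<Longrightarrow> act \<one> y = y"
    and mult: "\<And>u v y. \<lbrakk>u \<in> carrier G; v \<in> carrier G; y \<in> Y\<rbrakk> \<Longrightarrow> act (u \<otimes> v) y = act u (act v y)"
    and v: "v \<in> carrier G"
  shows "inj_on (act v) Y"
proof (rule inj_on_inverseI)
  fix y assume "y \<in> Y"
  then show "act (inv v) (act v y) = y" using mult[of "inv v" v y] one v by simp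
qed

lemma hom_squares:
  assumes closed: "\<And>u y. \<lbrakk>u \<in> carrier G; y \<in> Y\<rbrakk> \<Longrightarrow> act u y \<in> Y"
    and mult: "\<And>u v y. \<lbrakk>u \<in> carrier G; v \<in> carrier G; y \<in> Y\<rbrakk> \<Longrightarrow> act (u \<otimes> v) y = act u (act v y)"
    and "a \<in> carrier G" "b \<in> carrier G" "y \<in> Y"
  shows "act (a \<otimes> a \<otimes> (b \<otimes> b)) y = act a (act a (act b (act b y)))"
  using assms by simp

text \<open>On such a block the two coordinates move independently, so the group acts through a
  product of two permutation groups of degree at most 3, and each factor is settled
  separately.\<close>

lemma squares_commute_product:
  assumes AB: "A \<subseteq> X" "B \<subseteq> X" "card A \<le> 3" "card B \<le> 3" "x0 \<in> A" "y0 \<in> B"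
    and fA: "\<And>v x y. \<lbrakk>v \<in> carrier G; x \<in> A; y \<in> B\<rbrakk> \<Longrightarrow> f v x y \<in> A"
      "\<And>v x y. \<lbrakk>v \<in> carrier G; x \<in> A; y \<in> B\<rbrakk> \<Longrightarrow> f v x y = f v x y0"
    and gB: "\<And>v x y. \<lbrakk>v \<in> carrier G; x \<in> A; y \<in> B\<rbrakk> \<Longrightarrow> g v x y \<in> B"
      "\<And>v x y. \<lbrakk>v \<in> carrier G; x \<in> A; y \<in> B\<rbrakk> \<Longrightarrow> g v x y = g v x0 y"
  shows "squares_commute_at x0 y0"
proof -
  have X: "finite X" using card_X by (simp add: card_ge_0_finite)
  have A: "x \<in> X" if "x \<in> A" for x using that AB by blast
  have B: "x \<in> X" if "x \<in> B" for x using that AB by blast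
  let ?f = "\<lambda>v x. f v x y0" and ?g = "\<lambda>v y. g v x0 y"
  have fm: "?f (u \<otimes> v) x = ?f u (?f v x)" if "u \<in> carrier G" "v \<in> carrier G" "x \<in> A" for u v x
    using f_mult[OF that(1,2) A[OF that(3)] B[OF AB(6)]] fA(2)[OF that(1) fA(1) gB(1)] that(2,3) AB(6) by simp
  have gm: "?g (u \<otimes> v) y = ?g u (?g v y)" if "u \<in> carrier G" "v \<in> carrier G" "y \<in> B" for u v y
    using g_mult[OF that(1,2) A[OF AB(5)] B[OF that(3)]] gB(2)[OF that(1) fA(1) gB(1)] that(2,3) AB(5) by simp
  have fi: "inj_on (?f v) A" "?f v ` A \<subseteq> A" if "v \<in> carrier G" for v
  proof -
    show "inj_on (?f v) A" by (rule hom_inj_on[OF _ fm that]) (use A B AB f_one in auto)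
    show "?f v ` A \<subseteq> A" using fA(1)[OF that] AB(6) by blast
  qed
  have gi: "inj_on (?g v) B" "?g v ` B \<subseteq> B" if "v \<in> carrier G" for v
  proof -
    show "inj_on (?g v) B" by (rule hom_inj_on[OF _ gm that]) (use A B AB g_one in auto)
    show "?g v ` B \<subseteq> B" using gB(1)[OF that] AB(5) by blast
  qed
  have fin: "finite A" "finite B" using AB X finite_subset by auto
  show ?thesis unfolding squares_commute_at_def
  proof (intro ballI conjI)
    fix a b assume ab: "a \<in> carrier G" "b \<in> carrier G"
    have hf: "f (u \<otimes> u \<otimes> (v \<otimes> v)) x0 y0 = ?f u (?f u (?f v (?f v x0)))"
      if "u \<in> carrier G" "v \<in> carrier G" for u v
      by (rule hom_squares[where Y = A and act = ?f])
        (erule (1) fA(1)[OF _ _ AB(6)], erule (2) fm, rule that(1), rule that(2), rule AB(5))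
    show "f (a \<otimes> a \<otimes> (b \<otimes> b)) x0 y0 = f (b \<otimes> b \<otimes> (a \<otimes> a)) x0 y0"
      unfolding hf[OF ab] hf[OF ab(2,1)]
      by (rule squares_commute_card_le_3[OF fin(1) AB(3,5) fi[OF ab(1)] fi[OF ab(2)]])
    have hg: "g (u \<otimes> u \<otimes> (v \<otimes> v)) x0 y0 = ?g u (?g u (?g v (?g v y0)))"
      if "u \<in> carrier G" "v \<in> carrier G" for u v
      by (rule hom_squares[where Y = B and act = ?g])
        (erule gB(1)[OF _ AB(5)], assumption, erule (2) gm, rule that(1), rule that(2), rule AB(6))
    show "g (a \<otimes> a \<otimes> (b \<otimes> b)) x0 y0 = g (b \<otimes> b \<otimes> (a \<otimes> a)) x0 y0"
      unfolding hg[OF ab] hg[OF ab(2,1)]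
      by (rule squares_commute_card_le_3[OF fin(2) AB(4,6) gi[OF ab(1)] gi[OF ab(2)]])
  qed
qed

text \<open>Here the block is a \<open>2 \<times> 2\<close> grid whose columns are permuted, so the group acts through the
  dihedral group of order \<open>8\<close>.\<close>

lemma squares_commute_wreath:
  assumes A: "A = {a1, a2}" "a1 \<noteq> a2" "A \<subseteq> X" and B: "B = {b1, b2}" "b1 \<noteq> b2" "B \<subseteq> X"
    and x0: "x0 \<in> A" "y0 \<in> B" 
    and fA: "\<And>v x y. \<lbrakk>v \<in> carrier G; x \<in> A; y \<in> B\<rbrakk> \<Longrightarrow> f v x y \<in> A"
    and gB: "\<And>v x y. \<lbrakk>v \<in> carrier G; x \<in> A; y \<in> B\<rbrakk> \<Longrightarrow> g v x y \<in> B"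
      "\<And>v x y. \<lbrakk>v \<in> carrier G; x \<in> A; y \<in> B\<rbrakk> \<Longrightarrow> g v x y = g v x0 y"
  shows "squares_commute_at x0 y0"
proof -
  let ?Y = "A \<times> B"
  let ?act = "\<lambda>v (x, y). (f v x y, g v x y)"
  have Y: "?Y = {(a1, b1), (a2, b1), (a1, b2), (a2, b2)}" "distinct [(a1, b1), (a2, b1), (a1, b2), (a2, b2)]"
    using A B by auto
  have closed: "?act v z \<in> ?Y" if "v \<in> carrier G" "z \<in> ?Y" for v z
    using that fA[of v "fst z" "snd z"] gB(1)[of v "fst z" "snd z"] by (cases z) simp
  have mult: "?act (u \<otimes> v) z = ?act u (?act v z)"
    if "u \<in> carrier G" "v \<in> carrier G" "z \<in> ?Y" for u v z
    using that A(3) B(3) by (auto simp: f_mult g_mult subset_iff)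
  have one: "?act \<one> z = z" if "z \<in> ?Y" for z
    using that A(3) B(3) by (auto simp: f_one g_one subset_iff)
  have inj: "inj_on (?act v) ?Y" if "v \<in> carrier G" for v
    using that by (intro hom_inj_on one mult)
  have bl: "snd (?act v z) = snd (?act v z')"
    if "v \<in> carrier G" "z \<in> ?Y" "z' \<in> ?Y" "snd z = snd z'" for v z z'
    using that gB(2)[of v "fst z" "snd z"] gB(2)[of v "fst z'" "snd z'"]
    by (cases z, cases z') simp
  have "?act (a \<otimes> a \<otimes> (b \<otimes> b)) (x0, y0) = ?act (b \<otimes> b \<otimes> (a \<otimes> a)) (x0, y0)"
    if ab: "a \<in> carrier G" "b \<in> carrier G" for a b
  proof -
    have z: "(x0, y0) \<in> ?Y" using x0 by simp
    have "?act a (?act a (?act b (?act b (x0, y0)))) = ?act b (?act b (?act a (?act a (x0, y0))))"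
    proof (rule squares_commute_blocks[OF Y z, where \<pi> = snd])
      show "?act a ` ?Y \<subseteq> ?Y" using closed[OF ab(1)] by blast
      show "?act b ` ?Y \<subseteq> ?Y" using closed[OF ab(2)] by blast
      show "inj_on (?act a) ?Y" "inj_on (?act b) ?Y" using inj ab by blast+
      show "snd (?act a x) = snd (?act a x')" if "x \<in> ?Y" "x' \<in> ?Y" "snd x = snd x'" for x x'
        using bl[OF ab(1) that] .
      show "snd (?act b x) = snd (?act b x')" if "x \<in> ?Y" "x' \<in> ?Y" "snd x = snd x'" for x x'
        using bl[OF ab(2) that] .
    qed (use B(2) in simp_all)
    then show ?thesis
      using hom_squares[of ?Y ?act, OF closed mult ab z] hom_squares[of ?Y ?act, OF closed mult ab(2,1) z]
      by (simp only:)
  qed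
  then show ?thesis unfolding squares_commute_at_def by auto
qed


lemmas C_subset = bicompatible_action.R_subset[OF dual]
  and C_refl = bicompatible_action.R_refl[OF dual]
  and C_sym = bicompatible_action.R_sym[OF dual]
  and C_trans = bicompatible_action.R_trans[OF dual]
  and C_step = bicompatible_action.R_step[OF dual]
  and C_induct = bicompatible_action.R_induct[OF dual, consumes 1, case_names refl step]
  and g_cong_C = bicompatible_action.f_cong_R[OF dual]

lemma fixed_imp_f_eq: "\<lbrakk>fixed x; v \<in> carrier G; x \<in> X; y \<in> X\<rbrakk> \<Longrightarrow> f v x y = x"
  by (simp add: fixed_iff)

lemma fixed_iff_Image: "x \<in> X \<Longrightarrow> fixed x \<longleftrightarrow> R `` {x} = {x}"
  using R_refl by (auto simp: fixed_def dest: refl_onD)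

text \<open>The first coordinate ignores y on the block for one of two reasons: it never moves
  (singleton R-class), or all relevant y are R-equivalent. The condition on C does the same for the
  second coordinate, and the block splits as a product.\<close>

lemma squares_commute_classes:
  assumes xy: "x0 \<in> X" "y0 \<in> X"
    and card: "card (R `` {x0}) \<le> 3" "card (C `` {y0}) \<le> 3"
    and R: "R `` {x0} = {x0} \<or> C `` {y0} \<subseteq> R `` {y0}"
    and C: "C `` {y0} = {y0} \<or> R `` {x0} \<subseteq> C `` {x0}"
  shows "squares_commute_at x0 y0"
proof (rule squares_commute_product[where A = "R `` {x0}" and B = "C `` {y0}"])
  show sub: "R `` {x0} \<subseteq> X" "C `` {y0} \<subseteq> X" using R_subset C_subset by auto
  show "x0 \<in> R `` {x0}" "y0 \<in> C `` {y0}" using xy R_refl C_refl by (auto dest: refl_onD)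
  fix v x y assume v: "v \<in> carrier G" and x: "x \<in> R `` {x0}" and y: "y \<in> C `` {y0}"
  have xX: "x \<in> X" and yX: "y \<in> X" using x y sub by auto
  show "f v x y \<in> R `` {x0}" using x R_step[OF v xX yX] R_trans by (auto dest: transD)
  show "g v x y \<in> C `` {y0}" using y C_step[OF v yX xX] C_trans by (auto dest: transD)
  show "f v x y = f v x y0"
    using R
  proof
    assume "R `` {x0} = {x0}"
    then show ?thesis using x v xX yX xy by (auto simp: fixed_iff_Image fixed_imp_f_eq)
  next
    assume "C `` {y0} \<subseteq> R `` {y0}"
    then show ?thesis using f_cong_R[OF _ v xX, of y0 y] y by auto
  qed
  show "g v x y = g v x0 y"
    using C
  proof
    interpret d: bicompatible_action G X "\<lambda>v x y. g v y x" "\<lambda>v x y. f v y x" by (rule dual)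
    assume "C `` {y0} = {y0}"
    then show ?thesis using y v xX yX xy by (auto simp: d.fixed_iff_Image d.fixed_imp_f_eq)
  next
    assume "R `` {x0} \<subseteq> C `` {x0}"
    then show ?thesis using g_cong_C[OF _ v yX, of x0 x] x by auto
  qed
qed (use card in auto)

text \<open>Only the second coordinate is required to be autonomous here: the inclusion makes it
  blind to x, while the first may depend on both x and y.\<close>

lemma squares_commute_wreath_classes:
  assumes xy: "x0 \<in> X" "y0 \<in> X"
    and A: "R `` {x0} = {a1, a2}" "a1 \<noteq> a2" and B: "C `` {y0} = {b1, b2}" "b1 \<noteq> b2"
    and sub: "R `` {x0} \<subseteq> C `` {x0}"
  shows "squares_commute_at x0 y0"
proof (rule squares_commute_wreath[where A = "R `` {x0}" and B = "C `` {y0}", OF A _ B])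
  show sub': "R `` {x0} \<subseteq> X" "C `` {y0} \<subseteq> X" using R_subset C_subset by auto
  show "x0 \<in> R `` {x0}" "y0 \<in> C `` {y0}" using xy R_refl C_refl by (auto dest: refl_onD)
  fix v x y assume v: "v \<in> carrier G" and x: "x \<in> R `` {x0}" and y: "y \<in> C `` {y0}"
  have xX: "x \<in> X" and yX: "y \<in> X" using x y sub' by auto
  show "f v x y \<in> R `` {x0}" using x R_step[OF v xX yX] R_trans by (auto dest: transD)
  show "g v x y \<in> C `` {y0}" using y C_step[OF v yX xX] C_trans by (auto dest: transD)
  show "g v x y = g v x0 y" using g_cong_C[OF _ v yX, of x0 x] x sub by auto
qed

text \<open>With R total, v acts on first coordinates by a single permutation of \<open>X\<close>.
  It commutes with the maps g_u(x, .), whose steps connect all of \<open>X\<close> because C is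
  total, so its fixed points are all or nothing. The second coordinate is left to the dual
  statement.\<close>

lemma squares_commute_total:
  assumes R: "\<forall>x\<in>X. \<forall>y\<in>X. (x, y) \<in> R" and C: "\<forall>x\<in>X. \<forall>y\<in>X. (x, y) \<in> C"
    and xy: "x0 \<in> X" "y0 \<in> X" and ab: "a \<in> carrier G" "b \<in> carrier G"
  shows "f (a \<otimes> a \<otimes> (b \<otimes> b)) x0 y0 = f (b \<otimes> b \<otimes> (a \<otimes> a)) x0 y0"
proof -
  let ?f = "\<lambda>v x. f v x y0"
  obtain i j h k where X: "X = {i, j, h, k}" "distinct [i, j, h, k]"
    using card_X by (auto simp: numeral_eq_Suc card_Suc_eq)
  have indep: "f v x y = f v x y0" if "v \<in> carrier G" "x \<in> X" "y \<in> X" for v x y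
    using f_cong_R that R xy by blast
  have mult: "?f (u \<otimes> v) x = ?f u (?f v x)" if "u \<in> carrier G" "v \<in> carrier G" "x \<in> X" for u v x
    using that f_mult[OF that xy(2)] indep[of u "f v x y0" "g v x y0"] f_in g_in xy by simp
  \<comment> \<open>A fixed point is transported along C-steps, using that the C-moves commute with
    \<open>?f v\<close>. Below this is applied both to group elements and to their squares.\<close>
  have fp: "?f v x' = x'" if "v \<in> carrier G" "x \<in> X" "x' \<in> X" "?f v x = x" for v x x'
  proof -
    have "(x, x') \<in> C" using that C by blast
    then show ?thesis
    proof (induction rule: C_induct)
      case (step y u z)
      then show ?case using g_f[of v u z y y0] that xy by simp
    qed (use that in simp)
  qed
  have inj: "inj_on (?f v) X" if "v \<in> carrier G" for v
    by (rule hom_inj_on[OF _ mult that]) (use f_one xy in auto)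
  have img: "?f v ` X \<subseteq> X" if "v \<in> carrier G" for v using that f_in xy by auto
  have "?f a (?f a (?f b (?f b x0))) = ?f b (?f b (?f a (?f a x0)))"
  proof (rule squares_commute_semiregular[OF X xy(1)])
    show "?f a x' = x'" if "x \<in> X" "x' \<in> X" "?f a x = x" for x x' using fp ab that by blast
    show "?f b x' = x'" if "x \<in> X" "x' \<in> X" "?f b x = x" for x x' using fp ab that by blast
    show "?f a (?f a x') = x'" if "x \<in> X" "x' \<in> X" "?f a (?f a x) = x" for x x'
      using fp[of "a \<otimes> a" x x'] mult[of a a] ab that by simp
    show "?f b (?f b x') = x'" if "x \<in> X" "x' \<in> X" "?f b (?f b x) = x" for x x'
      using fp[of "b \<otimes> b" x x'] mult[of b b] ab that by simp
  qed (use inj img ab in blast)+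
  moreover have "f (u \<otimes> u \<otimes> (v \<otimes> v)) x0 y0 = ?f u (?f u (?f v (?f v x0)))"
    if "u \<in> carrier G" "v \<in> carrier G" for u v
    by (rule hom_squares[where Y = X and act = ?f])
      (erule (1) f_in[OF _ _ xy(2)], erule (2) mult, rule that(1), rule that(2), rule xy(1))
  ultimately show ?thesis using ab by simp
qed

lemma R_Image: "R `` {x} = {y \<in> X. (x, y) \<in> R}" 
  using R_subset by auto

text \<open>Totality of C makes g independent of x, and g preserves the pairing R, so second
  coordinates move in a dihedral group. First coordinates see y only through its R-class; replacing
  y by that class gives an action on a 2 by 2 grid, dihedral again.\<close>

lemma squares_commute_type22:
  assumes C: "\<forall>x\<in>X. \<forall>y\<in>X. (x, y) \<in> C"
    and X: "X = {i, j, h, k}" "distinct [i, j, h, k]"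
    and R: "(i, j) \<in> R" "(h, k) \<in> R" "(i, h) \<notin> R"
    and xy: "x0 \<in> X" "y0 \<in> X"
  shows "squares_commute_at x0 y0"
proof -
  \<comment> \<open>The pairing R is encoded by a predicate whose two fibres are its
    classes.\<close>
  define \<pi> where "\<pi> y \<longleftrightarrow> (i, y) \<in> R" for y
  have refl: "(x, x) \<in> R" if "x \<in> X" for x using R_refl that by (auto dest: refl_onD)
  have Rk: "(i, k) \<notin> R" using R R_sym R_trans by (meson symD transD)
  have \<pi>s: "\<pi> i" "\<pi> j" "\<not> \<pi> h" "\<not> \<pi> k" using R Rk refl X by (auto simp: \<pi>_def)
  have \<pi>_iff: "(x, y) \<in> R \<longleftrightarrow> \<pi> x = \<pi> y" if "x \<in> X" "y \<in> X" for x y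
  proof
    assume "(x, y) \<in> R" then show "\<pi> x = \<pi> y" using R_sym R_trans unfolding \<pi>_def by (meson symD transD)
  next
    assume "\<pi> x = \<pi> y"
    moreover have "(j, i) \<in> R" "(k, h) \<in> R" using R R_sym by (auto dest: symD)
    ultimately show "(x, y) \<in> R"
      using that \<pi>s refl[OF that(1)] R(1,2) unfolding X(1) by (elim insertE emptyE) simp_all
  qed
  have indep: "g v x y = g v x0 y" if "v \<in> carrier G" "x \<in> X" "y \<in> X" for v x y
    using g_cong_C[of x x0 v y] that C xy by blast
  let ?g = "\<lambda>v y. g v x0 y"
  have gm: "?g (u \<otimes> v) y = ?g u (?g v y)" if "u \<in> carrier G" "v \<in> carrier G" "y \<in> X" for u v y
    using that g_mult[OF that(1,2) xy(1) that(3)] indep[of u "f v x0 y" "g v x0 y"] f_in g_in xy by simp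
  have ginj: "inj_on (?g v) X" if "v \<in> carrier G" for v
    by (rule hom_inj_on[OF _ gm that]) (use g_one xy in auto)
  have gimg: "?g v ` X \<subseteq> X" if "v \<in> carrier G" for v using that g_in xy by auto
  have g\<pi>: "\<pi> (?g v y) = \<pi> (?g v y')" if "v \<in> carrier G" "y \<in> X" "y' \<in> X" "\<pi> y = \<pi> y'" for v y y'
    using g_preserves_R[of y y' v x0] \<pi>_iff[OF that(2,3)] that(1,4) xy
      \<pi>_iff[OF g_in[OF that(1) xy(1) that(2)] g_in[OF that(1) xy(1) that(3)]] by blast
  have g_eq: "g (a \<otimes> a \<otimes> (b \<otimes> b)) x0 y0 = g (b \<otimes> b \<otimes> (a \<otimes> a)) x0 y0"
    if ab: "a \<in> carrier G" "b \<in> carrier G" for a b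
  proof -
    have "?g a (?g a (?g b (?g b y0))) = ?g b (?g b (?g a (?g a y0)))"
    proof (rule squares_commute_blocks[OF X xy(2), where \<pi> = \<pi>])
      show "inj_on (?g a) X" "inj_on (?g b) X" using ginj ab by simp_all
      show "?g a ` X \<subseteq> X" "?g b ` X \<subseteq> X" using gimg ab by simp_all
      show "\<pi> (?g a y) = \<pi> (?g a y')" if "y \<in> X" "y' \<in> X" "\<pi> y = \<pi> y'" for y y'
        using g\<pi>[OF ab(1) that] .
      show "\<pi> (?g b y) = \<pi> (?g b y')" if "y \<in> X" "y' \<in> X" "\<pi> y = \<pi> y'" for y y'
        using g\<pi>[OF ab(2) that] .
    qed (use \<pi>s in simp_all)
    moreover have "g (u \<otimes> u \<otimes> (v \<otimes> v)) x0 y0 = ?g u (?g u (?g v (?g v y0)))"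
      if "u \<in> carrier G" "v \<in> carrier G" for u v
      by (rule hom_squares[where Y = X and act = ?g])
        (erule g_in[OF _ xy(1)], assumption, erule (2) gm, rule that(1), rule that(2), rule xy(2))
    ultimately show ?thesis using ab by simp
  qed
  \<comment> \<open>Each R-class is represented by i or h. As g preserves R, taking representatives
    after g gives a well-defined action on (R-class of x0) times {i, h}.\<close>
  define r where "r y = (if \<pi> y then i else h)" for y
  have rX: "r y \<in> X" for y using X by (simp add: r_def)
  have ry: "(y, r y) \<in> R" if "y \<in> X" for y using \<pi>_iff[OF that rX] \<pi>s by (simp add: r_def)
  have rr: "r y = r y' \<longleftrightarrow> \<pi> y = \<pi> y'" for y y' using X(2) by (auto simp: r_def)
  have f_r: "f v x (r y) = f v x y" if "v \<in> carrier G" "x \<in> X" "y \<in> X" for v x y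
    using f_cong_R[OF ry[OF that(3)] that(1,2)] by simp
  have g_r: "r (g v x (r y)) = r (g v x y)" if "v \<in> carrier G" "x \<in> X" "y \<in> X" for v x y
    unfolding rr using g_preserves_R[OF ry[OF that(3)] that(1,2)]
      \<pi>_iff[OF g_in[OF that] g_in[OF that(1,2) rX]] by blast
  have "R `` {x0} = (if \<pi> x0 then {i, j} else {h, k})"
    using \<pi>_iff[OF xy(1)] X \<pi>s unfolding R_Image by auto
  then obtain a1 a2 where A: "R `` {x0} = {a1, a2}" "a1 \<noteq> a2" using X(2) by (auto split: if_splits)
  define A' where "A' = R `` {x0}"
  have AX: "x \<in> X" if "x \<in> A'" for x using that R_subset by (auto simp: A'_def)
  have fA: "f v x y \<in> A'" if "v \<in> carrier G" "x \<in> A'" "y \<in> X" for v x y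
    using R_step[of v x y] AX that R_trans by (auto simp: A'_def dest: transD)
  let ?Y = "A' \<times> {i, h}" and ?act = "\<lambda>v (x, y). (f v x y, r (g v x y))"
  have Y: "?Y = {(a1, i), (a2, i), (a1, h), (a2, h)}" "distinct [(a1, i), (a2, i), (a1, h), (a2, h)]"
    using A X(2) by (auto simp: A'_def)
  have ihX: "i \<in> X" "h \<in> X" and ri: "r i = i" "r h = h" using X \<pi>s by (auto simp: r_def)
  have closed: "?act v z \<in> ?Y" if "v \<in> carrier G" "z \<in> ?Y" for v z
    using that fA ihX by (auto simp: r_def)
  have mult: "?act (u \<otimes> v) z = ?act u (?act v z)"
    if "u \<in> carrier G" "v \<in> carrier G" "z \<in> ?Y" for u v z
  proof -
    obtain x y where z: "z = (x, y)" "x \<in> A'" "x \<in> X" "y \<in> X" using \<open>z \<in> ?Y\<close> AX ihX by auto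
    show ?thesis using z that by (simp add: f_mult g_mult f_r g_r f_in g_in)
  qed
  have one: "?act \<one> z = z" if "z \<in> ?Y" for z
    using that AX ihX ri by (auto simp: f_one g_one)
  have inj: "inj_on (?act v) ?Y" if "v \<in> carrier G" for v
    using that by (intro hom_inj_on one mult)
  have bl: "snd (?act v z) = snd (?act v z')"
    if v: "v \<in> carrier G" and z: "z \<in> ?Y" "z' \<in> ?Y" "snd z = snd z'" for v z z'
  proof -
    obtain x x' y where "z = (x, y)" "z' = (x', y)" "x \<in> X" "x' \<in> X" "y \<in> X"
      using z AX ihX by (cases z, cases z') auto
    then show ?thesis using indep[of v x y] indep[of v x' y] v by simp
  qed
  have f_eq: "f (a \<otimes> a \<otimes> (b \<otimes> b)) x0 y0 = f (b \<otimes> b \<otimes> (a \<otimes> a)) x0 y0"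
    if ab: "a \<in> carrier G" "b \<in> carrier G" for a b
  proof -
    have z: "(x0, r y0) \<in> ?Y" using refl xy by (auto simp: A'_def r_def)
    have "?act a (?act a (?act b (?act b (x0, r y0)))) = ?act b (?act b (?act a (?act a (x0, r y0))))"
    proof (rule squares_commute_blocks[OF Y z, where \<pi> = snd])
      show "?act a ` ?Y \<subseteq> ?Y" using closed[OF ab(1)] by blast
      show "?act b ` ?Y \<subseteq> ?Y" using closed[OF ab(2)] by blast
      show "inj_on (?act a) ?Y" "inj_on (?act b) ?Y" using inj ab by blast+
      show "snd (?act a x) = snd (?act a x')" if "x \<in> ?Y" "x' \<in> ?Y" "snd x = snd x'" for x x'
        using bl[OF ab(1) that] .
      show "snd (?act b x) = snd (?act b x')" if "x \<in> ?Y" "x' \<in> ?Y" "snd x = snd x'" for x x'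
        using bl[OF ab(2) that] .
    qed (use X(2) in simp_all)
    then have "?act (a \<otimes> a \<otimes> (b \<otimes> b)) (x0, r y0) = ?act (b \<otimes> b \<otimes> (a \<otimes> a)) (x0, r y0)"
      using hom_squares[of ?Y ?act, OF closed mult ab z] hom_squares[of ?Y ?act, OF closed mult ab(2,1) z]
      by (simp only:)
    then show ?thesis using f_r[OF _ xy] ab by simp
  qed
  show ?thesis unfolding squares_commute_at_def using f_eq g_eq by blast
qed

text \<open>With C a single class, either all letters have singleton R-classes or none has. Types 31
  and 211 mix both kinds; types 4 and 22 are excluded by commuting squares.\<close>

lemma C_total_imp_R_trivial:
  assumes C: "\<forall>x\<in>X. \<forall>y\<in>X. (x, y) \<in> C"
    and xy: "x0 \<in> X" "y0 \<in> X" "\<not> squares_commute_at x0 y0"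
  shows "\<forall>x\<in>X. \<forall>y\<in>X. (x, y) \<in> R \<longrightarrow> x = y"
proof (cases rule: equiv_card_4_cases[OF card_X R_refl R_sym R_trans,
    case_names total trivial type31 type22 type211])
  case total
  interpret d: bicompatible_action G X "\<lambda>v x y. g v y x" "\<lambda>v x y. f v y x" by (rule dual)
  have "squares_commute_at x0 y0" unfolding squares_commute_at_def
    using squares_commute_total[OF total C xy(1,2)] d.squares_commute_total[OF C total xy(2,1)] by blast
  then show ?thesis using xy by blast
next
  case (type31 i j h k)
  then have "fixed k"
    using R_sym R_trans unfolding fixed_def by (metis R_subset insertE emptyE symD transD)
  then have "fixed i" using fixed_C C type31(1) by blast
  then show ?thesis using type31(2,3) by (auto simp: fixed_def)
next
  case (type22 i j h k)
  then show ?thesis using squares_commute_type22[OF C] xy by blast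
next
  case (type211 i j h k)
  then have "fixed h"
    using R_sym R_trans unfolding fixed_def by (metis R_subset insertE emptyE symD transD)
  then have "fixed i" using fixed_C C type211(1) by blast
  then show ?thesis using type211(2,3) by (auto simp: fixed_def)
qed


section \<open>Which pairs of partitions survive\<close>

lemma fixedI:
  assumes "X = {i, j, h, k}" "(i, j) \<notin> R" "(i, h) \<notin> R" "(i, k) \<notin> R"
  shows "fixed i"
  using assms R_subset unfolding fixed_def by blast

lemma R_Image_eq:
  assumes "X = Y"
  shows "R `` {x} = {y \<in> Y. (x, y) \<in> R}"
  unfolding R_Image using assms by simp

lemma squares_commute_fixed:
  assumes "x \<in> X" "y \<in> X" "fixed x" "card (C `` {y}) \<le> 3"
  shows "squares_commute_at x y"
proof (rule squares_commute_classes[OF assms(1,2)])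
  have "R `` {x} = {x}" using assms fixed_iff_Image by blast
  then show "card (R `` {x}) \<le> 3" "R `` {x} = {x} \<or> C `` {y} \<subseteq> R `` {y}"
    "C `` {y} = {y} \<or> R `` {x} \<subseteq> C `` {x}"
    using C_refl assms by (auto dest: refl_onD)
qed (rule assms)

lemma card_class_le_3:
  assumes "\<not> (\<forall>x\<in>X. \<forall>y\<in>X. (x, y) \<in> R)"
  shows "card (R `` {x}) \<le> 3"
proof (rule ccontr)
  have fin: "finite X" using card_X by (simp add: card_ge_0_finite)
  assume "\<not> ?thesis"
  then have "card (R `` {x}) = card X"
    using card_mono[OF fin, of "R `` {x}"] card_X R_Image by auto
  then have "R `` {x} = X" using card_subset_eq[OF fin, of "R `` {x}"] R_Image by auto
  then have "\<forall>y\<in>X. (x, y) \<in> R" by blast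
  then show False using assms R_sym R_trans by (meson symD transD)
qed

definition N_type :: "'a \<Rightarrow> 'a \<Rightarrow> 'a \<Rightarrow> 'a \<Rightarrow> bool" where
  "N_type i j h k \<longleftrightarrow> R `` {i} = {i, j} \<and> R `` {j} = {i, j} \<and> R `` {h} = {h} \<and> R `` {k} = {k}
     \<and> C `` {i} = {i} \<and> C `` {j} = {j} \<and> C `` {h} = {h, k} \<and> C `` {k} = {h, k}"

text \<open>The four letters are the corners of a square: R-classes are the rows ij and hk,
  C-classes the columns ih and jk.\<close>

definition T_type :: "'a \<Rightarrow> 'a \<Rightarrow> 'a \<Rightarrow> 'a \<Rightarrow> bool" where
  "T_type i j h k \<longleftrightarrow> R `` {i} = {i, j} \<and> R `` {j} = {i, j} \<and> R `` {h} = {h, k} \<and> R `` {k} = {h, k}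
     \<and> C `` {i} = {i, h} \<and> C `` {j} = {j, k} \<and> C `` {h} = {i, h} \<and> C `` {k} = {j, k}"

text \<open>With R = ij|hk, no letter can be a C-singleton, so C also consists of two pairs. If it
  equals R, all blocks are products; otherwise it is transversal to R.\<close>

lemma classification_type22:
  assumes X: "X = {i, j, h, k}" "distinct [i, j, h, k]"
    and R: "(i, j) \<in> R" "(h, k) \<in> R" "(i, h) \<notin> R"
    and xy: "x0 \<in> X" "y0 \<in> X" "\<not> squares_commute_at x0 y0"
    and C_total: "\<not> (\<forall>x\<in>X. \<forall>y\<in>X. (x, y) \<in> C)"
  shows "\<exists>i j h k. X = {i, j, h, k} \<and> distinct [i, j, h, k] \<and> T_type i j h k"
proof -
  interpret d: bicompatible_action G X "\<lambda>v x y. g v y x" "\<lambda>v x y. f v y x" by (rule dual)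
  have R_cls: "R `` {i} = {i, j}" "R `` {j} = {i, j}" "R `` {h} = {h, k}" "R `` {k} = {h, k}"
    if X: "X = {i, j, h, k}" and R: "(i, j) \<in> R" "(h, k) \<in> R" "(i, h) \<notin> R" for i j h k
  proof -
    have "(j, i) \<in> R" "(k, h) \<in> R" "(h, i) \<notin> R" "(j, h) \<notin> R" "(h, j) \<notin> R"
      "(i, k) \<notin> R" "(j, k) \<notin> R" "(k, i) \<notin> R" "(k, j) \<notin> R"
      using R R_sym R_trans by (meson symD transD)+
    moreover have "(i, i) \<in> R" "(j, j) \<in> R" "(h, h) \<in> R" "(k, k) \<in> R"
      using R_refl X by (auto dest: refl_onD)
    ultimately show "R `` {i} = {i, j}" "R `` {j} = {i, j}" "R `` {h} = {h, k}" "R `` {k} = {h, k}"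
      unfolding R_Image_eq[OF X] using R by auto
  qed
  have C3: "card (C `` {y}) \<le> 3" for y by (rule d.card_class_le_3[OF C_total])
  have sy: "(x, y) \<in> C \<longleftrightarrow> (y, x) \<in> C" for x y using C_sym by (auto dest: symD)
  have tr: "(x, z) \<in> C" if "(x, y) \<in> C" "(y, z) \<in> C" for x y z using C_trans that by (rule transD)
  have cr: "(x, x) \<in> C" if "x \<in> X" for x using C_refl that by (auto dest: refl_onD)
  \<comment> \<open>If i is a C-singleton, so is its R-partner j. Then C is trivial or i|j|hk, and
    every block obeys the law. The claim is quantified over labels because it is reused with the
    letters permuted.\<close>
  have not_fixed: "\<not> d.fixed i"
    if X: "X = {i, j, h, k}" "distinct [i, j, h, k]" and R: "(i, j) \<in> R" "(h, k) \<in> R" "(i, h) \<notin> R"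
    for i j h k
  proof
    note Rc = R_cls[OF X(1) R]
    have memX: "i \<in> X" "j \<in> X" "h \<in> X" "k \<in> X" using X(1) by auto
    have xy': "x0 \<in> {i, j, h, k}" "y0 \<in> {i, j, h, k}" using xy(1,2) X(1) by auto
    assume i: "d.fixed i"
    have j: "d.fixed j" using d.fixed_C R(1) i by blast
    have Ci: "C `` {i} = {i}" "C `` {j} = {j}" using i j X d.fixed_iff_Image by auto
    show False
    proof (cases "(h, k) \<in> C")
      case False
      have "d.fixed h" "d.fixed k"
        using i j False sy unfolding d.fixed_def by (metis C_subset X(1) insertE emptyE)+
      then have "d.fixed y0" using i j xy X by auto
      then have "squares_commute_at x0 y0"
        using d.squares_commute_fixed[OF xy(2,1)] Rc xy(1) X
        by (auto simp: dual_squares_commute_at card_insert_if)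
      then show False using xy(3) by blast
    next
      case True
      have hX: "h \<in> X" "k \<in> X" using X(1) by auto
      have "(i, h) \<notin> C" "(i, k) \<notin> C" "(j, h) \<notin> C" "(j, k) \<notin> C" using Ci X(2) by auto
      then have Cn: "(h, i) \<notin> C" "(k, i) \<notin> C" "(h, j) \<notin> C" "(k, j) \<notin> C" using sy by blast+
      have C: "C `` {h} = {h, k}" "C `` {k} = {h, k}"
        using True Cn sy[of k h] cr[OF hX(1)] cr[OF hX(2)]
        unfolding d.R_Image_eq[OF X(1)] by auto
      \<comment> \<open>On these blocks the C-class lies in an R-class, so the first coordinate
        moves autonomously and the second may depend on it. This is the dihedral case with the
        coordinates exchanged.\<close>
      have comm: "squares_commute_at x y" if "x \<in> {i, j}" "y \<in> {h, k}" for x y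
      proof -
        have "d.squares_commute_at y x"
        proof (rule d.squares_commute_wreath_classes)
          show "C `` {y} = {h, k}" using that C by auto
          show "R `` {x} = {i, j}" using that Rc by auto
          show "C `` {y} \<subseteq> R `` {y}" using that C Rc by auto
        qed (use that X in auto)
        then show ?thesis by (simp only: dual_squares_commute_at)
      qed
      have "squares_commute_at x0 y0"
      proof (cases "x0 \<in> {i, j} \<and> y0 \<in> {h, k}")
        case False
        then show ?thesis using xy'
          by (elim insertE emptyE; intro squares_commute_classes; simp add: memX C Ci Rc card_insert_if)
      qed (use comm in blast)
      then show False using xy(3) by blast
    qed
  qed
  \<comment> \<open>Once C links i with h, any further link from i would leave j or k as a
    C-singleton or make C total. Then j needs a partner, and only k is left.\<close>
  have finish: ?thesis if X: "X = {i, j, h, k}" "distinct [i, j, h, k]"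
    and R: "(i, j) \<in> R" "(h, k) \<in> R" "(i, h) \<notin> R" and C: "(i, h) \<in> C" for i j h k
  proof -
    have R': "(j, i) \<in> R" "(k, h) \<in> R" "(j, k) \<notin> R" "(k, i) \<notin> R"
      using R R_sym R_trans by (meson symD transD)+
    have nj: "\<not> d.fixed j" by (rule not_fixed[of j i k h]) (use X R' in auto)
    have nk: "\<not> d.fixed k" by (rule not_fixed[of k h i j]) (use X R' R_sym R in \<open>auto dest: symD\<close>)
    have total: "\<forall>x\<in>X. \<forall>y\<in>X. (x, y) \<in> C" if "\<forall>x\<in>X. (i, x) \<in> C" using that tr sy by blast
    have ij: "(i, j) \<notin> C"
    proof
      assume ij: "(i, j) \<in> C"
      have "(i, k) \<notin> C" using total C_total ij C cr X by auto
      then have "d.fixed k" using d.fixedI[of k i j h] ij C X sy tr by blast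
      then show False using nk by blast
    qed
    have ik: "(i, k) \<notin> C"
    proof
      assume ik: "(i, k) \<in> C"
      then have "d.fixed j" using d.fixedI[of j i h k] ij C X sy tr by blast
      then show False using nj by blast
    qed
    have jh: "(j, h) \<notin> C" using ij C sy tr by blast
    then have jk: "(j, k) \<in> C" using nj d.fixedI[of j i h k] ij X sy by blast
    have hk: "(h, k) \<notin> C" using ik C sy tr by blast
    have crX: "(i, i) \<in> C" "(j, j) \<in> C" "(h, h) \<in> C" "(k, k) \<in> C" using cr X(1) by auto
    have "C `` {i} = {i, h}" "C `` {j} = {j, k}" "C `` {h} = {i, h}" "C `` {k} = {j, k}"
      unfolding d.R_Image_eq[OF X(1)] using ij ik jh jk hk C crX
        sy[of j i] sy[of h i] sy[of k i] sy[of h j] sy[of k j] sy[of k h] by auto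
    then have "T_type i j h k" using R_cls[OF X(1) R] by (simp add: T_type_def)
    then show ?thesis using X by blast
  qed
  have sR: "(i, k) \<notin> R" "(k, h) \<in> R" using R R_sym R_trans by (meson symD transD)+
  show ?thesis
  proof (cases "(i, h) \<in> C \<or> (i, k) \<in> C")
    case True
    then show ?thesis
    proof
      assume "(i, k) \<in> C"
      moreover have "X = {i, j, k, h}" "distinct [i, j, k, h]" using X by auto
      ultimately show ?thesis using finish[of i j k h] R(1) sR by blast
    qed (rule finish[OF X R])
  next
    case False
    note Rc = R_cls[OF X(1) R]
    \<comment> \<open>Without a C-link between the two R-classes, the absence of C-singletons forces
      C = R, and then every block is a product.\<close>
    have ij: "(i, j) \<in> C" using d.fixedI[of i j h k] not_fixed[OF X R] False X by blast
    have "\<not> d.fixed h" by (rule not_fixed[of h k i j]) (use X R R_sym in \<open>auto dest: symD\<close>)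
    then have hk: "(h, k) \<in> C" using d.fixedI[of h i j k] ij False X sy tr by blast
    have crX: "(i, i) \<in> C" "(j, j) \<in> C" "(h, h) \<in> C" "(k, k) \<in> C" using cr X(1) by auto
    have "(j, h) \<notin> C" "(j, k) \<notin> C" using ij False sy tr by blast+
    then have C: "C `` {i} = {i, j}" "C `` {j} = {i, j}" "C `` {h} = {h, k}" "C `` {k} = {h, k}"
      unfolding d.R_Image_eq[OF X(1)] using ij hk False crX
        sy[of j i] sy[of h i] sy[of k i] sy[of h j] sy[of k j] sy[of k h] by auto
    have memX: "i \<in> X" "j \<in> X" "h \<in> X" "k \<in> X" using X(1) by auto
    have xy': "x0 \<in> {i, j, h, k}" "y0 \<in> {i, j, h, k}" using xy(1,2) X(1) by auto
    have "squares_commute_at x0 y0"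
      using xy'
      by (elim insertE emptyE; intro squares_commute_classes; simp add: memX C Rc card_insert_if)
    then show ?thesis using xy(3) by blast
  qed
qed

text \<open>For R = ijh|k only k is an R-singleton, so C does not link it to the rest. Dually i, j,
  h are all C-singletons or none is. Thus C is trivial or equal to R, and in both cases the blocks
  are products of sets with at most 3 points.\<close>

lemma not_type31:
  assumes X: "X = {i, j, h, k}" "distinct [i, j, h, k]"
    and R: "(i, j) \<in> R" "(i, h) \<in> R" "(i, k) \<notin> R"
    and xy: "x0 \<in> X" "y0 \<in> X" 
    and C_total: "\<not> (\<forall>x\<in>X. \<forall>y\<in>X. (x, y) \<in> C)"
  shows "squares_commute_at x0 y0"
proof -
  interpret d: bicompatible_action G X "\<lambda>v x y. g v y x" "\<lambda>v x y. f v y x" by (rule dual)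
  have sy: "(x, y) \<in> C \<longleftrightarrow> (y, x) \<in> C" for x y using C_sym by (auto dest: symD)
  have tr: "(x, z) \<in> C" if "(x, y) \<in> C" "(y, z) \<in> C" for x y z using C_trans that by (rule transD)
  have cr: "(x, x) \<in> C" if "x \<in> X" for x using C_refl that by (auto dest: refl_onD)
  have memX: "i \<in> X" "j \<in> X" "h \<in> X" "k \<in> X" using X(1) by auto
  have xy': "x0 \<in> {i, j, h, k}" "y0 \<in> {i, j, h, k}" using xy(1,2) X(1) by auto
  have crX: "(i, i) \<in> C" "(j, j) \<in> C" "(h, h) \<in> C" "(k, k) \<in> C" using cr memX by auto
  have R': "(j, i) \<in> R" "(h, i) \<in> R" "(j, h) \<in> R" "(h, j) \<in> R" "(k, i) \<notin> R" "(k, j) \<notin> R" "(k, h) \<notin> R"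
      "(j, k) \<notin> R" "(h, k) \<notin> R"
    using R R_sym R_trans by (meson symD transD)+
  have "(i, i) \<in> R" "(j, j) \<in> R" "(h, h) \<in> R" "(k, k) \<in> R"
    using R_refl X by (auto dest: refl_onD)
  then have Rc: "R `` {i} = {i, j, h}" "R `` {j} = {i, j, h}" "R `` {h} = {i, j, h}" "R `` {k} = {k}"
    unfolding R_Image_eq[OF X(1)] using R R' by auto
  have k: "fixed k" using Rc X fixed_iff_Image by auto
  have Ck: "(k, x) \<notin> C" if "x \<in> {i, j, h}" for x
  proof
    assume "(k, x) \<in> C"
    then have "fixed x" using fixed_C k by blast
    then have "R `` {x} = {x}" using fixed_iff_Image that X by auto
    then show False using Rc that X(2) by auto
  qed
  show ?thesis
  proof (cases "\<exists>x\<in>{i, j, h}. d.fixed x")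
    case True
    then have "d.fixed i" "d.fixed j" "d.fixed h" using d.fixed_C R R' by blast+
    moreover have "d.fixed k" using d.fixedI[of k i j h] Ck X by blast
    ultimately have "d.fixed y0" using X xy by auto
    moreover have "card (R `` {x0}) \<le> 3" using xy(1) X Rc by (auto simp: card_insert_if)
    ultimately show ?thesis
      using d.squares_commute_fixed[OF xy(2,1)] by (simp add: dual_squares_commute_at)
  next
    case False
    have "(i, j) \<in> C \<or> (i, h) \<in> C" "(j, i) \<in> C \<or> (j, h) \<in> C" "(h, i) \<in> C \<or> (h, j) \<in> C"
      using False d.fixedI[of i j h k] d.fixedI[of j i h k] d.fixedI[of h i j k] Ck sy X by blast+
    then have "(i, j) \<in> C" "(i, h) \<in> C" "(j, h) \<in> C" using sy tr by blast+
    then have C: "C `` {i} = {i, j, h}" "C `` {j} = {i, j, h}" "C `` {h} = {i, j, h}" "C `` {k} = {k}"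
      unfolding d.R_Image_eq[OF X(1)] using Ck crX
        sy[of j i] sy[of h i] sy[of i k] sy[of h j] sy[of j k] sy[of h k] by auto
    show ?thesis using xy'
      by (elim insertE emptyE; intro squares_commute_classes; simp add: memX C Rc card_insert_if)
  qed
qed

text \<open>For R = ij|h|k the R-singletons are h and k, so C refines ij|hk. If C links i and j,
  each block is a product or a dihedral grid; if C links nothing, y0 is a C-singleton. The remaining
  choice is C = i|j|hk.\<close>

lemma classification_type211:
  assumes X: "X = {i, j, h, k}" "distinct [i, j, h, k]"
    and R: "(i, j) \<in> R" "(h, k) \<notin> R" "(i, h) \<notin> R" "(i, k) \<notin> R"
    and xy: "x0 \<in> X" "y0 \<in> X" "\<not> squares_commute_at x0 y0"
    and C_total: "\<not> (\<forall>x\<in>X. \<forall>y\<in>X. (x, y) \<in> C)"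
  shows "N_type i j h k"
proof -
  interpret d: bicompatible_action G X "\<lambda>v x y. g v y x" "\<lambda>v x y. f v y x" by (rule dual)
  have sy: "(x, y) \<in> C \<longleftrightarrow> (y, x) \<in> C" for x y using C_sym by (auto dest: symD)
  have tr: "(x, z) \<in> C" if "(x, y) \<in> C" "(y, z) \<in> C" for x y z using C_trans that by (rule transD)
  have cr: "(x, x) \<in> C" if "x \<in> X" for x using C_refl that by (auto dest: refl_onD)
  have memX: "i \<in> X" "j \<in> X" "h \<in> X" "k \<in> X" using X(1) by auto
  have xy': "x0 \<in> {i, j, h, k}" "y0 \<in> {i, j, h, k}" using xy(1,2) X(1) by auto
  have crX: "(i, i) \<in> C" "(j, j) \<in> C" "(h, h) \<in> C" "(k, k) \<in> C" using cr memX by auto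
  have R': "(j, i) \<in> R" "(h, i) \<notin> R" "(j, h) \<notin> R" "(h, j) \<notin> R" "(k, i) \<notin> R" "(k, j) \<notin> R"
      "(k, h) \<notin> R" "(j, k) \<notin> R"
    using R R_sym R_trans by (meson symD transD)+
  have "(i, i) \<in> R" "(j, j) \<in> R" "(h, h) \<in> R" "(k, k) \<in> R"
    using R_refl X by (auto dest: refl_onD)
  then have Rc: "R `` {i} = {i, j}" "R `` {j} = {i, j}" "R `` {h} = {h}" "R `` {k} = {k}"
    unfolding R_Image_eq[OF X(1)] using R R' by auto
  have hk: "fixed h" "fixed k" and ij: "\<not> fixed i" "\<not> fixed j"
    using Rc X fixed_iff_Image by auto
  have cross: "(h, i) \<notin> C" "(h, j) \<notin> C" "(k, i) \<notin> C" "(k, j) \<notin> C"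
    using fixed_C hk ij by blast+
  have fixed_not: "\<not> d.fixed y0"
  proof
    assume "d.fixed y0"
    moreover have "card (R `` {x0}) \<le> 3" using xy(1) X Rc by (auto simp: card_insert_if)
    ultimately show False
      using d.squares_commute_fixed[OF xy(2,1)] xy(3) by (simp add: dual_squares_commute_at)
  qed
  have Ci: "C `` {i} = (if (i, j) \<in> C then {i, j} else {i})" "C `` {j} = (if (i, j) \<in> C then {i, j} else {j})"
    "C `` {h} = (if (h, k) \<in> C then {h, k} else {h})" "C `` {k} = (if (h, k) \<in> C then {h, k} else {k})"
    unfolding d.R_Image_eq[OF X(1)] using cross crX
        sy[of j i] sy[of i h] sy[of i k] sy[of j h] sy[of j k] sy[of k h] by auto
  show ?thesis
  proof (cases "(i, j) \<in> C")
    case True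
    have comm: "squares_commute_at x y" if "x \<in> {i, j}" "y \<in> {h, k}" "(h, k) \<in> C" for x y
    proof (rule squares_commute_wreath_classes)
      show "C `` {y} = {h, k}" using that Ci by auto
      show "R `` {x} = {i, j}" using that Rc by auto
      show "R `` {x} \<subseteq> C `` {x}" using that Ci Rc True by auto
    qed (use that X in auto)
    have "squares_commute_at x0 y0"
    proof (cases "x0 \<in> {i, j} \<and> y0 \<in> {h, k} \<and> (h, k) \<in> C")
      case False
      then show ?thesis using xy' True
        by (elim insertE emptyE; intro squares_commute_classes; simp add: memX Ci Rc card_insert_if)
    qed (use comm in blast)
    then show ?thesis using xy(3) by blast
  next
    case False
    have "(h, k) \<in> C"
    proof (rule ccontr)
      assume "(h, k) \<notin> C"
      then have "C `` {y0} = {y0}" using Ci False xy X by auto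
      then show False using fixed_not d.fixed_iff_Image xy by blast
    qed
    then show ?thesis using Ci Rc False by (simp add: N_type_def)
  qed
qed

text \<open>One bad point suffices: R and C are global objects, so the violation at that point
  restricts both partitions on all of \<open>X\<close>. Duality covers the case where R is
  total.\<close>

theorem classification:
  assumes xy: "x0 \<in> X" "y0 \<in> X" "\<not> squares_commute_at x0 y0"
  obtains "\<forall>x\<in>X. \<forall>y\<in>X. (x, y) \<in> R \<longrightarrow> x = y" "\<forall>x\<in>X. \<forall>y\<in>X. (x, y) \<in> C"
    | "\<forall>x\<in>X. \<forall>y\<in>X. (x, y) \<in> C \<longrightarrow> x = y" "\<forall>x\<in>X. \<forall>y\<in>X. (x, y) \<in> R"
    | i j h k where "X = {i, j, h, k}" "distinct [i, j, h, k]" "N_type i j h k"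
    | i j h k where "X = {i, j, h, k}" "distinct [i, j, h, k]" "T_type i j h k"
proof (cases "\<forall>x\<in>X. \<forall>y\<in>X. (x, y) \<in> C")
  case True
  show thesis by (rule that(1)[OF C_total_imp_R_trivial[OF True xy] True])
next
  case C: False
  interpret d: bicompatible_action G X "\<lambda>v x y. g v y x" "\<lambda>v x y. f v y x" by (rule dual)
  have nd: "\<not> d.squares_commute_at y0 x0" using xy by (simp add: dual_squares_commute_at)
  show thesis
  proof (cases rule: equiv_card_4_cases[OF card_X R_refl R_sym R_trans,
    case_names total trivial type31 type22 type211])
    case total
    show thesis by (rule that(2)[OF d.C_total_imp_R_trivial[OF total xy(2,1) nd] total])
  next
    case trivial
    then have "fixed x0" using xy R_subset by (auto simp: fixed_def)
    then show thesis using squares_commute_fixed[OF xy(1,2)] d.card_class_le_3[OF C] xy(3) by blast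
  next
    case (type31 i j h k)
    then show thesis using not_type31[OF type31 xy(1,2) C] xy(3) by blast
  next
    case (type22 i j h k)
    show thesis using classification_type22[OF type22 xy C] by (elim exE conjE) (rule that(4))
  next
    case (type211 i j h k)
    show thesis by (rule that(3)[OF type211(1,2) classification_type211[OF type211 xy C]])
  qed
qed

end

section \<open>Permutation groups\<close>

text \<open>A common form of \<open>sym_group\<close> and \<open>Sw\<close>, so that symmetric
  groups on letters, on words and on four-element sets of words can be compared.\<close>

definition perm_group :: "'a set \<Rightarrow> ('a \<Rightarrow> 'a) monoid" where
  "perm_group A = \<lparr>carrier = {p. p permutes A}, mult = (\<circ>), one = id\<rparr>"

lemma perm_group_simps [simp]:
  "p \<in> carrier (perm_group A) \<longleftrightarrow> p permutes A"
  "p \<otimes>\<^bsub>perm_group A\<^esub> q = p \<circ> q" "\<one>\<^bsub>perm_group A\<^esub> = id"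
  by (simp_all add: perm_group_def)

lemma carrier_perm_group: "carrier (perm_group A) = {p. p permutes A}"
  by (simp add: perm_group_def)

lemma group_perm_group: "group (perm_group A)"
proof (rule groupI)
  fix p assume "p \<in> carrier (perm_group A)"
  then show "\<exists>q\<in>carrier (perm_group A). q \<otimes>\<^bsub>perm_group A\<^esub> p = \<one>\<^bsub>perm_group A\<^esub>"
    by (intro bexI[of _ "inv' p"]) (simp_all add: permutes_inv permutes_inv_o)
qed (auto simp: permutes_compose permutes_id o_assoc)

lemma sym_group_eq_perm_group: "sym_group n = perm_group {1..n}"
  by (simp add: sym_group_def perm_group_def)

lemma perm_group_iso:
  assumes "bij_betw h A B"
  shows "perm_group A \<cong> perm_group B"
proof -
  have inj: "inj_on h A" using assms by (simp add: bij_betw_def)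
  have "bij_betw (map_permutation A h) {p. p permutes A} {p. p permutes B}"
  proof (rule bij_betwI[where g = "map_permutation B (inv_into A h)"])
    have inv: "bij_betw (inv_into A h) B A" using assms by (rule bij_betw_inv_into)
    show "map_permutation A h \<in> {p. p permutes A} \<rightarrow> {p. p permutes B}"
      using map_permutation_permutes[OF assms] by blast
    show "map_permutation B (inv_into A h) \<in> {p. p permutes B} \<rightarrow> {p. p permutes A}"
      using map_permutation_permutes[OF inv] by blast
    show "map_permutation B (inv_into A h) (map_permutation A h p) = p" if "p \<in> {p. p permutes A}" for p
      using that assms by (intro map_permutation_compose_inv) (auto simp: bij_betw_def)
    show "map_permutation A h (map_permutation B (inv_into A h) p) = p" if "p \<in> {p. p permutes B}" for p
      using that inv assms by (intro map_permutation_compose_inv) (auto simp: bij_betw_def f_inv_into_f)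
  qed
  then have "map_permutation A h \<in> iso (perm_group A) (perm_group B)"
    using map_permutation_permutes[OF assms] map_permutation_compose'[OF inj]
    by (intro isoI homI) (simp_all add: carrier_perm_group)
  then show ?thesis by (rule is_isoI)
qed

lemma perm_group_iso_sym_group:
  assumes "card Y = n" "finite Y"
  shows "perm_group Y \<cong> sym_group n"
proof -
  obtain h where "bij_betw h Y {1..n}"
    using finite_same_card_bij[of Y "{1..n}"] assms by auto
  then show ?thesis unfolding sym_group_eq_perm_group by (rule perm_group_iso)
qed

text \<open>All copies of S_4 constructed below arise this way, from a multiplicative and injective
  map defined on the permutations of four points.\<close>

lemma faithful_image:
  assumes closed: "\<And>p. p permutes Y \<Longrightarrow> \<Phi> p permutes W"
    and mult: "\<And>p q. \<lbrakk>p permutes Y; q permutes Y\<rbrakk> \<Longrightarrow> \<Phi> (p \<circ> q) = \<Phi> p \<circ> \<Phi> q"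
    and inj: "inj_on \<Phi> {p. p permutes Y}"
  shows "subgroup (\<Phi> ` {p. p permutes Y}) (perm_group W)" (is "subgroup ?I _")
    and "perm_group Y \<cong> perm_group W\<lparr>carrier := \<Phi> ` {p. p permutes Y}\<rparr>"
proof -
  have hom: "group_hom (perm_group Y) (perm_group W) \<Phi>"
    using closed mult by (intro group_hom.intro group_perm_group group_hom_axioms.intro homI) simp_all
  show "subgroup ?I (perm_group W)"
    using group_hom.img_is_subgroup[OF hom] by (simp add: carrier_perm_group)
  have "\<Phi> \<in> iso (perm_group Y) (perm_group W\<lparr>carrier := ?I\<rparr>)"
    using mult inj by (intro isoI homI) (auto simp: carrier_perm_group bij_betw_def)
  then show "perm_group Y \<cong> perm_group W\<lparr>carrier := ?I\<rparr>" by (rule is_isoI)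
qed

text \<open>Conjugating adjacent transpositions along the path gives all six. \<open>K\<close> is a
  set closed only under products of permutations of \<open>Y\<close>, because it will also be the
  preimage of a subgroup under a map that is multiplicative just on those.\<close>

lemma generated_by_path:
  assumes Y: "Y = {p1, p2, p3, p4}" "distinct [p1, p2, p3, p4]"
    and K: "id \<in> K" "\<And>p q. \<lbrakk>p \<in> K; q \<in> K; p permutes Y; q permutes Y\<rbrakk> \<Longrightarrow> p \<circ> q \<in> K"
    and t: "transpose p1 p2 \<in> K" "transpose p2 p3 \<in> K" "transpose p3 p4 \<in> K"
    and p: "p permutes Y"
  shows "p \<in> K"
proof -
  have Yt: "transpose x y permutes Y" if "x \<in> Y" "y \<in> Y" for x y using that by (rule permutes_swap_id)
  have conj: "transpose x z \<in> K"
    if "transpose x y \<in> K" "transpose y z \<in> K" "distinct [x, y, z]" "x \<in> Y" "y \<in> Y" "z \<in> Y" for x y z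
  proof -
    have "transpose x z = transpose x y \<circ> transpose y z \<circ> transpose x y"
      using that(3) by (auto simp: fun_eq_iff transpose_def)
    then show ?thesis using that K(2) Yt permutes_compose by metis
  qed
  have 13: "transpose p1 p3 \<in> K" using conj[OF t(1,2)] Y by simp
  have 24: "transpose p2 p4 \<in> K" using conj[OF t(2,3)] Y by simp
  have 14: "transpose p1 p4 \<in> K" using conj[OF 13 t(3)] Y by simp
  have "transpose x y \<in> K" if "x \<in> Y" "y \<in> Y" "x \<noteq> y" for x y
    using that t 13 24 14 unfolding Y(1) by (elim insertE emptyE) (simp_all add: transpose_commute)
  moreover have "finite Y" using Y by simp
  ultimately show ?thesis using p
    by (induction rule: permutes_induct[OF p \<open>finite Y\<close>]) (use K Yt in auto)
qed

text \<open>If z moves x, choose a third point w. The transposition of z x and w fixes x, so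
  commuting with it would give z x = w.\<close>

lemma perm_group_center_trivial:
  assumes "3 \<le> card A" "z permutes A" "\<And>p. p permutes A \<Longrightarrow> z \<circ> p = p \<circ> z"
  shows "z = id"
proof (rule ccontr)
  assume "z \<noteq> id"
  then obtain x where x: "z x \<noteq> x" by (auto simp: fun_eq_iff)
  then have xA: "x \<in> A" "z x \<in> A" using assms(2) permutes_not_in permutes_in_image by metis+
  have "card {x, z x} < card A" using assms(1) by (simp add: card_insert_if)
  then obtain w where w: "w \<in> A" "w \<notin> {x, z x}"
    by (metis card_mono finite.emptyI finite_insert not_less subsetI)
  have "z (transpose (z x) w x) = transpose (z x) w (z x)"
    using assms(3)[OF permutes_swap_id[OF xA(2) w(1)]] by (metis comp_apply)
  then show False using w x by (auto simp: transpose_def split: if_splits)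
qed

text \<open>Truth values under \<open>\<noteq>\<close> form the group of order 2. All transpositions
  are conjugate, hence take one common value \<open>c\<close>, and a homomorphism is determined by
  it: trivial or the sign.\<close>

lemma hom_to_bool_cases:
  assumes "finite A"
    and hom: "\<And>p q. \<lbrakk>p permutes A; q permutes A\<rbrakk> \<Longrightarrow> \<epsilon> (p \<circ> q) \<longleftrightarrow> \<epsilon> p \<noteq> \<epsilon> q"
  shows "\<exists>c. \<forall>p. p permutes A \<longrightarrow> (\<epsilon> p \<longleftrightarrow> c \<and> \<not> evenperm p)"
proof -
  note tA = permutes_swap_id[of _ A]
  have step: "\<epsilon> (transpose a b) = \<epsilon> (transpose a c)"
    if "a \<in> A" "b \<in> A" "c \<in> A" "distinct [a, b, c]" for a b c
  proof -
    have "transpose a c = transpose b c \<circ> transpose a b \<circ> transpose b c"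
      using that(4) by (auto simp: fun_eq_iff transpose_def)
    moreover have "transpose b c \<circ> transpose a b permutes A" using tA that permutes_compose by metis
    ultimately show ?thesis using hom tA that by metis
  qed
  have same: "\<epsilon> (transpose a b) = \<epsilon> (transpose c d)"
    if "a \<in> A" "b \<in> A" "c \<in> A" "d \<in> A" "a \<noteq> b" "c \<noteq> d" for a b c d
  proof (cases "c = a")
    case True
    then show ?thesis using that step[of a b d] by (cases "b = d") auto
  next
    case ca: False
    have 1: "\<epsilon> (transpose a b) = \<epsilon> (transpose a c)" using that ca step[of a b c] by (cases "b = c") auto
    have 2: "\<epsilon> (transpose c a) = \<epsilon> (transpose c d)" using that ca step[of c a d] by (cases "a = d") auto
    show ?thesis using 1 2 transpose_commute[of a c] by simp
  qed
  obtain c where c: "\<And>a b. \<lbrakk>a \<in> A; b \<in> A; a \<noteq> b\<rbrakk> \<Longrightarrow> \<epsilon> (transpose a b) = c"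
  proof (cases "\<exists>a b. a \<in> A \<and> b \<in> A \<and> a \<noteq> b")
    case True
    then obtain a b where "a \<in> A" "b \<in> A" "a \<noteq> b" by blast
    then show thesis by (intro that[of "\<epsilon> (transpose a b)"] same)
  next
    case False
    show thesis by (rule that[of True]) (use False in blast)
  qed
  have "\<epsilon> p \<longleftrightarrow> c \<and> \<not> evenperm p" if "p permutes A" for p
    using that assms(1)
  proof (induction rule: permutes_induct)
    case id
    show ?case using hom[OF permutes_id permutes_id] by (metis comp_id evenperm_id)
  next
    case (swap a b p)
    have "permutation p" using swap assms(1) permutation_permutes by blast
    then have "evenperm (transpose a b \<circ> p) \<longleftrightarrow> \<not> evenperm p"
      using swap by (simp add: evenperm_comp permutation_swap_id evenperm_swap)
    moreover have "\<epsilon> (transpose a b \<circ> p) \<longleftrightarrow> \<epsilon> (transpose a b) \<noteq> \<epsilon> p"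
      by (rule hom) (use swap tA in auto)
    moreover have "\<epsilon> (transpose a b) = c" using swap c by blast
    ultimately show ?case using swap by blast
  qed
  then show ?thesis by blast
qed

lemma sym_group_4_squares:
  "\<exists>a b. a permutes {1..4::nat} \<and> b permutes {1..4} \<and> a \<circ> a \<circ> (b \<circ> b) \<noteq> b \<circ> b \<circ> (a \<circ> a)"
proof (intro exI conjI)
  \<comment> \<open>These are the 3-cycles (1 2 3) and (1 2 4); their squares are their inverses,
    and two 3-cycles sharing exactly two points do not commute.\<close>
  let ?a = "transpose 1 2 \<circ> transpose 2 (3::nat)" and ?b = "transpose 1 2 \<circ> transpose 2 (4::nat)"
  show "?a permutes {1..4}" "?b permutes {1..4}" by (auto intro!: permutes_compose permutes_swap_id)
  have "(?a \<circ> ?a \<circ> (?b \<circ> ?b)) 1 \<noteq> (?b \<circ> ?b \<circ> (?a \<circ> ?a)) 1" by (simp add: transpose_def)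
  then show "?a \<circ> ?a \<circ> (?b \<circ> ?b) \<noteq> ?b \<circ> ?b \<circ> (?a \<circ> ?a)" by metis
qed

text \<open>The hypotheses describe \<open>Sym(Y) \<times> \<langle>\<tau>\<^sub>1\<rangle> \<times> \<langle>\<tau>\<^sub>2\<rangle>\<close> inside \<open>Sym(W)\<close>.\<close>

locale two_central_involutions =
  fixes W Y B1 B2 :: "'a set" and \<tau>1 \<tau>2 :: "'a \<Rightarrow> 'a"
  assumes card_Y: "card Y = 4" and sub: "Y \<subseteq> W" "B1 \<subseteq> W" "B2 \<subseteq> W"
    and disj: "Y \<inter> B1 = {}" "Y \<inter> B2 = {}" "B1 \<inter> B2 = {}"
    and \<tau>1: "\<tau>1 permutes B1" "\<tau>1 \<circ> \<tau>1 = id" "\<tau>1 \<noteq> id"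
    and \<tau>2: "\<tau>2 permutes B2" "\<tau>2 \<circ> \<tau>2 = id" "\<tau>2 \<noteq> id"
begin

text \<open>The element with coordinates \<open>\<sigma>\<close>, \<open>e1\<close>,
  \<open>e2\<close> of the direct product, the flags being the exponents of the two
  involutions.\<close>

definition \<Phi> :: "('a \<Rightarrow> 'a) \<Rightarrow> bool \<Rightarrow> bool \<Rightarrow> 'a \<Rightarrow> 'a" where
  "\<Phi> \<sigma> e1 e2 w = (if w \<in> Y then \<sigma> w else if e1 \<and> w \<in> B1 then \<tau>1 w else if e2 \<and> w \<in> B2 then \<tau>2 w else w)"

definition product :: "('a \<Rightarrow> 'a) set" where
  "product = {\<Phi> \<sigma> e1 e2 | \<sigma> e1 e2. \<sigma> permutes Y}"

text \<open>The flags \<open>c1\<close> and \<open>c2\<close> choose between the trivial character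
  and the sign in each central factor; the set is the graph of the resulting homomorphism.\<close>

definition sign_graph :: "bool \<Rightarrow> bool \<Rightarrow> ('a \<Rightarrow> 'a) set" where
  "sign_graph c1 c2 = (\<lambda>\<sigma>. \<Phi> \<sigma> (c1 \<and> \<not> evenperm \<sigma>) (c2 \<and> \<not> evenperm \<sigma>)) ` {\<sigma>. \<sigma> permutes Y}"

lemma finite_Y: "finite Y"
  using card_Y by (simp add: card_ge_0_finite)

lemma \<Phi>_mult:
  assumes "\<sigma> permutes Y" "\<sigma>' permutes Y"
  shows "\<Phi> \<sigma> e1 e2 \<circ> \<Phi> \<sigma>' e1' e2' = \<Phi> (\<sigma> \<circ> \<sigma>') (e1 \<noteq> e1') (e2 \<noteq> e2')"
proof
  fix w
  have m: "\<sigma>' w \<in> Y \<longleftrightarrow> w \<in> Y" "\<tau>1 w \<in> B1 \<longleftrightarrow> w \<in> B1" "\<tau>2 w \<in> B2 \<longleftrightarrow> w \<in> B2"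
    using assms \<tau>1(1) \<tau>2(1) by (simp_all add: permutes_in_image)
  have i: "\<tau>1 (\<tau>1 w) = w" "\<tau>2 (\<tau>2 w) = w" using \<tau>1(2) \<tau>2(2) by (metis comp_apply id_apply)+
  show "(\<Phi> \<sigma> e1 e2 \<circ> \<Phi> \<sigma>' e1' e2') w = \<Phi> (\<sigma> \<circ> \<sigma>') (e1 \<noteq> e1') (e2 \<noteq> e2') w"
  proof (cases "w \<in> Y")
    case False
    show ?thesis
    proof (cases "w \<in> B1")
      case True
      then have "\<tau>1 w \<notin> Y" "\<tau>1 w \<notin> B2" "w \<notin> B2" using m disj by blast+
      then show ?thesis using False True m i by (simp add: \<Phi>_def)
    next
      case w1: False
      show ?thesis
      proof (cases "w \<in> B2")
        case True
        then have "\<tau>2 w \<notin> Y" "\<tau>2 w \<notin> B1" using m disj by blast+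
        then show ?thesis using False w1 True m i by (simp add: \<Phi>_def)
      qed (use False w1 in \<open>simp add: \<Phi>_def\<close>)
    qed
  qed (use m in \<open>simp add: \<Phi>_def\<close>)
qed

lemma \<Phi>_id: "\<Phi> id False False = id"
  by (auto simp: \<Phi>_def)

lemma \<Phi>_generators:
  "\<sigma> permutes Y \<Longrightarrow> \<Phi> \<sigma> False False = \<sigma>" "\<Phi> id True False = \<tau>1" "\<Phi> id False True = \<tau>2"
  using disj by (auto simp: \<Phi>_def fun_eq_iff permutes_not_in permutes_not_in[OF \<tau>1(1)]
      permutes_not_in[OF \<tau>2(1)] disjoint_iff)

text \<open>Since \<open>\<tau>1\<close> and \<open>\<tau>2\<close> are involutions, inverting an
  element keeps its flags and inverts only \<open>\<sigma>\<close>.\<close>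

lemma \<Phi>_permutes:
  assumes "\<sigma> permutes Y"
  shows "\<Phi> \<sigma> e1 e2 permutes W"
proof -
  have "\<Phi> \<sigma> e1 e2 \<circ> \<Phi> (inv' \<sigma>) e1 e2 = id" "\<Phi> (inv' \<sigma>) e1 e2 \<circ> \<Phi> \<sigma> e1 e2 = id"
    using assms by (simp_all add: \<Phi>_mult permutes_inv permutes_inv_o \<Phi>_id)
  then have "bij (\<Phi> \<sigma> e1 e2)" by (rule o_bij[rotated])
  moreover have "\<Phi> \<sigma> e1 e2 w = w" if "w \<notin> W" for w using that sub by (auto simp: \<Phi>_def)
  ultimately show ?thesis by (simp add: permutes_def bij_iff)
qed

lemma \<Phi>_restrict:
  assumes "\<sigma> permutes Y"
  shows "(\<lambda>w. if w \<in> Y then \<Phi> \<sigma> e1 e2 w else w) = \<sigma>"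
  using assms by (auto simp: \<Phi>_def fun_eq_iff permutes_not_in)

text \<open>The flags can be read off from the permutation itself, which makes the decomposition
  unique.\<close>

lemma \<Phi>_moves:
  "(\<exists>w\<in>B1. \<Phi> \<sigma> e1 e2 w \<noteq> w) \<longleftrightarrow> e1" "(\<exists>w\<in>B2. \<Phi> \<sigma> e1 e2 w \<noteq> w) \<longleftrightarrow> e2"
proof -
  obtain w1 w2 where "\<tau>1 w1 \<noteq> w1" "\<tau>2 w2 \<noteq> w2" using \<tau>1(3) \<tau>2(3) by (auto simp: fun_eq_iff)
  then have "w1 \<in> B1" "w2 \<in> B2" "w1 \<notin> Y" "w2 \<notin> Y" "w2 \<notin> B1"
    using disj permutes_not_in[OF \<tau>1(1)] permutes_not_in[OF \<tau>2(1)] by blast+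
  then show "(\<exists>w\<in>B1. \<Phi> \<sigma> e1 e2 w \<noteq> w) \<longleftrightarrow> e1" "(\<exists>w\<in>B2. \<Phi> \<sigma> e1 e2 w \<noteq> w) \<longleftrightarrow> e2"
    using disj \<open>\<tau>1 w1 \<noteq> w1\<close> \<open>\<tau>2 w2 \<noteq> w2\<close> unfolding \<Phi>_def
    by (smt (verit) disjoint_iff)+
qed

lemma \<Phi>_eq_iff:
  assumes "\<sigma> permutes Y" "\<sigma>' permutes Y"
  shows "\<Phi> \<sigma> e1 e2 = \<Phi> \<sigma>' e1' e2' \<longleftrightarrow> \<sigma> = \<sigma>' \<and> e1 = e1' \<and> e2 = e2'"
proof
  assume eq: "\<Phi> \<sigma> e1 e2 = \<Phi> \<sigma>' e1' e2'"
  show "\<sigma> = \<sigma>' \<and> e1 = e1' \<and> e2 = e2'"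
    using \<Phi>_restrict[OF assms(1), of e1 e2] \<Phi>_restrict[OF assms(2), of e1' e2']
      \<Phi>_moves[of \<sigma> e1 e2] \<Phi>_moves[of \<sigma>' e1' e2'] unfolding eq by blast
qed simp

lemma subgroup_product: "subgroup product (perm_group W)"
proof (rule group.subgroupI[OF group_perm_group])
  show "product \<subseteq> carrier (perm_group W)" by (auto simp: product_def \<Phi>_permutes)
  show "product \<noteq> {}" using permutes_id[of Y] unfolding product_def by blast
  fix u v assume "u \<in> product" "v \<in> product"
  then obtain \<sigma> e1 e2 \<sigma>' e1' e2' where u: "u = \<Phi> \<sigma> e1 e2" "\<sigma> permutes Y"
    and v: "v = \<Phi> \<sigma>' e1' e2'" "\<sigma>' permutes Y" by (auto simp: product_def)
  have "u \<circ> v = \<Phi> (\<sigma> \<circ> \<sigma>') (e1 \<noteq> e1') (e2 \<noteq> e2')" "\<sigma> \<circ> \<sigma>' permutes Y"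
    using u v by (auto simp: \<Phi>_mult permutes_compose)
  then show "u \<otimes>\<^bsub>perm_group W\<^esub> v \<in> product" by (auto simp: product_def)
  have "\<Phi> (inv' \<sigma>) e1 e2 \<circ> u = id"
    using u by (simp add: \<Phi>_mult permutes_inv permutes_inv_o \<Phi>_id)
  then have "inv\<^bsub>perm_group W\<^esub> u = \<Phi> (inv' \<sigma>) e1 e2"
    using u by (intro group.inv_equality[OF group_perm_group]) (auto simp: \<Phi>_permutes permutes_inv)
  then show "inv\<^bsub>perm_group W\<^esub> u \<in> product" using u permutes_inv by (auto simp: product_def)
qed

text \<open>The first three generators are the edges of the path p1, p2, p3, p4; their orientation
  and order match the generators of \<open>N_group\<close>.\<close>

lemma generate_eq_product:
  assumes Y: "Y = {p1, p2, p3, p4}" "distinct [p1, p2, p3, p4]"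
  shows "generate (perm_group W) {transpose p2 p1, transpose p3 p4, transpose p2 p3, \<tau>1, \<tau>2} = product"
    (is "generate ?G ?S = _")
proof
  interpret group ?G by (rule group_perm_group)
  have inP: "\<Phi> \<sigma> e1 e2 \<in> product" if "\<sigma> permutes Y" for \<sigma> e1 e2
    using that unfolding product_def by blast
  have "transpose x y \<in> product" if "x \<in> Y" "y \<in> Y" for x y
    using inP[OF permutes_swap_id[OF that], of False False] \<Phi>_generators(1)[OF permutes_swap_id[OF that]]
    by simp
  moreover have "\<tau>1 \<in> product" "\<tau>2 \<in> product"
    using inP[OF permutes_id, of True False] inP[OF permutes_id, of False True]
    by (simp_all add: \<Phi>_generators)
  ultimately have "?S \<subseteq> product" using Y(1) by simp
  then show "generate ?G ?S \<subseteq> product" using subgroup_product by (rule generate_subgroup_incl)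
  have closed: "p \<circ> q \<in> generate ?G ?S" if "p \<in> generate ?G ?S" "q \<in> generate ?G ?S" for p q
    using generate.eng[OF that] by simp
  have id: "id \<in> generate ?G ?S" using generate.one[of ?G] by simp
  have gen: "s \<in> generate ?G ?S" if "s \<in> ?S" for s using that by (rule generate.incl)
  have \<sigma>: "\<sigma> \<in> generate ?G ?S" if "\<sigma> permutes Y" for \<sigma>
    using Y id closed
  proof (rule generated_by_path)
    show "transpose p1 p2 \<in> generate ?G ?S" using gen[of "transpose p2 p1"] by (simp add: transpose_commute)
  qed (use gen that in auto)
  show "product \<subseteq> generate ?G ?S"
  proof
    fix u assume "u \<in> product"
    then obtain \<sigma> e1 e2 where u: "u = \<Phi> \<sigma> e1 e2" "\<sigma> permutes Y" unfolding product_def by blast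
    have "u = \<Phi> \<sigma> False False \<circ> \<Phi> id e1 False \<circ> \<Phi> id False e2"
      using u by (simp add: \<Phi>_mult permutes_id)
    moreover have "\<Phi> \<sigma> False False \<in> generate ?G ?S" using u(2) \<sigma> by (simp add: \<Phi>_generators)
    moreover have "\<Phi> id e1 False \<in> generate ?G ?S" "\<Phi> id False e2 \<in> generate ?G ?S"
      using id gen by (cases e1; cases e2; simp add: \<Phi>_generators \<Phi>_id)+
    ultimately show "u \<in> generate ?G ?S" using closed by blast
  qed
qed

text \<open>Parity is additive under composition, so attaching it to the flags keeps the map
  multiplicative; it is injective because \<open>\<sigma>\<close> is one of the coordinates.\<close>

lemma sign_graph:
  shows sign_graph_subgroup: "subgroup (sign_graph c1 c2) (perm_group W)"
    and sign_graph_iso: "perm_group W\<lparr>carrier := sign_graph c1 c2\<rparr> \<cong> sym_group 4"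
    and sign_graph_subset: "sign_graph c1 c2 \<subseteq> product"
    and card_sign_graph: "card (sign_graph c1 c2) = 24"
proof -
  let ?\<Psi> = "\<lambda>\<sigma>. \<Phi> \<sigma> (c1 \<and> \<not> evenperm \<sigma>) (c2 \<and> \<not> evenperm \<sigma>)"
  have mult: "?\<Psi> (p \<circ> q) = ?\<Psi> p \<circ> ?\<Psi> q" if "p permutes Y" "q permutes Y" for p q
  proof -
    have "permutation p" "permutation q" using that finite_Y permutation_permutes by blast+
    then show ?thesis using that by (simp add: \<Phi>_mult evenperm_comp) (rule arg_cong2[of _ _ _ _ "\<Phi> (p \<circ> q)"]; blast)
  qed
  have inj: "inj_on ?\<Psi> {p. p permutes Y}" by (auto simp: inj_on_def \<Phi>_eq_iff)
  note fi = faithful_image[of Y ?\<Psi> W, OF \<Phi>_permutes mult inj]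
  show "subgroup (sign_graph c1 c2) (perm_group W)" using fi(1) by (simp add: sign_graph_def)
  show "perm_group W\<lparr>carrier := sign_graph c1 c2\<rparr> \<cong> sym_group 4"
    using fi(2) perm_group_iso_sym_group[OF card_Y finite_Y] group.iso_sym[OF group_perm_group]
    unfolding sign_graph_def by (metis (no_types, lifting) iso_trans)
  show "sign_graph c1 c2 \<subseteq> product" by (auto simp: sign_graph_def product_def)
  show "card (sign_graph c1 c2) = 24"
    using inj card_permutations[OF card_Y finite_Y] by (simp add: sign_graph_def card_image fact_numeral)
qed

text \<open>A transposition is odd, so the element above it displays both flags.\<close>

lemma sign_graph_inj: "sign_graph c1 c2 = sign_graph d1 d2 \<Longrightarrow> c1 = d1 \<and> c2 = d2"
proof -
  assume eq: "sign_graph c1 c2 = sign_graph d1 d2"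
  obtain a b where ab: "a \<in> Y" "b \<in> Y" "a \<noteq> b"
    using card_Y by (auto simp: numeral_eq_Suc card_Suc_eq)
  then have t: "transpose a b permutes Y" "\<not> evenperm (transpose a b)"
    by (simp_all add: permutes_swap_id evenperm_swap)
  then have "\<Phi> (transpose a b) c1 c2 \<in> sign_graph c1 c2" by (auto simp: sign_graph_def image_iff)
  then obtain \<sigma> where "\<sigma> permutes Y"
    "\<Phi> (transpose a b) c1 c2 = \<Phi> \<sigma> (d1 \<and> \<not> evenperm \<sigma>) (d2 \<and> \<not> evenperm \<sigma>)"
    unfolding eq by (auto simp: sign_graph_def)
  then show ?thesis using t by (auto simp: \<Phi>_eq_iff)
qed

text \<open>Since \<open>S\<^sub>4\<close> is centreless, such a subgroup meets the central factor trivially, so it projects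
  isomorphically onto \<open>Sym(Y)\<close> and is the graph of a homomorphism to \<open>\<int>\<^sub>2 \<times> \<int>\<^sub>2\<close>.\<close>

lemma subgroup_iso_sym_group_4:
  assumes U: "subgroup U (perm_group W)" "U \<subseteq> product"
    and iso: "perm_group W\<lparr>carrier := U\<rparr> \<cong> sym_group 4"
  shows "\<exists>c1 c2. U = sign_graph c1 c2"
proof -
  have "group (perm_group W\<lparr>carrier := U\<rparr>)" using U(1) by (rule subgroup.subgroup_is_group[OF _ group_perm_group])
  then obtain \<phi> where \<phi>: "\<phi> \<in> iso (sym_group 4) (perm_group W\<lparr>carrier := U\<rparr>)"
    using group.iso_sym[OF _ iso] by (auto simp: is_iso_def)
  have \<phi>_bij: "bij_betw \<phi> {p. p permutes {1..4}} U"
    using \<phi> by (simp add: iso_def sym_group_def)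
  have \<phi>_mult: "\<phi> (p \<circ> q) = \<phi> p \<circ> \<phi> q" if "p permutes {1..4}" "q permutes {1..4}" for p q
    using \<phi> that by (auto simp: iso_def hom_def sym_group_def perm_group_def)
  define \<pi> where "\<pi> u = (\<lambda>w. if w \<in> Y then u w else w)" for u :: "'a \<Rightarrow> 'a"
  define \<epsilon>1 where "\<epsilon>1 u \<longleftrightarrow> (\<exists>w\<in>B1. u w \<noteq> w)" for u :: "'a \<Rightarrow> 'a"
  define \<epsilon>2 where "\<epsilon>2 u \<longleftrightarrow> (\<exists>w\<in>B2. u w \<noteq> w)" for u :: "'a \<Rightarrow> 'a"
  have decomp: "\<pi> u permutes Y \<and> u = \<Phi> (\<pi> u) (\<epsilon>1 u) (\<epsilon>2 u)" if u: "u \<in> U" for u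
  proof -
    obtain \<sigma> e1 e2 where "u = \<Phi> \<sigma> e1 e2" "\<sigma> permutes Y" using u U(2) unfolding product_def by blast
    then show ?thesis using \<Phi>_restrict \<Phi>_moves by (simp add: \<pi>_def \<epsilon>1_def \<epsilon>2_def)
  qed
  have mult: "\<pi> (u \<circ> v) = \<pi> u \<circ> \<pi> v \<and> (\<epsilon>1 (u \<circ> v) \<longleftrightarrow> \<epsilon>1 u \<noteq> \<epsilon>1 v) \<and> (\<epsilon>2 (u \<circ> v) \<longleftrightarrow> \<epsilon>2 u \<noteq> \<epsilon>2 v)"
    if "u \<in> U" "v \<in> U" for u v
  proof -
    have uv: "u \<circ> v \<in> U" using subgroup.m_closed[OF U(1) that] by simp
    have "\<Phi> (\<pi> (u \<circ> v)) (\<epsilon>1 (u \<circ> v)) (\<epsilon>2 (u \<circ> v)) = u \<circ> v" using decomp[OF uv] by simp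
    also have "\<dots> = \<Phi> (\<pi> u) (\<epsilon>1 u) (\<epsilon>2 u) \<circ> \<Phi> (\<pi> v) (\<epsilon>1 v) (\<epsilon>2 v)"
      using decomp[OF that(1)] decomp[OF that(2)] by simp
    also have "\<dots> = \<Phi> (\<pi> u \<circ> \<pi> v) (\<epsilon>1 u \<noteq> \<epsilon>1 v) (\<epsilon>2 u \<noteq> \<epsilon>2 v)"
      using decomp that by (intro \<Phi>_mult) auto
    finally have eq: "\<Phi> (\<pi> (u \<circ> v)) (\<epsilon>1 (u \<circ> v)) (\<epsilon>2 (u \<circ> v)) = \<dots>" .
    have "\<pi> (u \<circ> v) permutes Y" "\<pi> u \<circ> \<pi> v permutes Y"
      using decomp uv that permutes_compose by blast+
    from iffD1[OF \<Phi>_eq_iff[OF this] eq] show ?thesis .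
  qed
  have \<phi>_U: "\<phi> p \<in> U" if "p permutes {1..4}" for p using \<phi>_bij that by (auto simp: bij_betw_def)
  \<comment> \<open>An element whose \<open>Y\<close>-component is trivial is a product of the
    central involutions, hence commutes with all of \<open>U\<close>. Its preimage is central in
    S_4.\<close>
  have center: "z = id" if z: "z permutes {1..4}" "\<pi> (\<phi> z) = id" for z
  proof (rule perm_group_center_trivial[OF _ z(1)])
    fix p :: "nat \<Rightarrow> nat" assume p: "p permutes {1..4}"
    obtain e1 e2 where fz: "\<phi> z = \<Phi> id e1 e2" using decomp[OF \<phi>_U[OF z(1)]] z(2) by metis
    obtain \<sigma> d1 d2 where fp: "\<phi> p = \<Phi> \<sigma> d1 d2" "\<sigma> permutes Y" using decomp[OF \<phi>_U[OF p]] by blast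
    have "(e1 \<noteq> d1) = (d1 \<noteq> e1)" "(e2 \<noteq> d2) = (d2 \<noteq> e2)" by blast+
    then have "\<phi> z \<circ> \<phi> p = \<phi> p \<circ> \<phi> z"
      unfolding fz fp(1) \<Phi>_mult[OF permutes_id fp(2)] \<Phi>_mult[OF fp(2) permutes_id] by (simp only: comp_id id_comp)
    then have "\<phi> (z \<circ> p) = \<phi> (p \<circ> z)" unfolding \<phi>_mult[OF z(1) p] \<phi>_mult[OF p z(1)] .
    then show "z \<circ> p = p \<circ> z"
      by (rule inj_onD[OF bij_betw_imp_inj_on[OF \<phi>_bij]]) (simp_all only: mem_Collect_eq permutes_compose p z(1))
  qed simp
  have inj: "inj_on (\<pi> \<circ> \<phi>) {p. p permutes {1..4}}"
  proof (rule inj_onI)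
    fix p q :: "nat \<Rightarrow> nat" assume "p \<in> {p. p permutes {1..4}}" "q \<in> {p. p permutes {1..4}}"
      and eq: "(\<pi> \<circ> \<phi>) p = (\<pi> \<circ> \<phi>) q"
    then have p: "p permutes {1..4}" and q: "q permutes {1..4}" by auto
    have iq: "inv' q permutes {1..4}" using q by (rule permutes_inv)
    have "\<pi> (\<phi> (inv' q \<circ> p)) = \<pi> (\<phi> (inv' q \<circ> q))"
      using eq \<phi>_mult[OF iq p] \<phi>_mult[OF iq q] mult[OF \<phi>_U[OF iq] \<phi>_U[OF p]] mult[OF \<phi>_U[OF iq] \<phi>_U[OF q]]
      by simp
    also have "\<dots> = id"
    proof -
      have "\<phi> id \<circ> \<phi> id = \<phi> id" using \<phi>_mult[OF permutes_id permutes_id] by simp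
      then have "\<pi> (\<phi> id) \<circ> \<pi> (\<phi> id) = \<pi> (\<phi> id)" using mult[OF \<phi>_U[OF permutes_id] \<phi>_U[OF permutes_id]] by simp
      moreover have "\<pi> (\<phi> id) permutes Y" using decomp \<phi>_U permutes_id by blast
      ultimately have "\<pi> (\<phi> id) = id" by (metis comp_id fun.map_id0 o_assoc permutes_inv_o(2) id_comp)
      then show ?thesis using q by (simp add: permutes_inv_o)
    qed
    finally have "inv' q \<circ> p = id" using center permutes_compose[OF p iq] by blast
    then show "p = q" using q by (metis comp_id id_comp o_assoc permutes_inv_o(1))
  qed
  \<comment> \<open>An injection between two sets of 24 permutations.\<close>
  have surj: "(\<pi> \<circ> \<phi>) ` {p. p permutes {1..4}} = {\<sigma>. \<sigma> permutes Y}"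
  proof (rule card_subset_eq)
    show "finite {\<sigma>. \<sigma> permutes Y}" using finite_Y by (rule finite_permutations)
    show "(\<pi> \<circ> \<phi>) ` {p. p permutes {1..4}} \<subseteq> {\<sigma>. \<sigma> permutes Y}" using decomp \<phi>_U by auto
    show "card ((\<pi> \<circ> \<phi>) ` {p. p permutes {1..4}}) = card {\<sigma>. \<sigma> permutes Y}"
      using card_image[OF inj] card_permutations[OF card_Y finite_Y] card_permutations[of "{1..4::nat}" 4] by simp
  qed
  have hom_cases: "\<exists>c. \<forall>p. p permutes {1..4} \<longrightarrow> (\<epsilon> (\<phi> p) \<longleftrightarrow> c \<and> \<not> evenperm p)"
    if "\<And>u v. \<lbrakk>u \<in> U; v \<in> U\<rbrakk> \<Longrightarrow> \<epsilon> (u \<circ> v) \<longleftrightarrow> \<epsilon> u \<noteq> \<epsilon> v" for \<epsilon>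
    by (rule hom_to_bool_cases) (use that \<phi>_mult \<phi>_U in auto)
  obtain c1 where c1: "\<And>p. p permutes {1..4} \<Longrightarrow> \<epsilon>1 (\<phi> p) \<longleftrightarrow> c1 \<and> \<not> evenperm p"
    using hom_cases[of \<epsilon>1] mult by blast
  obtain c2 where c2: "\<And>p. p permutes {1..4} \<Longrightarrow> \<epsilon>2 (\<phi> p) \<longleftrightarrow> c2 \<and> \<not> evenperm p"
    using hom_cases[of \<epsilon>2] mult by blast
  \<comment> \<open>So far the flags are expressed through the parity of p on {1..4}, whereas
    \<open>sign_graph\<close> uses the parity on \<open>Y\<close>. The latter is also a homomorphism
    to the group of order 2 in p; it is nontrivial because a transposition of \<open>Y\<close> is
    attained, so the two parities agree.\<close>
  have "\<exists>c. \<forall>p. p permutes {1..4} \<longrightarrow> (\<not> evenperm (\<pi> (\<phi> p)) \<longleftrightarrow> c \<and> \<not> evenperm p)"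
  proof (rule hom_cases)
    fix u v assume "u \<in> U" "v \<in> U"
    then have "permutation (\<pi> u)" "permutation (\<pi> v)" "\<pi> (u \<circ> v) = \<pi> u \<circ> \<pi> v"
      using decomp mult finite_Y permutation_permutes by blast+
    then show "\<not> evenperm (\<pi> (u \<circ> v)) \<longleftrightarrow> (\<not> evenperm (\<pi> u)) \<noteq> (\<not> evenperm (\<pi> v))"
      by (simp add: evenperm_comp)
  qed
  then obtain c where c: "\<And>p. p permutes {1..4} \<Longrightarrow> \<not> evenperm (\<pi> (\<phi> p)) \<longleftrightarrow> c \<and> \<not> evenperm p" by blast
  have c
  proof -
    obtain a b where ab: "a \<in> Y" "b \<in> Y" "a \<noteq> b"
      using card_Y by (auto simp: numeral_eq_Suc card_Suc_eq)
    then have "transpose a b \<in> (\<pi> \<circ> \<phi>) ` {p. p permutes {1..4}}" unfolding surj by (simp add: permutes_swap_id)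
    then obtain p where "p permutes {1..4}" "\<pi> (\<phi> p) = transpose a b" by auto
    then show ?thesis using c[of p] ab by (simp add: evenperm_swap)
  qed
  have "U \<subseteq> sign_graph c1 c2"
  proof
    fix u assume u: "u \<in> U"
    then obtain p where p: "p permutes {1..4}" "u = \<phi> p" using \<phi>_bij by (auto simp: bij_betw_def)
    then have "\<epsilon>1 u \<longleftrightarrow> c1 \<and> \<not> evenperm (\<pi> u)" "\<epsilon>2 u \<longleftrightarrow> c2 \<and> \<not> evenperm (\<pi> u)"
      using c1 c2 c \<open>c\<close> by auto
    then show "u \<in> sign_graph c1 c2" using decomp[OF u] unfolding sign_graph_def by auto
  qed
  moreover have "card U = 24"
    using bij_betw_same_card[OF \<phi>_bij] card_permutations[of "{1..4::nat}" 4] by (simp add: fact_numeral)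
  moreover have "finite (sign_graph c1 c2)" using card_sign_graph by (simp add: card_ge_0_finite)
  ultimately have "U = sign_graph c1 c2" using card_subset_eq card_sign_graph by metis
  then show ?thesis by blast
qed

end

section \<open>Permutations of words\<close>

declare One_nat_def [simp del]

lemma Sw_eq_perm_group: "Sw n t = perm_group (words n t)"
  by (simp add: Sw_def perm_group_def)

lemma group_Sw: "group (Sw n t)"
  by (simp add: Sw_eq_perm_group group_perm_group)

lemma finite_words: "finite (words n t)"
proof -
  have "words n t = {w. set w \<subseteq> {1..n} \<and> length w = t}" by (auto simp: words_def)
  then show ?thesis using finite_lists_length_eq[of "{1..n}" t] by simp
qed

lemma words_1: "w \<in> words n 1 \<longleftrightarrow> (\<exists>x\<in>{1..n}. w = [x])"
  by (auto simp: words_def length_Suc_conv One_nat_def)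

lemma words_2: "w \<in> words n 2 \<longleftrightarrow> (\<exists>x\<in>{1..n}. \<exists>y\<in>{1..n}. w = [x, y])"
  by (auto simp: words_def length_Suc_conv numeral_eq_Suc)

lemma words_3: "w \<in> words n 3 \<longleftrightarrow> (\<exists>x\<in>{1..n}. \<exists>y\<in>{1..n}. \<exists>z\<in>{1..n}. w = [x, y, z])"
  by (auto simp: words_def length_Suc_conv numeral_eq_Suc)

text \<open>Together with \<open>coord2\<close> this is the pair f_v, g_v, in the form expected by
  \<open>bicompatible_action\<close>.\<close>

definition coord1 :: "(nat list \<Rightarrow> nat list) \<Rightarrow> nat \<Rightarrow> nat \<Rightarrow> nat" where
  "coord1 v x y = v [x, y] ! 0"

definition coord2 :: "(nat list \<Rightarrow> nat list) \<Rightarrow> nat \<Rightarrow> nat \<Rightarrow> nat" where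
  "coord2 v x y = v [x, y] ! 1"

lemma coords:
  assumes "v permutes words n 2" "x \<in> {1..n}" "y \<in> {1..n}"
  shows "v [x, y] = [coord1 v x y, coord2 v x y]" "coord1 v x y \<in> {1..n}" "coord2 v x y \<in> {1..n}"
proof -
  have "[x, y] \<in> words n 2" using assms(2,3) unfolding words_2 by blast
  then have "v [x, y] \<in> words n 2" by (simp only: permutes_in_image[OF assms(1)])
  then show "v [x, y] = [coord1 v x y, coord2 v x y]" "coord1 v x y \<in> {1..n}" "coord2 v x y \<in> {1..n}"
    by (auto simp: words_2 coord1_def coord2_def)
qed

lemma permutes_words_eqI:
  assumes "u permutes words n 2" "v permutes words n 2"
    and "\<And>x y. \<lbrakk>x \<in> {1..n}; y \<in> {1..n}\<rbrakk> \<Longrightarrow> coord1 u x y = coord1 v x y \<and> coord2 u x y = coord2 v x y"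
  shows "u = v"
proof
  fix w
  show "u w = v w"
  proof (cases "w \<in> words n 2")
    case True
    then show ?thesis using assms by (auto simp: words_2 coords)
  qed (use assms in \<open>simp add: permutes_not_in\<close>)
qed

text \<open>Both composites are the identity off the words of length 3. On [x, y, z] the element u
  acts on the last two letters and v on the first two, and the equations compare the three output
  letters.\<close>

lemma compatible_iff:
  assumes u: "u permutes words n 2" and v: "v permutes words n 2"
  shows "compatible n u v \<longleftrightarrow> (\<forall>x\<in>{1..n}. \<forall>y\<in>{1..n}. \<forall>z\<in>{1..n}.
    coord1 v x (coord1 u y z) = coord1 v x y \<and>
    coord2 v x (coord1 u y z) = coord1 u (coord2 v x y) z \<and>
    coord2 u (coord2 v x y) z = coord2 u y z)" (is "_ \<longleftrightarrow> ?R")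
proof -
  let ?l = "tensor n 2 1 v id \<circ> tensor n 1 2 id u" and ?r = "tensor n 1 2 id u \<circ> tensor n 2 1 v id"
  have t1: "tensor n 1 2 id u [x, y, z] = [x, coord1 u y z, coord2 u y z]"
    and t2: "tensor n 2 1 v id [x, y, z] = [coord1 v x y, coord2 v x y, z]"
    if "x \<in> {1..n}" "y \<in> {1..n}" "z \<in> {1..n}" for x y z
  proof -
    have "[x, y, z] \<in> words n 3" using that by (simp add: words_3)
    then show "tensor n 1 2 id u [x, y, z] = [x, coord1 u y z, coord2 u y z]"
      "tensor n 2 1 v id [x, y, z] = [coord1 v x y, coord2 v x y, z]"
      using coords(1)[OF u that(2,3)] coords(1)[OF v that(1,2)] by (simp_all add: tensor_def numeral_eq_Suc One_nat_def)
  qed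
  have l: "?l [x, y, z] = [coord1 v x (coord1 u y z), coord2 v x (coord1 u y z), coord2 u y z]"
    and r: "?r [x, y, z] = [coord1 v x y, coord1 u (coord2 v x y) z, coord2 u (coord2 v x y) z]"
    if "x \<in> {1..n}" "y \<in> {1..n}" "z \<in> {1..n}" for x y z
    using t1[OF that] t2[OF that] t2[OF that(1) coords(2,3)[OF u that(2,3)]]
      t1[OF coords(2,3)[OF v that(1,2)] that(3)] by simp_all
  have "?l w = ?r w" if "w \<notin> words n 3" for w using that by (simp add: tensor_def)
  then have "?l = ?r \<longleftrightarrow> (\<forall>w\<in>words n 3. ?l w = ?r w)" by (auto simp: fun_eq_iff)
  also have "\<dots> \<longleftrightarrow> (\<forall>x\<in>{1..n}. \<forall>y\<in>{1..n}. \<forall>z\<in>{1..n}. ?l [x, y, z] = ?r [x, y, z])"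
    unfolding Ball_def words_3 by blast
  also have "\<dots> \<longleftrightarrow> ?R" using l r by auto
  finally show ?thesis unfolding compatible_def .
qed

lemma bicompatible_subgroupI:
  assumes "subgroup V (Sw n 2)"
    and "\<And>u v x y z. \<lbrakk>u \<in> V; v \<in> V; x \<in> {1..n}; y \<in> {1..n}; z \<in> {1..n}\<rbrakk> \<Longrightarrow>
      coord1 v x (coord1 u y z) = coord1 v x y \<and>
      coord2 v x (coord1 u y z) = coord1 u (coord2 v x y) z \<and>
      coord2 u (coord2 v x y) z = coord2 u y z"
  shows "bicompatible_subgroup n V"
proof -
  have "v permutes words n 2" if "v \<in> V" for v
    using subgroup.subset[OF assms(1)] that by (auto simp: Sw_eq_perm_group)
  then show ?thesis
    using assms unfolding bicompatible_subgroup_def bicompatible_def by (simp add: compatible_iff)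
qed

lemma coord_comp:
  assumes "u permutes words n 2" "v permutes words n 2" "x \<in> {1..n}" "y \<in> {1..n}"
  shows "coord1 (u \<circ> v) x y = coord1 u (coord1 v x y) (coord2 v x y)"
    and "coord2 (u \<circ> v) x y = coord2 u (coord1 v x y) (coord2 v x y)"
  using coords(1)[OF assms(2-4)] by (simp_all add: coord1_def coord2_def)

lemma bicompatible_action_subgroup:
  assumes "bicompatible_subgroup 4 V"
  shows "bicompatible_action (Sw 4 2\<lparr>carrier := V\<rparr>) {1..4} coord1 coord2"
proof -
  have sub: "subgroup V (perm_group (words 4 2))"
    using assms by (simp add: bicompatible_subgroup_def Sw_eq_perm_group)
  have perm: "v permutes words 4 2" if "v \<in> V" for v
    using subgroup.subset[OF sub] that by auto
  have compat: "coord1 v x (coord1 u y z) = coord1 v x y \<and>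
      coord2 v x (coord1 u y z) = coord1 u (coord2 v x y) z \<and>
      coord2 u (coord2 v x y) z = coord2 u y z"
    if "u \<in> V" "v \<in> V" "x \<in> {1..4}" "y \<in> {1..4}" "z \<in> {1..4}" for u v x y z
  proof -
    have "compatible 4 u v"
      using assms that unfolding bicompatible_subgroup_def bicompatible_def by blast
    then show ?thesis using compatible_iff[OF perm[OF that(1)] perm[OF that(2)]] that by blast
  qed
  interpret group "Sw 4 2\<lparr>carrier := V\<rparr>"
    unfolding Sw_eq_perm_group using sub by (rule subgroup.subgroup_is_group[OF _ group_perm_group])
  show ?thesis
    by unfold_locales
      (use compat in \<open>auto simp del: atLeastAtMost_iff
        simp: Sw_eq_perm_group coords[OF perm] coord_comp[OF perm perm] coord1_def[of id] coord2_def[of id]\<close>)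
qed

lemma card_iso_sym_group:
  assumes "perm_group W\<lparr>carrier := V\<rparr> \<cong> sym_group 4"
  shows "card V = 24"
proof -
  obtain \<phi> where "\<phi> \<in> iso (perm_group W\<lparr>carrier := V\<rparr>) (sym_group 4)" using assms by (auto simp: is_iso_def)
  then have "bij_betw \<phi> V {p. p permutes {1..4}}" by (simp add: iso_def sym_group_def)
  then show ?thesis
    using bij_betw_same_card card_permutations[of "{1..4::nat}" 4] by (fastforce simp: fact_numeral)
qed

lemma squares_do_not_commute:
  assumes sub: "subgroup V (Sw 4 2)" and iso: "Sw 4 2\<lparr>carrier := V\<rparr> \<cong> sym_group 4"
  shows "\<exists>a\<in>V. \<exists>b\<in>V. a \<circ> a \<circ> (b \<circ> b) \<noteq> b \<circ> b \<circ> (a \<circ> a)"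
proof -
  have "group (Sw 4 2\<lparr>carrier := V\<rparr>)" using sub by (rule subgroup.subgroup_is_group[OF _ group_Sw])
  then obtain \<phi> where \<phi>: "\<phi> \<in> iso (sym_group 4) (Sw 4 2\<lparr>carrier := V\<rparr>)"
    using group.iso_sym[OF _ iso] by (auto simp: is_iso_def)
  have \<phi>_bij: "bij_betw \<phi> {p. p permutes {1..4}} V"
    using \<phi> by (simp add: iso_def sym_group_def)
  have \<phi>_mult: "\<phi> (p \<circ> q) = \<phi> p \<circ> \<phi> q" if "p permutes {1..4}" "q permutes {1..4}" for p q
    using \<phi> that by (auto simp: iso_def hom_def sym_group_def Sw_def)
  obtain a b where a: "a permutes {1..4::nat}" and b: "b permutes {1..4::nat}"
    and ne: "a \<circ> a \<circ> (b \<circ> b) \<noteq> b \<circ> b \<circ> (a \<circ> a)"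
    using sym_group_4_squares by blast
  note pc = permutes_compose
  have "\<phi> (a \<circ> a \<circ> (b \<circ> b)) \<noteq> \<phi> (b \<circ> b \<circ> (a \<circ> a))"
  proof
    assume "\<phi> (a \<circ> a \<circ> (b \<circ> b)) = \<phi> (b \<circ> b \<circ> (a \<circ> a))"
    then have "a \<circ> a \<circ> (b \<circ> b) = b \<circ> b \<circ> (a \<circ> a)"
      by (rule inj_onD[OF bij_betw_imp_inj_on[OF \<phi>_bij]]) (simp_all only: mem_Collect_eq pc a b)
    then show False using ne by blast
  qed
  then have "\<phi> a \<circ> \<phi> a \<circ> (\<phi> b \<circ> \<phi> b) \<noteq> \<phi> b \<circ> \<phi> b \<circ> (\<phi> a \<circ> \<phi> a)"
    by (simp only: \<phi>_mult a b pc not_False_eq_True)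
  moreover have "\<phi> a \<in> V" "\<phi> b \<in> V" using \<phi>_bij a b by (auto simp: bij_betw_def)
  ultimately show ?thesis by blast
qed

text \<open>The elements of \<open>V\<close> are honest permutations of the words, so two products
  that differ in \<open>V\<close> already differ in a coordinate at some word. This turns the
  failure of the law into a bad point.\<close>

lemma exists_not_squares_commute_at:
  assumes bic: "bicompatible_subgroup 4 V" and iso: "Sw 4 2\<lparr>carrier := V\<rparr> \<cong> sym_group 4"
  shows "\<exists>x\<in>{1..4}. \<exists>y\<in>{1..4}.
    \<not> bicompatible_action.squares_commute_at (Sw 4 2\<lparr>carrier := V\<rparr>) coord1 coord2 x y"
proof -
  interpret bicompatible_action "Sw 4 2\<lparr>carrier := V\<rparr>" "{1..4}" coord1 coord2
    by (rule bicompatible_action_subgroup[OF bic])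
  have sub: "subgroup V (Sw 4 2)" using bic by (simp add: bicompatible_subgroup_def)
  obtain a b where ab: "a \<in> V" "b \<in> V" and ne: "a \<circ> a \<circ> (b \<circ> b) \<noteq> b \<circ> b \<circ> (a \<circ> a)"
    using squares_do_not_commute[OF sub iso] by blast
  have "a permutes words 4 2" "b permutes words 4 2"
    using subgroup.subset[OF sub] ab by (auto simp: Sw_eq_perm_group)
  then have "a \<circ> a \<circ> (b \<circ> b) permutes words 4 2" "b \<circ> b \<circ> (a \<circ> a) permutes words 4 2"
    by (simp_all only: permutes_compose)
  then obtain x y where "x \<in> {1..4}" "y \<in> {1..4}"
    "\<not> (coord1 (a \<circ> a \<circ> (b \<circ> b)) x y = coord1 (b \<circ> b \<circ> (a \<circ> a)) x y
      \<and> coord2 (a \<circ> a \<circ> (b \<circ> b)) x y = coord2 (b \<circ> b \<circ> (a \<circ> a)) x y)"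
    using permutes_words_eqI ne by blast
  moreover have "c \<otimes>\<^bsub>Sw 4 2\<lparr>carrier := V\<rparr>\<^esub> d = c \<circ> d" for c d by (simp add: Sw_def)
  ultimately show ?thesis using ab unfolding squares_commute_at_def by fastforce
qed

text \<open>The last claim is how inclusions become equalities: a copy of S_4 inside a set of 24
  elements fills it.\<close>

lemma faithful_image_sym_group_4:
  assumes "card Y = 4"
    and closed: "\<And>p. p permutes Y \<Longrightarrow> \<Phi> p permutes words 4 2"
    and mult: "\<And>p q. \<lbrakk>p permutes Y; q permutes Y\<rbrakk> \<Longrightarrow> \<Phi> (p \<circ> q) = \<Phi> p \<circ> \<Phi> q"
    and inj: "inj_on \<Phi> {p. p permutes Y}"
  shows "subgroup (\<Phi> ` {p. p permutes Y}) (Sw 4 2)"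
    and "Sw 4 2\<lparr>carrier := \<Phi> ` {p. p permutes Y}\<rparr> \<cong> sym_group 4"
    and "\<And>V. \<lbrakk>V \<subseteq> \<Phi> ` {p. p permutes Y}; Sw 4 2\<lparr>carrier := V\<rparr> \<cong> sym_group 4\<rbrakk>
      \<Longrightarrow> V = \<Phi> ` {p. p permutes Y}"
proof -
  have fin: "finite Y" using assms(1) by (simp add: card_ge_0_finite)
  note fi = faithful_image[of Y \<Phi> "words 4 2", OF closed mult inj]
  show "subgroup (\<Phi> ` {p. p permutes Y}) (Sw 4 2)" using fi(1) by (simp add: Sw_eq_perm_group)
  show iso: "Sw 4 2\<lparr>carrier := \<Phi> ` {p. p permutes Y}\<rparr> \<cong> sym_group 4"
    unfolding Sw_eq_perm_group
    by (rule iso_trans[OF group.iso_sym[OF group_perm_group fi(2)] perm_group_iso_sym_group[OF assms(1) fin]])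
  fix V assume V: "V \<subseteq> \<Phi> ` {p. p permutes Y}" "Sw 4 2\<lparr>carrier := V\<rparr> \<cong> sym_group 4"
  show "V = \<Phi> ` {p. p permutes Y}"
  proof (rule card_subset_eq[OF _ V(1)])
    show "finite (\<Phi> ` {p. p permutes Y})" using finite_permutations[OF fin] by simp
    show "card V = card (\<Phi> ` {p. p permutes Y})"
      using card_iso_sym_group iso V(2) unfolding Sw_eq_perm_group by metis
  qed
qed

lemma card_words_4_1: "card (words 4 1) = 4"
proof -
  have "words 4 1 = (\<lambda>x. [x]) ` {1..4}" by (auto simp: words_1)
  moreover have "inj_on (\<lambda>x. [x]) {1..4::nat}" by (simp add: inj_on_def)
  ultimately show ?thesis by (simp add: card_image)
qed

section \<open>The two tensor factors\<close>

lemma tensor_1_1_facts: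
  assumes "\<sigma> permutes words n 1" "\<tau> permutes words n 1"
  shows tensor_1_1_eval: "\<And>x y. \<lbrakk>x \<in> {1..n}; y \<in> {1..n}\<rbrakk> \<Longrightarrow> tensor n 1 1 \<sigma> \<tau> [x, y] = [\<sigma> [x] ! 0, \<tau> [y] ! 0]"
    and tensor_1_1_in: "\<And>x y. \<lbrakk>x \<in> {1..n}; y \<in> {1..n}\<rbrakk> \<Longrightarrow> \<sigma> [x] ! 0 \<in> {1..n} \<and> [\<sigma> [x] ! 0] = \<sigma> [x]"
proof -
  have 1: "\<sigma> [x] \<in> words n 1" "\<tau> [x] \<in> words n 1" if "x \<in> {1..n}" for x
  proof -
    have "[x] \<in> words n 1" using that unfolding words_1 by blast
    then show "\<sigma> [x] \<in> words n 1" "\<tau> [x] \<in> words n 1"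
      by (simp_all only: permutes_in_image[OF assms(1)] permutes_in_image[OF assms(2)])
  qed
  show "\<sigma> [x] ! 0 \<in> {1..n} \<and> [\<sigma> [x] ! 0] = \<sigma> [x]" if "x \<in> {1..n}" "y \<in> {1..n}" for x y
    using 1(1)[OF that(1)] by (auto simp: words_1)
  show "tensor n 1 1 \<sigma> \<tau> [x, y] = [\<sigma> [x] ! 0, \<tau> [y] ! 0]" if "x \<in> {1..n}" "y \<in> {1..n}" for x y
  proof -
    have "[x, y] \<in> words n (1 + 1)" using that by (simp add: words_2)
    moreover have "take 1 [x, y] = [x]" "drop 1 [x, y] = [y]" by (simp_all add: One_nat_def)
    ultimately show ?thesis using 1(1)[OF that(1)] 1(2)[OF that(2)] by (auto simp: words_1 tensor_def)
  qed
qed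

lemma tensor_1_1_comp:
  assumes "\<sigma> permutes words n 1" "\<tau> permutes words n 1" "\<sigma>' permutes words n 1" "\<tau>' permutes words n 1"
  shows "tensor n 1 1 \<sigma> \<tau> \<circ> tensor n 1 1 \<sigma>' \<tau>' = tensor n 1 1 (\<sigma> \<circ> \<sigma>') (\<tau> \<circ> \<tau>')"
proof
  fix w
  show "(tensor n 1 1 \<sigma> \<tau> \<circ> tensor n 1 1 \<sigma>' \<tau>') w = tensor n 1 1 (\<sigma> \<circ> \<sigma>') (\<tau> \<circ> \<tau>') w"
  proof (cases "w \<in> words n 2")
    case True
    then obtain x y where w: "x \<in> {1..n}" "y \<in> {1..n}" "w = [x, y]" by (auto simp: words_2)
    have "\<sigma> \<circ> \<sigma>' permutes words n 1" "\<tau> \<circ> \<tau>' permutes words n 1"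
      using assms by (simp_all only: permutes_compose)
    note e = tensor_1_1_eval[OF this w(1,2)] tensor_1_1_eval[OF assms(3,4) w(1,2)]
    have s: "\<sigma>' [x] ! 0 \<in> {1..n}" "[\<sigma>' [x] ! 0] = \<sigma>' [x]" "\<tau>' [y] ! 0 \<in> {1..n}" "[\<tau>' [y] ! 0] = \<tau>' [y]"
      using tensor_1_1_in[OF assms(3,4) w(1,2)] tensor_1_1_in[OF assms(4,3) w(2,1)] by blast+
    show ?thesis unfolding w(3) using e tensor_1_1_eval[OF assms(1,2) s(1,3)] s(2,4) by simp
  qed (simp add: tensor_def)
qed

lemma tensor_1_1_permutes:
  assumes "\<sigma> permutes words n 1" "\<tau> permutes words n 1"
  shows "tensor n 1 1 \<sigma> \<tau> permutes words n 2"
proof -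
  have id: "tensor n 1 1 id id = id" by (auto simp: tensor_def fun_eq_iff)
  have "tensor n 1 1 \<sigma> \<tau> \<circ> tensor n 1 1 (inv' \<sigma>) (inv' \<tau>) = id"
    "tensor n 1 1 (inv' \<sigma>) (inv' \<tau>) \<circ> tensor n 1 1 \<sigma> \<tau> = id"
    using assms by (simp_all only: tensor_1_1_comp permutes_inv permutes_inv_o id)
  then have "bij (tensor n 1 1 \<sigma> \<tau>)" by (rule o_bij[rotated])
  moreover have "tensor n 1 1 \<sigma> \<tau> w = w" if "w \<notin> words n 2" for w using that by (simp add: tensor_def)
  ultimately show ?thesis by (simp add: permutes_def bij_iff)
qed

lemma tensor_1_1_inj:
  assumes "\<sigma> permutes words n 1" "\<tau> permutes words n 1" "\<sigma>' permutes words n 1" "\<tau>' permutes words n 1"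
    and "tensor n 1 1 \<sigma> \<tau> = tensor n 1 1 \<sigma>' \<tau>'"
  shows "\<sigma> = \<sigma>'" "\<tau> = \<tau>'"
proof -
  have *: "\<sigma> [x] = \<sigma>' [x] \<and> \<tau> [y] = \<tau>' [y]" if "x \<in> {1..n}" "y \<in> {1..n}" for x y
    using tensor_1_1_eval[OF assms(1,2) that] tensor_1_1_eval[OF assms(3,4) that] assms(5)
      tensor_1_1_in[OF assms(1,2) that] tensor_1_1_in[OF assms(3,4) that]
      tensor_1_1_in[OF assms(2,1) that(2,1)] tensor_1_1_in[OF assms(4,3) that(2,1)] by force
  show "\<sigma> = \<sigma>'" "\<tau> = \<tau>'"
    using * assms(1-4) by (metis ext permutes_not_in words_1)+
qed

lemma S4_tensor_1_eq: "S4_tensor_1 = (\<lambda>\<sigma>. tensor 4 1 1 \<sigma> id) ` {\<sigma>. \<sigma> permutes words 4 1}"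
  and one_tensor_S4_eq: "one_tensor_S4 = (\<lambda>\<sigma>. tensor 4 1 1 id \<sigma>) ` {\<sigma>. \<sigma> permutes words 4 1}"
  by (auto simp: S4_tensor_1_def one_tensor_S4_def Sw_def)

lemma S4_tensor_1:
  shows S4_tensor_1_subgroup: "subgroup S4_tensor_1 (Sw 4 2)"
    and S4_tensor_1_iso: "Sw 4 2\<lparr>carrier := S4_tensor_1\<rparr> \<cong> sym_group 4"
    and S4_tensor_1_maximal: "\<And>V. \<lbrakk>V \<subseteq> S4_tensor_1; Sw 4 2\<lparr>carrier := V\<rparr> \<cong> sym_group 4\<rbrakk> \<Longrightarrow> V = S4_tensor_1"
proof -
  have mult: "tensor 4 1 1 (p \<circ> q) id = tensor 4 1 1 p id \<circ> tensor 4 1 1 q id"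
    if "p permutes words 4 1" "q permutes words 4 1" for p q
    using tensor_1_1_comp[OF that(1) permutes_id that(2) permutes_id] by simp
  have inj: "inj_on (\<lambda>\<sigma>. tensor 4 1 1 \<sigma> id) {\<sigma>. \<sigma> permutes words 4 1}"
    using tensor_1_1_inj(1)[OF _ permutes_id _ permutes_id] by (auto intro: inj_onI)
  note fi = faithful_image_sym_group_4[OF card_words_4_1 tensor_1_1_permutes[OF _ permutes_id] mult inj]
  show "subgroup S4_tensor_1 (Sw 4 2)" "Sw 4 2\<lparr>carrier := S4_tensor_1\<rparr> \<cong> sym_group 4"
    "\<And>V. \<lbrakk>V \<subseteq> S4_tensor_1; Sw 4 2\<lparr>carrier := V\<rparr> \<cong> sym_group 4\<rbrakk> \<Longrightarrow> V = S4_tensor_1"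
    unfolding S4_tensor_1_eq using fi by blast+
qed

lemma one_tensor_S4:
  shows one_tensor_S4_subgroup: "subgroup one_tensor_S4 (Sw 4 2)"
    and one_tensor_S4_iso: "Sw 4 2\<lparr>carrier := one_tensor_S4\<rparr> \<cong> sym_group 4"
    and one_tensor_S4_maximal: "\<And>V. \<lbrakk>V \<subseteq> one_tensor_S4; Sw 4 2\<lparr>carrier := V\<rparr> \<cong> sym_group 4\<rbrakk> \<Longrightarrow> V = one_tensor_S4"
proof -
  have mult: "tensor 4 1 1 id (p \<circ> q) = tensor 4 1 1 id p \<circ> tensor 4 1 1 id q"
    if "p permutes words 4 1" "q permutes words 4 1" for p q
    using tensor_1_1_comp[OF permutes_id that(1) permutes_id that(2)] by simp
  have inj: "inj_on (\<lambda>\<sigma>. tensor 4 1 1 id \<sigma>) {\<sigma>. \<sigma> permutes words 4 1}"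
    using tensor_1_1_inj(2)[OF permutes_id _ permutes_id] by (auto intro: inj_onI)
  note fi = faithful_image_sym_group_4[OF card_words_4_1 tensor_1_1_permutes[OF permutes_id] mult inj]
  show "subgroup one_tensor_S4 (Sw 4 2)" "Sw 4 2\<lparr>carrier := one_tensor_S4\<rparr> \<cong> sym_group 4"
    "\<And>V. \<lbrakk>V \<subseteq> one_tensor_S4; Sw 4 2\<lparr>carrier := V\<rparr> \<cong> sym_group 4\<rbrakk> \<Longrightarrow> V = one_tensor_S4"
    unfolding one_tensor_S4_eq using fi by blast+
qed

text \<open>The first coordinate ignores y and the second stays put, so each of the three equations
  holds at sight.\<close>

lemma S4_tensor_1_bicompatible: "bicompatible_subgroup 4 S4_tensor_1"
proof (rule bicompatible_subgroupI[OF S4_tensor_1_subgroup])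
  have c: "\<exists>\<alpha>. \<forall>x\<in>{1..4}. \<forall>y\<in>{1..4}. \<alpha> x \<in> {1..4} \<and> coord1 v x y = \<alpha> x \<and> coord2 v x y = y"
    if v: "v \<in> S4_tensor_1" for v
  proof -
    obtain \<sigma> where "\<sigma> permutes words 4 1" "v = tensor 4 1 1 \<sigma> id" using v by (auto simp: S4_tensor_1_eq)
    then show ?thesis
      using tensor_1_1_eval[of \<sigma> 4 id] tensor_1_1_in[of \<sigma> 4 id] permutes_id
      by (intro exI[of _ "\<lambda>x. \<sigma> [x] ! 0"]) (simp add: coord1_def coord2_def)
  qed
  fix u v x y z assume uv: "u \<in> S4_tensor_1" "v \<in> S4_tensor_1"
    and X: "x \<in> {1..4::nat}" "y \<in> {1..4::nat}" "z \<in> {1..4::nat}"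
  from c[OF uv(1)] obtain \<alpha> where
    "\<forall>x\<in>{1..4}. \<forall>y\<in>{1..4}. \<alpha> x \<in> {1..4} \<and> coord1 u x y = \<alpha> x \<and> coord2 u x y = y" by blast
  moreover from c[OF uv(2)] obtain \<beta> where
    "\<forall>x\<in>{1..4}. \<forall>y\<in>{1..4}. \<beta> x \<in> {1..4} \<and> coord1 v x y = \<beta> x \<and> coord2 v x y = y" by blast
  ultimately show "coord1 v x (coord1 u y z) = coord1 v x y \<and>
      coord2 v x (coord1 u y z) = coord1 u (coord2 v x y) z \<and>
      coord2 u (coord2 v x y) z = coord2 u y z"
    using X by metis
qed

lemma one_tensor_S4_bicompatible: "bicompatible_subgroup 4 one_tensor_S4"
proof (rule bicompatible_subgroupI[OF one_tensor_S4_subgroup])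
  have c: "\<exists>\<alpha>. \<forall>x\<in>{1..4}. \<forall>y\<in>{1..4}. \<alpha> y \<in> {1..4} \<and> coord1 v x y = x \<and> coord2 v x y = \<alpha> y"
    if v: "v \<in> one_tensor_S4" for v
  proof -
    obtain \<sigma> where "\<sigma> permutes words 4 1" "v = tensor 4 1 1 id \<sigma>" using v by (auto simp: one_tensor_S4_eq)
    then show ?thesis
      using tensor_1_1_eval[of id 4 \<sigma>] tensor_1_1_in[of \<sigma> 4 id] permutes_id
      by (intro exI[of _ "\<lambda>x. \<sigma> [x] ! 0"]) (simp add: coord1_def coord2_def)
  qed
  fix u v x y z assume uv: "u \<in> one_tensor_S4" "v \<in> one_tensor_S4"
    and X: "x \<in> {1..4::nat}" "y \<in> {1..4::nat}" "z \<in> {1..4::nat}"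
  from c[OF uv(1)] obtain \<alpha> where
    "\<forall>x\<in>{1..4}. \<forall>y\<in>{1..4}. \<alpha> y \<in> {1..4} \<and> coord1 u x y = x \<and> coord2 u x y = \<alpha> y" by blast
  moreover from c[OF uv(2)] obtain \<beta> where
    "\<forall>x\<in>{1..4}. \<forall>y\<in>{1..4}. \<beta> y \<in> {1..4} \<and> coord1 v x y = x \<and> coord2 v x y = \<beta> y" by blast
  ultimately show "coord1 v x (coord1 u y z) = coord1 v x y \<and>
      coord2 v x (coord1 u y z) = coord1 u (coord2 v x y) z \<and>
      coord2 u (coord2 v x y) z = coord2 u y z"
    using X by metis
qed

lemma permutes_finiteI:
  assumes "finite A" "\<And>x. x \<in> A \<Longrightarrow> p x \<in> A" "inj_on p A" "\<And>x. x \<notin> A \<Longrightarrow> p x = x"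
  shows "p permutes A"
proof (rule bij_imp_permutes)
  have "p ` A = A" using assms by (intro endo_inj_surj) auto
  then show "bij_betw p A A" using assms(3) by (simp add: bij_betw_def)
qed (rule assms(4))

text \<open>The permutation of letters is read off from the words starting with 1; the letter 1
  serves only as a reference row.\<close>

lemma in_one_tensor_S4:
  assumes v: "v permutes words 4 2"
    and c: "\<And>x y. \<lbrakk>x \<in> {1..4}; y \<in> {1..4}\<rbrakk> \<Longrightarrow> coord1 v x y = x \<and> coord2 v x y = coord2 v 1 y"
  shows "v \<in> one_tensor_S4"
proof -
  define \<sigma> where "\<sigma> w = (if w \<in> words 4 1 then [coord2 v 1 (w ! 0)] else w)" for w
  have 1: "1 \<in> {1..4::nat}" by simp
  have e: "\<sigma> [y] = [coord2 v 1 y]" if "y \<in> {1..4}" for y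
    using that unfolding \<sigma>_def words_1 by auto
  have v1: "v [1, y] = 1 # \<sigma> [y]" if "y \<in> {1..4}" for y
    using coords(1)[OF v 1 that] c[OF 1 that] e[OF that] by simp
  have \<sigma>: "\<sigma> permutes words 4 1"
  proof (rule permutes_finiteI)
    show "\<sigma> w \<in> words 4 1" if w: "w \<in> words 4 1" for w
    proof -
      obtain y where "y \<in> {1..4}" "w = [y]" using w unfolding words_1 by blast
      then show ?thesis using e coords(3)[OF v 1] unfolding words_1 by blast
    qed
    show "inj_on \<sigma> (words 4 1)"
    proof (rule inj_onI)
      fix w w' assume w: "w \<in> words 4 1" "w' \<in> words 4 1" "\<sigma> w = \<sigma> w'"
      obtain y y' where y: "y \<in> {1..4}" "w = [y]" "y' \<in> {1..4}" "w' = [y']"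
        using w(1,2) unfolding words_1 by blast
      then have "v [1, y] = v [1, y']" using v1 w(3) by simp
      then show "w = w'" using y permutes_inj[OF v] by (auto dest: injD)
    qed
  qed (simp_all add: finite_words \<sigma>_def)
  have "v = tensor 4 1 1 id \<sigma>"
  proof (rule permutes_words_eqI[OF v tensor_1_1_permutes[OF permutes_id \<sigma>]])
    fix x y :: nat assume xy: "x \<in> {1..4}" "y \<in> {1..4}"
    show "coord1 v x y = coord1 (tensor 4 1 1 id \<sigma>) x y \<and> coord2 v x y = coord2 (tensor 4 1 1 id \<sigma>) x y"
      unfolding coord1_def[of "tensor 4 1 1 id \<sigma>"] coord2_def[of "tensor 4 1 1 id \<sigma>"]
        tensor_1_1_eval[OF permutes_id \<sigma> xy]
      using c[OF xy] e[OF xy(2)] by simp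
  qed
  then show ?thesis using \<sigma> by (auto simp: one_tensor_S4_eq)
qed

lemma in_S4_tensor_1:
  assumes v: "v permutes words 4 2"
    and c: "\<And>x y. \<lbrakk>x \<in> {1..4}; y \<in> {1..4}\<rbrakk> \<Longrightarrow> coord2 v x y = y \<and> coord1 v x y = coord1 v x 1"
  shows "v \<in> S4_tensor_1"
proof -
  define \<sigma> where "\<sigma> w = (if w \<in> words 4 1 then [coord1 v (w ! 0) 1] else w)" for w
  have 1: "1 \<in> {1..4::nat}" by simp
  have e: "\<sigma> [y] = [coord1 v y 1]" if "y \<in> {1..4}" for y
    using that unfolding \<sigma>_def words_1 by auto
  have v1: "v [y, 1] = \<sigma> [y] @ [1]" if "y \<in> {1..4}" for y
    using coords(1)[OF v that 1] c[OF that 1] e[OF that] by simp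
  have \<sigma>: "\<sigma> permutes words 4 1"
  proof (rule permutes_finiteI)
    show "\<sigma> w \<in> words 4 1" if w: "w \<in> words 4 1" for w
    proof -
      obtain y where "y \<in> {1..4}" "w = [y]" using w unfolding words_1 by blast
      then show ?thesis using e coords(2)[OF v _ 1] unfolding words_1 by blast
    qed
    show "inj_on \<sigma> (words 4 1)"
    proof (rule inj_onI)
      fix w w' assume w: "w \<in> words 4 1" "w' \<in> words 4 1" "\<sigma> w = \<sigma> w'"
      obtain y y' where y: "y \<in> {1..4}" "w = [y]" "y' \<in> {1..4}" "w' = [y']"
        using w(1,2) unfolding words_1 by blast
      then have "v [y, 1] = v [y', 1]" using v1 w(3) by simp
      then show "w = w'" using y permutes_inj[OF v] by (auto dest: injD)
    qed
  qed (simp_all add: finite_words \<sigma>_def)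
  have "v = tensor 4 1 1 \<sigma> id"
  proof (rule permutes_words_eqI[OF v tensor_1_1_permutes[OF \<sigma> permutes_id]])
    fix x y :: nat assume xy: "x \<in> {1..4}" "y \<in> {1..4}"
    show "coord1 v x y = coord1 (tensor 4 1 1 \<sigma> id) x y \<and> coord2 v x y = coord2 (tensor 4 1 1 \<sigma> id) x y"
      unfolding coord1_def[of "tensor 4 1 1 \<sigma> id"] coord2_def[of "tensor 4 1 1 \<sigma> id"]
        tensor_1_1_eval[OF \<sigma> permutes_id xy]
      using c[OF xy] e[OF xy(1)] by simp
  qed
  then show ?thesis using \<sigma> by (auto simp: S4_tensor_1_eq)
qed

section \<open>The groups attached to a labelling of the four letters\<close>

text \<open>The groups are attached to a labelling, not to a pair of numbers. Different labellings
  may give the same group, and the normalisations built into \<open>N_group\<close> and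
  \<open>T_group\<close> enter later as \<open>h < k\<close> and \<open>i = 1\<close>.\<close>

locale labels =
  fixes i j h k :: nat
  assumes X: "{1..4} = {i, j, h, k}" and dist: "distinct [i, j, h, k]"
begin

lemma neq: "i \<noteq> j" "i \<noteq> h" "i \<noteq> k" "j \<noteq> h" "j \<noteq> k" "h \<noteq> k"
  "j \<noteq> i" "h \<noteq> i" "k \<noteq> i" "h \<noteq> j" "k \<noteq> j" "k \<noteq> h"
  using dist by auto

lemma mem: "i \<in> {1..4}" "j \<in> {1..4}" "h \<in> {1..4}" "k \<in> {1..4}"
  by (simp_all only: X) simp_all

lemma words_X: "w \<in> words 4 2 \<longleftrightarrow> (\<exists>x\<in>{i, j, h, k}. \<exists>y\<in>{i, j, h, k}. w = [x, y])"
  unfolding words_2 X ..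

section \<open>The groups attached to a pair of letters\<close>

definition N_Y :: "nat list set" where "N_Y = {[i, k], [i, h], [j, h], [j, k]}"

text \<open>The 16 words split into four squares. On {i,j} x {h,k}, which is \<open>N_Y\<close>, all
  permutations occur; on {i,j} x {i,j} only the swap of first letters; on {h,k} x {h,k} only the
  swap of second letters; the words of {h,k} x {i,j} stay fixed.\<close>

abbreviation "N_B1 \<equiv> {[i, i], [j, i], [i, j], [j, j]}"
abbreviation "N_B2 \<equiv> {[h, h], [h, k], [k, h], [k, k]}"
definition N_t1 :: "nat list \<Rightarrow> nat list" where
  "N_t1 = transpose [i, i] [j, i] \<circ> transpose [i, j] [j, j]"
definition N_t2 :: "nat list \<Rightarrow> nat list" where
  "N_t2 = transpose [h, h] [h, k] \<circ> transpose [k, h] [k, k]"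

sublocale N: two_central_involutions "words 4 2" N_Y N_B1 N_B2 N_t1 N_t2
proof
  show "N_t1 permutes N_B1" "N_t2 permutes N_B2"
    unfolding N_t1_def N_t2_def by (auto intro!: permutes_compose permutes_swap_id)
  show "N_t1 \<circ> N_t1 = id" "N_t2 \<circ> N_t2 = id"
    using neq by (auto simp: N_t1_def N_t2_def fun_eq_iff transpose_def)
  have "N_t1 [i, i] = [j, i]" "N_t2 [h, h] = [h, k]"
    using neq by (simp_all add: N_t1_def N_t2_def transpose_def)
  then show "N_t1 \<noteq> id" "N_t2 \<noteq> id" using neq by auto
  show "N_Y \<subseteq> words 4 2" "N_B1 \<subseteq> words 4 2" "N_B2 \<subseteq> words 4 2" by (auto simp: words_X N_Y_def)
qed (use neq in \<open>auto simp: N_Y_def\<close>)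

lemma N_group_eq:
  assumes "h < k"
  shows "N_group i j = N.product"
proof -
  have "{1..4} - {i, j} = {h, k}" unfolding X using neq by auto
  then have "Min ({1..4} - {i, j}) = h" "Max ({1..4} - {i, j}) = k" using assms by simp_all
  \<comment> \<open>The words of \<open>N_Y\<close> are listed along the path whose edges are the
    first three generators of \<open>N_group\<close>.\<close>
  moreover have "distinct [[i, k], [i, h], [j, h], [j, k]]" using neq by simp
  ultimately show ?thesis
    using N.generate_eq_product[OF N_Y_def]
    by (simp add: N_group_def Sw_eq_perm_group N_t1_def N_t2_def)
qed

text \<open>The bridge between partitions and groups: it spells out what R = ij|h|k and C = i|j|hk
  say about one permutation, and for permutations of the words it is equivalent to membership in the
  product group.\<close>

definition N_like :: "(nat list \<Rightarrow> nat list) \<Rightarrow> bool" where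
  "N_like v \<longleftrightarrow> (\<forall>x\<in>{i, j, h, k}. coord1 v h x = h \<and> coord1 v k x = k
     \<and> coord1 v i x \<in> {i, j} \<and> coord1 v j x \<in> {i, j} \<and> coord1 v x i = coord1 v x j
     \<and> coord2 v x i = i \<and> coord2 v x j = j
     \<and> coord2 v x h \<in> {h, k} \<and> coord2 v x k \<in> {h, k} \<and> coord2 v h x = coord2 v k x)"

lemma N_like_product:
  assumes "v \<in> N.product"
  shows "N_like v"
proof -
  obtain \<sigma> e1 e2 where v: "v = N.\<Phi> \<sigma> e1 e2" and \<sigma>: "\<sigma> permutes N_Y"
    using assms unfolding N.product_def by blast
  have tab: "v [i, i] = [if e1 then j else i, i]" "v [j, i] = [if e1 then i else j, i]"
    "v [i, j] = [if e1 then j else i, j]" "v [j, j] = [if e1 then i else j, j]"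
    "v [h, h] = [h, if e2 then k else h]" "v [h, k] = [h, if e2 then h else k]"
    "v [k, h] = [k, if e2 then k else h]" "v [k, k] = [k, if e2 then h else k]"
    "v [h, i] = [h, i]" "v [h, j] = [h, j]" "v [k, i] = [k, i]" "v [k, j] = [k, j]"
    unfolding v N.\<Phi>_def using neq by (simp_all add: N_Y_def N_t1_def N_t2_def transpose_def)
  have "v [x, y] ! 0 \<in> {i, j} \<and> v [x, y] ! 1 \<in> {h, k}" if "x \<in> {i, j}" "y \<in> {h, k}" for x y
  proof -
    have Y: "[x, y] \<in> N_Y" using that by (auto simp: N_Y_def)
    then have "v [x, y] = \<sigma> [x, y]" by (simp add: v N.\<Phi>_def)
    moreover have "\<sigma> [x, y] \<in> N_Y" using Y by (simp only: permutes_in_image[OF \<sigma>])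
    ultimately show ?thesis by (auto simp: N_Y_def)
  qed
  from this[of i h] this[of i k] this[of j h] this[of j k]
  have Y: "v [i, h] ! 0 = i \<or> v [i, h] ! 0 = j" "v [i, k] ! 0 = i \<or> v [i, k] ! 0 = j"
    "v [j, h] ! 0 = i \<or> v [j, h] ! 0 = j" "v [j, k] ! 0 = i \<or> v [j, k] ! 0 = j"
    "v [i, h] ! 1 = h \<or> v [i, h] ! 1 = k" "v [i, k] ! 1 = h \<or> v [i, k] ! 1 = k"
    "v [j, h] ! 1 = h \<or> v [j, h] ! 1 = k" "v [j, k] ! 1 = h \<or> v [j, k] ! 1 = k"
    by blast+
  show ?thesis unfolding N_like_def coord1_def coord2_def
    by (intro ballI; elim insertE emptyE; simp add: tab Y)
qed

text \<open>Such a v preserves each of the four squares. On {i,j} x {i,j} it keeps the second letter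
  and moves the first independently of it, so injectivity leaves the identity or
  \<open>N_t1\<close>; the square of {h,k} is symmetric, and on \<open>N_Y\<close> nothing is
  prescribed.\<close>

lemma product_N_like:
  assumes v: "v permutes words 4 2" and N: "N_like v"
  shows "v \<in> N.product"
proof -
  define \<sigma> where "\<sigma> w = (if w \<in> N_Y then v w else w)" for w
  define e1 where "e1 \<longleftrightarrow> coord1 v i i = j"
  define e2 where "e2 \<longleftrightarrow> coord2 v h h = k"
  have c: "v [x, y] = [coord1 v x y, coord2 v x y]" if "x \<in> {i, j, h, k}" "y \<in> {i, j, h, k}" for x y
    using coords(1)[OF v] that unfolding X by blast
  have inj: "v w = v w' \<Longrightarrow> w = w'" for w w' using permutes_inj[OF v] by (auto dest: injD)
  have N1: "coord1 v h x = h" "coord1 v k x = k" "coord2 v x i = i" "coord2 v x j = j"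
    and N2: "coord1 v i x \<in> {i, j}" "coord1 v j x \<in> {i, j}" "coord2 v x h \<in> {h, k}" "coord2 v x k \<in> {h, k}"
    and N3: "coord1 v x i = coord1 v x j" "coord2 v h x = coord2 v k x"
    if "x \<in> {i, j, h, k}" for x
    using bspec[OF N[unfolded N_like_def] that] by blast+
  have ne: "coord1 v i i \<noteq> coord1 v j i" "coord2 v h h \<noteq> coord2 v h k"
  proof -
    show "coord1 v i i \<noteq> coord1 v j i"
    proof
      assume "coord1 v i i = coord1 v j i"
      then have "v [i, i] = v [j, i]" using c[of i i] c[of j i] N1(3)[of i] N1(3)[of j] by simp
      then show False using inj neq by blast
    qed
    show "coord2 v h h \<noteq> coord2 v h k"
    proof
      assume "coord2 v h h = coord2 v h k"
      then have "v [h, h] = v [h, k]" using c[of h h] c[of h k] N1(1)[of h] N1(1)[of k] by simp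
      then show False using inj neq by blast
    qed
  qed
  have Y: "v w \<in> N_Y" if w: "w \<in> N_Y" for w
  proof -
    obtain x y where xy: "w = [x, y]" "x \<in> {i, j}" "y \<in> {h, k}" using w unfolding N_Y_def by blast
    then have xy': "x \<in> {i, j, h, k}" "y \<in> {i, j, h, k}" by auto
    have "coord1 v x y \<in> {i, j}" "coord2 v x y \<in> {h, k}" using xy(2,3) N2[OF xy'(2)] N2[OF xy'(1)] by blast+
    then show ?thesis unfolding xy(1) c[OF xy'] N_Y_def by blast
  qed
  have "\<sigma> permutes N_Y"
    by (rule permutes_finiteI) (use Y inj in \<open>auto simp: \<sigma>_def N.finite_Y inj_on_def\<close>)
  moreover have "v w = N.\<Phi> \<sigma> e1 e2 w" for w
  proof (cases "w \<in> words 4 2")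
    case False
    then show ?thesis using permutes_not_in[OF v] N.sub by (auto simp: N.\<Phi>_def)
  next
    case True
    then obtain x y where w: "w = [x, y]" and xy: "x \<in> {i, j, h, k}" "y \<in> {i, j, h, k}"
      unfolding words_X by blast
    show ?thesis
    proof (cases "w \<in> N_Y")
      case True
      then show ?thesis by (simp add: N.\<Phi>_def \<sigma>_def)
    next
      case False
      have N4: "coord1 v i i = (if e1 then j else i)" "coord1 v j i = (if e1 then i else j)"
        "coord2 v h h = (if e2 then k else h)" "coord2 v h k = (if e2 then h else k)"
        using N2(1)[of i] N2(2)[of i] N2(3)[of h] N2(4)[of h] ne neq unfolding e1_def e2_def by auto
      show ?thesis using xy False unfolding w N.\<Phi>_def
        by (elim insertE emptyE;
          simp add: neq c N4 N1 N3(1)[of i, symmetric] N3(1)[of j, symmetric]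
            N3(2)[of h, symmetric] N3(2)[of k, symmetric] N_Y_def N_t1_def N_t2_def transpose_def)
    qed
  qed
  then have "v = N.\<Phi> \<sigma> e1 e2" by (rule ext)
  ultimately show ?thesis unfolding N.product_def by blast
qed

text \<open>Only the middle letter y matters. If y is i or j, only u can change it, and only within
  {i, j}, a difference that v cannot see; if y is h or k, the roles are exchanged.\<close>

lemma N_like_bicompatible:
  assumes "N_like u" "N_like v" and xyz: "x \<in> {1..4}" "y \<in> {1..4}" "z \<in> {1..4}"
  shows "coord1 v x (coord1 u y z) = coord1 v x y \<and>
      coord2 v x (coord1 u y z) = coord1 u (coord2 v x y) z \<and>
      coord2 u (coord2 v x y) z = coord2 u y z"
proof -
  have u: "coord1 u h z = h" "coord1 u k z = k" "coord1 u i z \<in> {i, j}" "coord1 u j z \<in> {i, j}"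
    "coord2 u h z = coord2 u k z"
    using assms(1) xyz(3) unfolding N_like_def X by blast+
  have v: "coord1 v x i = coord1 v x j" "coord2 v x i = i" "coord2 v x j = j"
    "coord2 v x h \<in> {h, k}" "coord2 v x k \<in> {h, k}"
    using assms(2) xyz(1) unfolding N_like_def X by blast+
  show ?thesis using xyz(2) u v unfolding X by (elim insertE emptyE) auto
qed

section \<open>The groups attached to two transversal pairings\<close>

text \<open>\<open>T_P\<close> and \<open>T_Q\<close> pick representatives of the classes \<open>{i, h}\<close>, \<open>{j, k}\<close> and \<open>{i, j}\<close>, \<open>{h, k}\<close>; a letter
  is recovered from the two by \<open>T_J\<close>.\<close>

definition T_P :: "nat \<Rightarrow> nat" where "T_P x = (if x = i \<or> x = h then i else j)"
definition T_Q :: "nat \<Rightarrow> nat" where "T_Q x = (if x = i \<or> x = j then i else h)"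
definition T_J :: "nat \<Rightarrow> nat \<Rightarrow> nat" where
  "T_J s t = (if s = i then if t = i then i else h else if t = i then j else k)"
text \<open>A model of one block, four points in cyclic order; the three consecutive pairs
  correspond to the generators of \<open>T_group\<close>.\<close>

definition T_Y :: "nat list set" where "T_Y = {[i, i], [i, h], [j, h], [j, i]}"
text \<open>Splitting each letter by \<open>T_P\<close> and \<open>T_Q\<close> gives four binary
  coordinates to a word (x, y). The permutation acts on the pair (P x, Q y) and keeps (Q x, P y),
  which names the block: S_4 acts in the same way on all four blocks.\<close>

definition T_\<Phi> :: "(nat list \<Rightarrow> nat list) \<Rightarrow> nat list \<Rightarrow> nat list" where
  "T_\<Phi> \<sigma> w = (if w \<in> words 4 2 then
     [T_J (\<sigma> [T_P (w ! 0), T_Q (w ! 1)] ! 0) (T_Q (w ! 0)),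
      T_J (T_P (w ! 1)) (\<sigma> [T_P (w ! 0), T_Q (w ! 1)] ! 1)] else w)"

lemma T_PQJ:
  shows "T_P x \<in> {i, j}" "T_Q x \<in> {i, h}" "T_J s t \<in> {i, j, h, k}"
    and "x \<in> {i, j, h, k} \<Longrightarrow> T_J (T_P x) (T_Q x) = x"
    and "\<lbrakk>s \<in> {i, j}; t \<in> {i, h}\<rbrakk> \<Longrightarrow> T_P (T_J s t) = s" "\<lbrakk>s \<in> {i, j}; t \<in> {i, h}\<rbrakk> \<Longrightarrow> T_Q (T_J s t) = t"
    and "s \<in> {i, j} \<Longrightarrow> T_P s = s" "t \<in> {i, h} \<Longrightarrow> T_Q t = t"
proof -
  show "T_P x \<in> {i, j}" "T_Q x \<in> {i, h}" "T_J s t \<in> {i, j, h, k}"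
    by (simp_all add: T_P_def T_Q_def T_J_def)
  show "T_J (T_P x) (T_Q x) = x" if "x \<in> {i, j, h, k}"
    using that by (elim insertE emptyE; simp add: T_P_def T_Q_def T_J_def neq)
  show "T_P (T_J s t) = s" "T_Q (T_J s t) = t" if "s \<in> {i, j}" "t \<in> {i, h}"
    using that by (elim insertE emptyE; simp add: T_P_def T_Q_def T_J_def neq)+
  show "s \<in> {i, j} \<Longrightarrow> T_P s = s" "t \<in> {i, h} \<Longrightarrow> T_Q t = t"
    by (elim insertE emptyE; simp add: T_P_def T_Q_def neq)+
qed

lemma T_Y_iff: "w \<in> T_Y \<longleftrightarrow> (\<exists>s\<in>{i, j}. \<exists>t\<in>{i, h}. w = [s, t])"
  by (auto simp: T_Y_def)

lemma card_T_Y: "card T_Y = 4"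
  using neq by (simp add: T_Y_def)

lemma T_\<sigma>:
  assumes "\<sigma> permutes T_Y" "s \<in> {i, j}" "t \<in> {i, h}"
  shows "\<sigma> [s, t] ! 0 \<in> {i, j}" "\<sigma> [s, t] ! 1 \<in> {i, h}" "[\<sigma> [s, t] ! 0, \<sigma> [s, t] ! 1] = \<sigma> [s, t]"
proof -
  have "[s, t] \<in> T_Y" using assms(2,3) unfolding T_Y_iff by blast
  then have "\<sigma> [s, t] \<in> T_Y" by (simp only: permutes_in_image[OF assms(1)])
  then show "\<sigma> [s, t] ! 0 \<in> {i, j}" "\<sigma> [s, t] ! 1 \<in> {i, h}" "[\<sigma> [s, t] ! 0, \<sigma> [s, t] ! 1] = \<sigma> [s, t]"
    unfolding T_Y_iff by auto
qed

lemma T_\<Phi>_coords: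
  assumes "x \<in> {i, j, h, k}" "y \<in> {i, j, h, k}"
  shows "T_\<Phi> \<sigma> [x, y] = [T_J (\<sigma> [T_P x, T_Q y] ! 0) (T_Q x), T_J (T_P y) (\<sigma> [T_P x, T_Q y] ! 1)]"
proof -
  have "[x, y] \<in> words 4 2" using assms unfolding words_X by blast
  then show ?thesis by (simp add: T_\<Phi>_def)
qed

lemma T_\<Phi>_mult:
  assumes "\<sigma> permutes T_Y" "\<tau> permutes T_Y"
  shows "T_\<Phi> (\<sigma> \<circ> \<tau>) = T_\<Phi> \<sigma> \<circ> T_\<Phi> \<tau>"
proof
  fix w
  show "T_\<Phi> (\<sigma> \<circ> \<tau>) w = (T_\<Phi> \<sigma> \<circ> T_\<Phi> \<tau>) w"
  proof (cases "w \<in> words 4 2")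
    case False
    then show ?thesis by (simp add: T_\<Phi>_def)
  next
    case True
    then obtain x y where w: "w = [x, y]" and xy: "x \<in> {i, j, h, k}" "y \<in> {i, j, h, k}"
      unfolding words_X by blast
    note \<tau> = T_\<sigma>[OF assms(2) T_PQJ(1)[of x] T_PQJ(2)[of y]]
    show ?thesis unfolding w comp_apply T_\<Phi>_coords[OF xy] T_\<Phi>_coords[OF T_PQJ(3) T_PQJ(3)]
      T_PQJ(5)[OF \<tau>(1) T_PQJ(2)] T_PQJ(6)[OF T_PQJ(1) \<tau>(2)] \<tau>(3)
      T_PQJ(6)[OF \<tau>(1) T_PQJ(2)] T_PQJ(5)[OF T_PQJ(1) \<tau>(2)] ..
  qed
qed

lemma T_\<Phi>_id: "T_\<Phi> id = id"
proof
  fix w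
  show "T_\<Phi> id w = id w"
  proof (cases "w \<in> words 4 2")
    case True
    then obtain x y where w: "w = [x, y]" and xy: "x \<in> {i, j, h, k}" "y \<in> {i, j, h, k}"
      unfolding words_X by blast
    show ?thesis unfolding w T_\<Phi>_coords[OF xy] using T_PQJ(4)[OF xy(1)] T_PQJ(4)[OF xy(2)] by simp
  qed (simp add: T_\<Phi>_def)
qed

lemma T_\<Phi>_permutes:
  assumes "\<sigma> permutes T_Y"
  shows "T_\<Phi> \<sigma> permutes words 4 2"
proof -
  have "T_\<Phi> \<sigma> \<circ> T_\<Phi> (inv' \<sigma>) = id" "T_\<Phi> (inv' \<sigma>) \<circ> T_\<Phi> \<sigma> = id"
    using assms by (simp_all add: T_\<Phi>_mult[symmetric] permutes_inv permutes_inv_o T_\<Phi>_id)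
  then have "bij (T_\<Phi> \<sigma>)" by (rule o_bij[rotated])
  moreover have "T_\<Phi> \<sigma> w = w" if "w \<notin> words 4 2" for w using that by (simp add: T_\<Phi>_def)
  ultimately show ?thesis by (simp add: permutes_def bij_iff)
qed

lemma T_\<Phi>_inj: "inj_on T_\<Phi> {\<sigma>. \<sigma> permutes T_Y}"
proof (rule inj_onI, rule ext)
  fix \<sigma> \<tau> w assume "\<sigma> \<in> {\<sigma>. \<sigma> permutes T_Y}" "\<tau> \<in> {\<sigma>. \<sigma> permutes T_Y}" and eq: "T_\<Phi> \<sigma> = T_\<Phi> \<tau>"
  then have \<sigma>: "\<sigma> permutes T_Y" and \<tau>: "\<tau> permutes T_Y" by auto
  show "\<sigma> w = \<tau> w"
  proof (cases "w \<in> T_Y")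
    case True
    then obtain s t where w: "w = [s, t]" and st: "s \<in> {i, j}" "t \<in> {i, h}" unfolding T_Y_iff by blast
    have st': "s \<in> {i, j, h, k}" "t \<in> {i, j, h, k}" using st by auto
    note 1 = T_\<sigma>[OF \<sigma> st] and 2 = T_\<sigma>[OF \<tau> st]
    have "T_J (\<sigma> [s, t] ! 0) (T_Q s) = T_J (\<tau> [s, t] ! 0) (T_Q s)"
      "T_J (T_P t) (\<sigma> [s, t] ! 1) = T_J (T_P t) (\<tau> [s, t] ! 1)"
      using T_\<Phi>_coords[OF st', of \<sigma>] T_\<Phi>_coords[OF st', of \<tau>] T_PQJ(7)[OF st(1)] T_PQJ(8)[OF st(2)] eq
      by simp_all
    then have "\<sigma> [s, t] ! 0 = \<tau> [s, t] ! 0" "\<sigma> [s, t] ! 1 = \<tau> [s, t] ! 1"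
      using T_PQJ(5)[OF 1(1) T_PQJ(2)[of s]] T_PQJ(5)[OF 2(1) T_PQJ(2)[of s]]
        T_PQJ(6)[OF T_PQJ(1)[of t] 1(2)] T_PQJ(6)[OF T_PQJ(1)[of t] 2(2)] by metis+
    then show ?thesis using 1(3) 2(3) w by metis
  qed (simp add: permutes_not_in[OF \<sigma>] permutes_not_in[OF \<tau>])
qed

definition T_image :: "(nat list \<Rightarrow> nat list) set" where
  "T_image = T_\<Phi> ` {\<sigma>. \<sigma> permutes T_Y}"

lemma T_image_subgroup: "subgroup T_image (Sw 4 2)"
  and T_image_iso: "Sw 4 2\<lparr>carrier := T_image\<rparr> \<cong> sym_group 4"
  and T_image_maximal: "\<lbrakk>V \<subseteq> T_image; Sw 4 2\<lparr>carrier := V\<rparr> \<cong> sym_group 4\<rbrakk> \<Longrightarrow> V = T_image"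
  unfolding T_image_def
  using faithful_image_sym_group_4[OF card_T_Y T_\<Phi>_permutes T_\<Phi>_mult T_\<Phi>_inj] by blast+

lemma T_image_coords:
  assumes "v \<in> T_image"
  shows "\<exists>\<alpha> \<beta>. (\<forall>s t. \<alpha> s t \<in> {i, j} \<and> \<beta> s t \<in> {i, h}) \<and>
    (\<forall>x\<in>{1..4}. \<forall>y\<in>{1..4}. coord1 v x y = T_J (\<alpha> (T_P x) (T_Q y)) (T_Q x)
      \<and> coord2 v x y = T_J (T_P y) (\<beta> (T_P x) (T_Q y)))"
proof -
  obtain \<sigma> where \<sigma>: "\<sigma> permutes T_Y" and v: "v = T_\<Phi> \<sigma>" using assms unfolding T_image_def by blast
  show ?thesis
  proof (intro exI conjI allI ballI)
    \<comment> \<open>The witnesses first reduce their arguments by \<open>T_P\<close> and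
      \<open>T_Q\<close>, so that the bounds hold for arbitrary naturals.\<close>
    show "\<sigma> [T_P s, T_Q t] ! 0 \<in> {i, j}" "\<sigma> [T_P s, T_Q t] ! 1 \<in> {i, h}" for s t
      using T_\<sigma>[OF \<sigma> T_PQJ(1,2)] by blast+
    fix x y :: nat assume xy: "x \<in> {1..4}" "y \<in> {1..4}"
    have 1: "T_P (T_P x) = T_P x" "T_Q (T_Q y) = T_Q y"
      by (rule T_PQJ(7)[OF T_PQJ(1)], rule T_PQJ(8)[OF T_PQJ(2)])
    have "T_\<Phi> \<sigma> [x, y] = [T_J (\<sigma> [T_P x, T_Q y] ! 0) (T_Q x), T_J (T_P y) (\<sigma> [T_P x, T_Q y] ! 1)]"
      using xy unfolding X by (rule T_\<Phi>_coords)
    then show "coord1 v x y = T_J (\<sigma> [T_P (T_P x), T_Q (T_Q y)] ! 0) (T_Q x)"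
      "coord2 v x y = T_J (T_P y) (\<sigma> [T_P (T_P x), T_Q (T_Q y)] ! 1)"
      unfolding coord1_def coord2_def v 1 by simp_all
  qed
qed

text \<open>On the middle letter y, u changes only the P-part and v only the Q-part, so these moves
  commute. Moreover v reads y only through Q and u only through P, hence neither notices what the
  other did.\<close>

lemma T_image_bicompatible: "bicompatible_subgroup 4 T_image"
proof (rule bicompatible_subgroupI[OF T_image_subgroup])
  fix u v x y z assume u: "u \<in> T_image" and v: "v \<in> T_image"
    and X': "x \<in> {1..4::nat}" "y \<in> {1..4::nat}" "z \<in> {1..4::nat}"
  obtain \<alpha> \<beta> where "\<forall>s t. \<alpha> s t \<in> {i, j} \<and> \<beta> s t \<in> {i, h}"
    "\<forall>x\<in>{1..4}. \<forall>y\<in>{1..4}. coord1 u x y = T_J (\<alpha> (T_P x) (T_Q y)) (T_Q x)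
      \<and> coord2 u x y = T_J (T_P y) (\<beta> (T_P x) (T_Q y))"
    using T_image_coords[OF u] by blast
  then have a: "\<And>s t. \<alpha> s t \<in> {i, j}" "\<And>s t. \<beta> s t \<in> {i, h}"
    and u: "\<And>x y. \<lbrakk>x \<in> {1..4}; y \<in> {1..4}\<rbrakk> \<Longrightarrow> coord1 u x y = T_J (\<alpha> (T_P x) (T_Q y)) (T_Q x)"
    "\<And>x y. \<lbrakk>x \<in> {1..4}; y \<in> {1..4}\<rbrakk> \<Longrightarrow> coord2 u x y = T_J (T_P y) (\<beta> (T_P x) (T_Q y))"
    by blast+
  obtain \<alpha>' \<beta>' where "\<forall>s t. \<alpha>' s t \<in> {i, j} \<and> \<beta>' s t \<in> {i, h}"
    "\<forall>x\<in>{1..4}. \<forall>y\<in>{1..4}. coord1 v x y = T_J (\<alpha>' (T_P x) (T_Q y)) (T_Q x)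
      \<and> coord2 v x y = T_J (T_P y) (\<beta>' (T_P x) (T_Q y))"
    using T_image_coords[OF v] by blast
  then have a': "\<And>s t. \<alpha>' s t \<in> {i, j}" "\<And>s t. \<beta>' s t \<in> {i, h}"
    and v: "\<And>x y. \<lbrakk>x \<in> {1..4}; y \<in> {1..4}\<rbrakk> \<Longrightarrow> coord1 v x y = T_J (\<alpha>' (T_P x) (T_Q y)) (T_Q x)"
    "\<And>x y. \<lbrakk>x \<in> {1..4}; y \<in> {1..4}\<rbrakk> \<Longrightarrow> coord2 v x y = T_J (T_P y) (\<beta>' (T_P x) (T_Q y))"
    by blast+
  have J: "T_J s t \<in> {1..4}" for s t unfolding X by (rule T_PQJ(3))
  have PQ: "T_P (T_J (\<alpha> s t) (T_Q w)) = \<alpha> s t" "T_Q (T_J (\<alpha> s t) (T_Q w)) = T_Q w"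
    "T_P (T_J (T_P w) (\<beta>' s t)) = T_P w" "T_Q (T_J (T_P w) (\<beta>' s t)) = \<beta>' s t" for s t w
    by (simp_all only: T_PQJ(5)[OF a(1) T_PQJ(2)] T_PQJ(6)[OF a(1) T_PQJ(2)]
        T_PQJ(5)[OF T_PQJ(1) a'(2)] T_PQJ(6)[OF T_PQJ(1) a'(2)])
  show "coord1 v x (coord1 u y z) = coord1 v x y \<and>
      coord2 v x (coord1 u y z) = coord1 u (coord2 v x y) z \<and>
      coord2 u (coord2 v x y) z = coord2 u y z"
    by (simp only: u v X' J PQ simp_thms)
qed

text \<open>The hypotheses say that v is determined by its restriction to \<open>T_Y\<close>; that
  restriction is the required \<open>\<sigma>\<close>.\<close>

lemma in_T_image:
  assumes v: "v permutes words 4 2"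
    and c1: "\<And>x y. \<lbrakk>x \<in> {1..4}; y \<in> {1..4}\<rbrakk> \<Longrightarrow>
      coord1 v (T_P x) (T_Q y) \<in> {i, j} \<and> coord1 v x y = T_J (coord1 v (T_P x) (T_Q y)) (T_Q x)"
    and c2: "\<And>x y. \<lbrakk>x \<in> {1..4}; y \<in> {1..4}\<rbrakk> \<Longrightarrow>
      coord2 v (T_P x) (T_Q y) \<in> {i, h} \<and> coord2 v x y = T_J (T_P y) (coord2 v (T_P x) (T_Q y))"
  shows "v \<in> T_image"
proof -
  define \<sigma> where "\<sigma> w = (if w \<in> T_Y then v w else w)" for w
  have st: "v [s, t] = [coord1 v s t, coord2 v s t]" "coord1 v s t \<in> {i, j}" "coord2 v s t \<in> {i, h}"
    if st: "s \<in> {i, j}" "t \<in> {i, h}" for s t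
  proof -
    have st': "s \<in> {1..4}" "t \<in> {1..4}" using st unfolding X by auto
    show "v [s, t] = [coord1 v s t, coord2 v s t]" by (rule coords(1)[OF v st'])
    show "coord1 v s t \<in> {i, j}" "coord2 v s t \<in> {i, h}"
      using c1[OF st'] c2[OF st'] T_PQJ(7)[OF st(1)] T_PQJ(8)[OF st(2)] by simp_all
  qed
  have \<sigma>: "\<sigma> permutes T_Y"
  proof (rule permutes_finiteI)
    show "finite T_Y" by (simp add: T_Y_def)
    show "\<sigma> w \<in> T_Y" if "w \<in> T_Y" for w using that st unfolding \<sigma>_def T_Y_iff by fastforce
    show "inj_on \<sigma> T_Y" using permutes_inj[OF v] by (auto simp: \<sigma>_def inj_on_def dest: injD)
  qed (simp add: \<sigma>_def)
  have "v = T_\<Phi> \<sigma>"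
  proof (rule permutes_words_eqI[OF v T_\<Phi>_permutes[OF \<sigma>]])
    fix x y :: nat assume xy: "x \<in> {1..4}" "y \<in> {1..4}"
    have "[T_P x, T_Q y] \<in> T_Y" using T_PQJ(1,2) unfolding T_Y_iff by blast
    then have "\<sigma> [T_P x, T_Q y] = [coord1 v (T_P x) (T_Q y), coord2 v (T_P x) (T_Q y)]"
      using st(1)[OF T_PQJ(1,2)] by (simp add: \<sigma>_def)
    then have "T_\<Phi> \<sigma> [x, y] = [coord1 v x y, coord2 v x y]"
      using T_\<Phi>_coords[of x y \<sigma>] xy c1[OF xy] c2[OF xy] unfolding X by simp
    then show "coord1 v x y = coord1 (T_\<Phi> \<sigma>) x y \<and> coord2 v x y = coord2 (T_\<Phi> \<sigma>) x y"
      by (simp add: coord1_def coord2_def)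
  qed
  then show ?thesis using \<sigma> unfolding T_image_def by blast
qed

text \<open>One transposition of the model block becomes four, one in each block. With i = 1, a = j,
  b = h, c = k these are s_1, s_2, s_3.\<close>

lemma T_\<Phi>_generators:
  "T_\<Phi> (transpose [i, i] [i, h]) = transpose [i, i] [i, h] \<circ> transpose [h, i] [h, h]
     \<circ> transpose [i, j] [i, k] \<circ> transpose [h, j] [h, k]" (is "?a = ?A")
  "T_\<Phi> (transpose [i, h] [j, h]) = transpose [i, h] [j, h] \<circ> transpose [h, h] [k, h]
     \<circ> transpose [i, k] [j, k] \<circ> transpose [h, k] [k, k]" (is "?b = ?B")
  "T_\<Phi> (transpose [j, i] [j, h]) = transpose [j, i] [j, h] \<circ> transpose [k, i] [k, h]
     \<circ> transpose [j, j] [j, k] \<circ> transpose [k, j] [k, k]" (is "?c = ?C")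
proof -
  have "?a w = ?A w \<and> ?b w = ?B w \<and> ?c w = ?C w" for w
  proof (cases "w \<in> words 4 2")
    case True
    then obtain x y where w: "w = [x, y]" and xy: "x \<in> {i, j, h, k}" "y \<in> {i, j, h, k}"
      unfolding words_X by blast
    show ?thesis unfolding w T_\<Phi>_coords[OF xy] using xy
      by (elim insertE emptyE; simp add: neq T_P_def T_Q_def T_J_def transpose_def)
  next
    case False
    then have "w \<noteq> [x, y]" if "x \<in> {i, j, h, k}" "y \<in> {i, j, h, k}" for x y
      using that unfolding words_X by blast
    then show ?thesis using False by (simp add: T_\<Phi>_def transpose_def)
  qed
  then show "?a = ?A" "?b = ?B" "?c = ?C" by (simp_all add: fun_eq_iff)
qed

text \<open>The preimage of the generated group under \<open>T_\<Phi>\<close> contains the edges of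
  the path through \<open>T_Y\<close>, hence every permutation of \<open>T_Y\<close>.\<close>

lemma T_group_eq:
  assumes "i = 1"
  shows "T_group j h = T_image"
proof -
  have "{2, 3, 4} - {j, h} = {1..4} - {1, j, h}" by auto
  also have "\<dots> = {i, j, h, k} - {i, j, h}" by (simp only: X assms)
  also have "\<dots> = {k}" using neq by auto
  finally have "{2, 3, 4} - {j, h} = {k}" .
  then have c: "the_elem ({2, 3, 4} - {j, h}) = k" by simp
  let ?S = "{transpose [i, i] [i, h], transpose [i, h] [j, h], transpose [j, i] [j, h]}"
  have T: "T_group j h = generate (Sw 4 2) (T_\<Phi> ` ?S)"
    unfolding T_group_def c Let_def image_insert image_empty T_\<Phi>_generators unfolding assms ..
  have S: "s permutes T_Y" if "s \<in> ?S" for s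
    using that by (auto intro!: permutes_swap_id simp: T_Y_def)
  interpret group "Sw 4 2" by (rule group_Sw)
  have eng: "p \<circ> q \<in> generate (Sw 4 2) (T_\<Phi> ` ?S)"
    if "p \<in> generate (Sw 4 2) (T_\<Phi> ` ?S)" "q \<in> generate (Sw 4 2) (T_\<Phi> ` ?S)" for p q
    using generate.eng[OF that] by (simp add: Sw_def)
  have "\<sigma> \<in> {\<sigma>. T_\<Phi> \<sigma> \<in> generate (Sw 4 2) (T_\<Phi> ` ?S)}" if "\<sigma> permutes T_Y" for \<sigma>
  proof (rule generated_by_path[OF T_Y_def _ _ _ _ _ _ that])
    show "distinct [[i, i], [i, h], [j, h], [j, i]]" using neq by simp
    show "id \<in> {\<sigma>. T_\<Phi> \<sigma> \<in> generate (Sw 4 2) (T_\<Phi> ` ?S)}"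
      using generate.one[of "Sw 4 2"] by (simp add: T_\<Phi>_id Sw_def)
    show "p \<circ> q \<in> {\<sigma>. T_\<Phi> \<sigma> \<in> generate (Sw 4 2) (T_\<Phi> ` ?S)}"
      if "p \<in> {\<sigma>. T_\<Phi> \<sigma> \<in> generate (Sw 4 2) (T_\<Phi> ` ?S)}"
        "q \<in> {\<sigma>. T_\<Phi> \<sigma> \<in> generate (Sw 4 2) (T_\<Phi> ` ?S)}" "p permutes T_Y" "q permutes T_Y" for p q
      using that eng by (simp add: T_\<Phi>_mult)
    have "transpose [j, h] [j, i] = transpose [j, i] [j, h]" by (rule transpose_commute)
    then show "transpose [j, h] [j, i] \<in> {\<sigma>. T_\<Phi> \<sigma> \<in> generate (Sw 4 2) (T_\<Phi> ` ?S)}"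
      by (auto intro: generate.incl)
  qed (auto intro: generate.incl)
  then have "T_image \<subseteq> generate (Sw 4 2) (T_\<Phi> ` ?S)" unfolding T_image_def by blast
  moreover have "generate (Sw 4 2) (T_\<Phi> ` ?S) \<subseteq> T_image"
    by (rule generate_subgroup_incl[OF _ T_image_subgroup]) (use S in \<open>auto simp: T_image_def\<close>)
  ultimately show ?thesis using T by blast
qed


section \<open>From partition types back to the groups\<close>

lemma N_type_imp_N_like:
  assumes bic: "bicompatible_subgroup 4 V" and v: "v \<in> V"
    and N: "bicompatible_action.N_type (Sw 4 2\<lparr>carrier := V\<rparr>) {1..4} coord1 coord2 i j h k"
  shows "N_like v"
proof -
  interpret A: bicompatible_action "Sw 4 2\<lparr>carrier := V\<rparr>" "{1..4}" coord1 coord2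
    by (rule bicompatible_action_subgroup[OF bic])
  note N = N[unfolded A.N_type_def]
  have vG: "v \<in> carrier (Sw 4 2\<lparr>carrier := V\<rparr>)" using v by simp
  have R: "coord1 v x y \<in> A.R `` {x}" and C: "coord2 v x y \<in> A.C `` {y}"
    if "x \<in> {1..4}" "y \<in> {1..4}" for x y
    using A.R_step[OF vG that] A.C_step[OF vG that(2,1)] by blast+
  have ij: "(i, j) \<in> A.R" and hk: "(h, k) \<in> A.C" using N by blast+
  show ?thesis unfolding N_like_def
  proof (intro ballI)
    fix x assume "x \<in> {i, j, h, k}"
    then have x: "x \<in> {1..4}" unfolding X .
    show "coord1 v h x = h \<and> coord1 v k x = k
     \<and> coord1 v i x \<in> {i, j} \<and> coord1 v j x \<in> {i, j} \<and> coord1 v x i = coord1 v x j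
     \<and> coord2 v x i = i \<and> coord2 v x j = j
     \<and> coord2 v x h \<in> {h, k} \<and> coord2 v x k \<in> {h, k} \<and> coord2 v h x = coord2 v k x"
      using R[OF mem(1) x] R[OF mem(2) x] R[OF mem(3) x] R[OF mem(4) x]
        C[OF x mem(1)] C[OF x mem(2)] C[OF x mem(3)] C[OF x mem(4)]
        A.f_cong_R[OF ij vG x] A.g_cong_C[OF hk vG x] N by simp
  qed
qed

text \<open>An R-step keeps Q, so only the P-part of f_v(x, y) is in question. There y may be
  replaced by the R-equivalent \<open>T_Q y\<close>, and x by the C-equivalent \<open>T_P x\<close>
  because f preserves C. The second coordinate is symmetric.\<close>

lemma T_type_imp_in_T_image:
  assumes bic: "bicompatible_subgroup 4 V" and v: "v \<in> V"
    and T: "bicompatible_action.T_type (Sw 4 2\<lparr>carrier := V\<rparr>) {1..4} coord1 coord2 i j h k"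
  shows "v \<in> T_image"
proof -
  interpret A: bicompatible_action "Sw 4 2\<lparr>carrier := V\<rparr>" "{1..4}" coord1 coord2
    by (rule bicompatible_action_subgroup[OF bic])
  interpret d: bicompatible_action "Sw 4 2\<lparr>carrier := V\<rparr>" "{1..4}"
    "\<lambda>v x y. coord2 v y x" "\<lambda>v x y. coord1 v y x" by (rule A.dual)
  note T = T[unfolded A.T_type_def]
  have vG: "v \<in> carrier (Sw 4 2\<lparr>carrier := V\<rparr>)" using v by simp
  have vp: "v permutes words 4 2"
    using bic v subgroup.subset by (fastforce simp: bicompatible_subgroup_def Sw_eq_perm_group)
  have Q: "T_Q x = T_Q y" if "(x, y) \<in> A.R" for x y
  proof -
    have "x \<in> {i, j, h, k}" "y \<in> A.R `` {x}" using that A.R_subset unfolding X by blast+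
    then show ?thesis using T by (elim insertE emptyE) (auto simp: T_Q_def neq)
  qed
  have P: "T_P x = T_P y" if "(x, y) \<in> A.C" for x y
  proof -
    have "x \<in> {i, j, h, k}" "y \<in> A.C `` {x}" using that A.C_subset unfolding X by blast+
    then show ?thesis using T by (elim insertE emptyE) (auto simp: T_P_def neq)
  qed
  have Rel: "(x, T_P x) \<in> A.C" "(x, T_Q x) \<in> A.R" if "x \<in> {1..4}" for x
  proof -
    have "T_P x \<in> A.C `` {x}" "T_Q x \<in> A.R `` {x}"
      using that T unfolding X by (elim insertE emptyE; simp add: T_P_def T_Q_def neq)+
    then show "(x, T_P x) \<in> A.C" "(x, T_Q x) \<in> A.R" by blast+
  qed
  have PX: "T_P x \<in> {1..4}" and QX: "T_Q x \<in> {1..4}" for x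
    using T_PQJ(1)[of x] T_PQJ(2)[of x] unfolding X by blast+
  have recover: "r = T_J (T_P r) (T_Q r)" if "r \<in> {1..4}" for r
    using T_PQJ(4)[of r] that unfolding X by simp
  show ?thesis
  proof (rule in_T_image[OF vp])
    fix x y :: nat assume x: "x \<in> {1..4}" and y: "y \<in> {1..4}"
    have "coord1 v (T_P x) (T_Q y) \<in> A.R `` {T_P x}" using A.R_step[OF vG PX QX] by blast
    moreover have "A.R `` {T_P x} = {i, j}" using T_PQJ(1)[of x] T by (elim insertE emptyE) simp_all
    ultimately have 1: "coord1 v (T_P x) (T_Q y) \<in> {i, j}" by blast
    have "coord1 v x y = coord1 v x (T_Q y)" by (rule A.f_cong_R[OF Rel(2)[OF y] vG x])
    moreover have "T_Q (coord1 v x (T_Q y)) = T_Q x" using Q[OF A.R_step[OF vG x QX]] by simp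
    moreover have "T_P (coord1 v x (T_Q y)) = T_P (coord1 v (T_P x) (T_Q y))"
      by (rule P[OF d.g_preserves_R[OF Rel(1)[OF x] vG QX]])
    ultimately show "coord1 v (T_P x) (T_Q y) \<in> {i, j} \<and>
        coord1 v x y = T_J (coord1 v (T_P x) (T_Q y)) (T_Q x)"
      using 1 T_PQJ(7)[OF 1] recover[OF A.f_in[OF vG x y]] by simp
  next
    fix x y :: nat assume x: "x \<in> {1..4}" and y: "y \<in> {1..4}"
    have "coord2 v (T_P x) (T_Q y) \<in> A.C `` {T_Q y}" using A.C_step[OF vG QX PX] by blast
    moreover have "A.C `` {T_Q y} = {i, h}" using T_PQJ(2)[of y] T by (elim insertE emptyE) simp_all
    ultimately have 1: "coord2 v (T_P x) (T_Q y) \<in> {i, h}" by blast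
    have "coord2 v x y = coord2 v (T_P x) y" by (rule A.g_cong_C[OF Rel(1)[OF x] vG y])
    moreover have "T_P (coord2 v (T_P x) y) = T_P y" using P[OF A.C_step[OF vG y PX]] by simp
    moreover have "T_Q (coord2 v (T_P x) y) = T_Q (coord2 v (T_P x) (T_Q y))"
      by (rule Q[OF A.g_preserves_R[OF Rel(2)[OF y] vG PX]])
    ultimately show "coord2 v (T_P x) (T_Q y) \<in> {i, h} \<and>
        coord2 v x y = T_J (T_P y) (coord2 v (T_P x) (T_Q y))"
      using 1 T_PQJ(8)[OF 1] recover[OF A.g_in[OF vG x y]] by simp
  qed
qed

lemma S4_subgroups_of_N_eq:
  assumes "h < k"
  shows "S4_subgroups_of_N i j = (\<lambda>(c1, c2). N.sign_graph c1 c2) ` UNIV"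
proof -
  have "U \<in> S4_subgroups_of_N i j \<longleftrightarrow> subgroup U (Sw 4 2) \<and> U \<subseteq> N.product \<and> Sw 4 2\<lparr>carrier := U\<rparr> \<cong> sym_group 4"
    for U
  proof -
    have P: "subgroup N.product (Sw 4 2)" using N.subgroup_product by (simp add: Sw_eq_perm_group)
    have "subgroup U (Sw 4 2\<lparr>carrier := N.product\<rparr>) \<longleftrightarrow> subgroup U (Sw 4 2) \<and> U \<subseteq> N.product"
    proof
      assume U: "subgroup U (Sw 4 2\<lparr>carrier := N.product\<rparr>)"
      then show "subgroup U (Sw 4 2) \<and> U \<subseteq> N.product"
        using group.incl_subgroup[OF group_Sw P U] subgroup.subset[OF U] by simp
    next
      assume "subgroup U (Sw 4 2) \<and> U \<subseteq> N.product"
      then show "subgroup U (Sw 4 2\<lparr>carrier := N.product\<rparr>)"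
        using group.subgroup_incl[OF group_Sw _ P] by blast
    qed
    then show ?thesis by (simp add: S4_subgroups_of_N_def N_group_eq[OF assms])
  qed
  then show ?thesis
    using N.subgroup_iso_sym_group_4 N.sign_graph_subgroup N.sign_graph_iso N.sign_graph_subset
    by (auto simp: Sw_eq_perm_group image_iff)
qed

lemma card_S4_subgroups_of_N:
  assumes "h < k"
  shows "card (S4_subgroups_of_N i j) = 4"
proof -
  have "inj (\<lambda>(c1, c2). N.sign_graph c1 c2)" by (auto intro!: injI dest: N.sign_graph_inj)
  then have "card ((\<lambda>(c1, c2). N.sign_graph c1 c2) ` UNIV) = card (UNIV :: (bool \<times> bool) set)"
    by (rule card_image)
  also have "\<dots> = 4" unfolding UNIV_Times_UNIV[symmetric] card_cartesian_product by simp
  finally show ?thesis unfolding S4_subgroups_of_N_eq[OF assms] .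
qed

lemma S4_subgroups_of_N_bicompatible:
  assumes "h < k" "U \<in> S4_subgroups_of_N i j"
  shows "bicompatible_subgroup 4 U \<and> Sw 4 2\<lparr>carrier := U\<rparr> \<cong> sym_group 4"
proof -
  obtain c1 c2 where U: "U = N.sign_graph c1 c2" using assms S4_subgroups_of_N_eq by auto
  have "N_like v" if "v \<in> U" for v using that N.sign_graph_subset N_like_product unfolding U by blast
  then have "bicompatible_subgroup 4 U"
    using N.sign_graph_subgroup N_like_bicompatible
    by (intro bicompatible_subgroupI) (auto simp: U Sw_eq_perm_group)
  then show ?thesis using N.sign_graph_iso by (simp add: U Sw_eq_perm_group)
qed

text \<open>The pair {i, j} is recovered from the subgroup alone, so different pairs share no
  subgroup. Every sign graph contains an element above the transposition of [i, h] and [j, h], which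
  moves both i and j.\<close>

lemma S4_subgroups_of_N_moved:
  assumes "h < k" "U \<in> S4_subgroups_of_N i j"
  shows "{x \<in> {1..4}. \<exists>v\<in>U. \<exists>y\<in>{1..4}. coord1 v x y \<noteq> x} = {i, j}"
proof -
  obtain c1 c2 where U: "U = N.sign_graph c1 c2" using assms S4_subgroups_of_N_eq by auto
  let ?t = "transpose [i, h] [j, h]"
  have "?t permutes N_Y" by (rule permutes_swap_id) (simp_all add: N_Y_def)
  then obtain e1 e2 where v: "N.\<Phi> ?t e1 e2 \<in> U" unfolding U N.sign_graph_def by blast
  have "coord1 (N.\<Phi> ?t e1 e2) i h = j" "coord1 (N.\<Phi> ?t e1 e2) j h = i"
    unfolding N.\<Phi>_def coord1_def by (simp_all add: N_Y_def)
  then have "\<exists>v\<in>U. \<exists>y\<in>{1..4}. coord1 v i y \<noteq> i" "\<exists>v\<in>U. \<exists>y\<in>{1..4}. coord1 v j y \<noteq> j"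
    using v mem(3) neq by metis+
  moreover have "x \<in> {i, j}" if "x \<in> {1..4}" "v \<in> U" "y \<in> {1..4}" "coord1 v x y \<noteq> x" for x v y
  proof -
    have "N_like v" using that N.sign_graph_subset N_like_product unfolding U by blast
    then have "coord1 v h y = h" "coord1 v k y = k" using that(3) unfolding N_like_def X by blast+
    then show ?thesis using that(1,4) unfolding X by blast
  qed
  ultimately show ?thesis using mem by blast
qed

text \<open>Serves to tell the groups apart: once i = 1 is fixed, the letters reachable from it in
  either coordinate recover j and h.\<close>

lemma T_image_moves:
  "{coord1 v i y | v y. v \<in> T_image \<and> y \<in> {1..4}} = {i, j}"
  "{coord2 v x i | v x. v \<in> T_image \<and> x \<in> {1..4}} = {i, h}"
proof -
  have 1: "coord1 v i y \<in> {i, j} \<and> coord2 v y i \<in> {i, h}" if v: "v \<in> T_image" and y: "y \<in> {1..4}" for v y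
  proof -
    obtain \<alpha> \<beta> where "\<forall>s t. \<alpha> s t \<in> {i, j} \<and> \<beta> s t \<in> {i, h}"
      "\<forall>x\<in>{1..4}. \<forall>y\<in>{1..4}. coord1 v x y = T_J (\<alpha> (T_P x) (T_Q y)) (T_Q x)
        \<and> coord2 v x y = T_J (T_P y) (\<beta> (T_P x) (T_Q y))"
      using T_image_coords[OF v] by blast
    then have "coord1 v i y = T_J (\<alpha> (T_P i) (T_Q y)) (T_Q i)" "coord2 v y i = T_J (T_P i) (\<beta> (T_P y) (T_Q i))"
      using mem(1) y by blast+
    then show ?thesis by (simp add: T_J_def T_P_def T_Q_def)
  qed
  have id: "id \<in> T_image" using subgroup.one_closed[OF T_image_subgroup] by (simp add: Sw_def)
  have "coord1 id i i = i" "coord2 id i i = i" by (simp_all add: coord1_def coord2_def)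
  then have i: "\<exists>v\<in>T_image. \<exists>y\<in>{1..4}. i = coord1 v i y" "\<exists>v\<in>T_image. \<exists>x\<in>{1..4}. i = coord2 v x i"
    using id mem(1) by metis+
  have "transpose [i, i] [j, i] permutes T_Y" "transpose [i, i] [i, h] permutes T_Y"
    by (rule permutes_swap_id; simp add: T_Y_def)+
  then have v: "T_\<Phi> (transpose [i, i] [j, i]) \<in> T_image" "T_\<Phi> (transpose [i, i] [i, h]) \<in> T_image"
    unfolding T_image_def by blast+
  have "j = coord1 (T_\<Phi> (transpose [i, i] [j, i])) i i" "h = coord2 (T_\<Phi> (transpose [i, i] [i, h])) i i"
    unfolding coord1_def coord2_def by (simp_all add: T_\<Phi>_coords T_P_def T_Q_def T_J_def neq)
  then have "\<exists>v\<in>T_image. \<exists>y\<in>{1..4}. j = coord1 v i y" "\<exists>v\<in>T_image. \<exists>x\<in>{1..4}. h = coord2 v x i"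
    using v mem(1) by metis+
  then show "{coord1 v i y | v y. v \<in> T_image \<and> y \<in> {1..4}} = {i, j}"
    "{coord2 v x i | v x. v \<in> T_image \<and> x \<in> {1..4}} = {i, h}"
    using 1 i by blast+
qed

end

section \<open>Relabelling, counting and the equivalence\<close>

lemma labels_of_pair:
  assumes "1 \<le> i" "i < j" "j \<le> 4"
  obtains h k where "labels i j h k" "h < k"
proof -
  have "card ({1..4} - {i, j}) = 2" using assms by (simp add: card_Diff_subset)
  then obtain h k where hk: "{1..4} - {i, j} = {h, k}" "h \<noteq> k" by (auto simp: card_2_iff)
  have "{1..4} = {i, j} \<union> ({1..4} - {i, j})" using assms by auto
  then have X: "{1..4} = {i, j, h, k}" unfolding hk(1) by (simp only: Un_insert_left Un_empty_left)
  have "i \<notin> {h, k}" "j \<notin> {h, k}" unfolding hk(1)[symmetric] by simp_all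
  then have "labels i j h k" "labels i j k h" using X assms hk(2) by (auto simp: labels_def)
  then show thesis using that hk(2) by (cases "h < k") auto
qed

lemma labels_1_of_pair:
  assumes "a \<in> {2, 3, 4}" "b \<in> {2, 3, 4}" "a \<noteq> (b :: nat)"
  obtains c where "labels 1 a b c"
proof -
  have X: "{1..4::nat} = {1, 2, 3, 4}" by auto
  \<comment> \<open>The letters 2, 3, 4 add up to 9, so this is the remaining one.\<close>
  have "labels 1 a b (9 - a - b)"
    using assms by (elim insertE emptyE; simp add: labels_def X; auto)
  then show thesis by (rule that)
qed

lemma bicompatible_S4_cases:
  assumes bic: "bicompatible_subgroup 4 V" and iso: "Sw 4 2\<lparr>carrier := V\<rparr> \<cong> sym_group 4"
  shows "(\<exists>i j. 1 \<le> i \<and> i < j \<and> j \<le> 4 \<and> V \<in> S4_subgroups_of_N i j) \<or> V = S4_tensor_1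
    \<or> V = one_tensor_S4 \<or> (\<exists>a\<in>{2, 3, 4}. \<exists>b\<in>{2, 3, 4}. a \<noteq> b \<and> V = T_group a b)"
proof -
  interpret A: bicompatible_action "Sw 4 2\<lparr>carrier := V\<rparr>" "{1..4}" coord1 coord2
    by (rule bicompatible_action_subgroup[OF bic])
  have sub: "subgroup V (Sw 4 2)" using bic by (simp add: bicompatible_subgroup_def)
  have perm: "v permutes words 4 2" if "v \<in> V" for v
    using subgroup.subset[OF sub] that by (auto simp: Sw_eq_perm_group)
  have 1: "1 \<in> {1..4::nat}" by simp
  obtain x0 y0 where xy: "x0 \<in> {1..4}" "y0 \<in> {1..4}" "\<not> A.squares_commute_at x0 y0"
    using exists_not_squares_commute_at[OF bic iso] by blast
  show ?thesis
  proof (cases rule: A.classification[OF xy, case_names one_tensor tensor_one N T])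
    case one_tensor
    have "V \<subseteq> one_tensor_S4"
    proof
      fix v assume v: "v \<in> V"
      show "v \<in> one_tensor_S4"
      proof (rule in_one_tensor_S4[OF perm[OF v]])
        fix x y :: nat assume x: "x \<in> {1..4}" and y: "y \<in> {1..4}"
        have "x = coord1 v x y" using one_tensor(1) A.R_step[of v x y] A.f_in[of v x y] v x y by simp
        moreover have "(x, 1) \<in> A.C" using one_tensor(2) x 1 by blast
        then have "coord2 v x y = coord2 v 1 y" using A.g_cong_C[of x 1 v y] v y by simp
        ultimately show "coord1 v x y = x \<and> coord2 v x y = coord2 v 1 y" by simp
      qed
    qed
    then show ?thesis using one_tensor_S4_maximal iso by blast
  next
    case tensor_one
    have "V \<subseteq> S4_tensor_1"
    proof
      fix v assume v: "v \<in> V"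
      show "v \<in> S4_tensor_1"
      proof (rule in_S4_tensor_1[OF perm[OF v]])
        fix x y :: nat assume x: "x \<in> {1..4}" and y: "y \<in> {1..4}"
        have "y = coord2 v x y" using tensor_one(1) A.C_step[of v y x] A.g_in[of v x y] v x y by simp
        moreover have "(y, 1) \<in> A.R" using tensor_one(2) y 1 by blast
        then have "coord1 v x y = coord1 v x 1" using A.f_cong_R[of y 1 v x] v x by simp
        ultimately show "coord2 v x y = y \<and> coord1 v x y = coord1 v x 1" by simp
      qed
    qed
    then show ?thesis using S4_tensor_1_maximal iso by blast
  next
    case (N i j h k)
    \<comment> \<open>The type is symmetric in i, j and in h, k, so the labels can be ordered as
      \<open>N_group\<close> expects.\<close>
    have swap: "A.N_type j i h k" "A.N_type i j k h" if "A.N_type i j h k" for i j h k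
      using that by (auto simp: A.N_type_def insert_commute)
    have main: ?thesis if "labels i j h k" "A.N_type i j h k" "i < j" "h < k" for i j h k
    proof -
      interpret labels i j h k by fact
      have "V \<subseteq> N_group i j"
        unfolding N_group_eq[OF that(4)]
        using product_N_like[OF perm] N_type_imp_N_like[OF bic _ that(2)] by blast
      moreover have "subgroup (N_group i j) (Sw 4 2)"
        unfolding N_group_eq[OF that(4)] using N.subgroup_product by (simp add: Sw_eq_perm_group)
      ultimately have "V \<in> S4_subgroups_of_N i j"
        using iso group.subgroup_incl[OF group_Sw sub] by (simp add: S4_subgroups_of_N_def)
      then show ?thesis using that(3) mem(1,2) by auto
    qed
    have l: "labels i j h k" "labels j i h k" "labels i j k h" "labels j i k h"
      using N by (auto simp: labels_def)
    note t = N(3) swap[OF N(3)] swap(2)[OF swap(1)[OF N(3)]]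
    have "i \<noteq> j" "h \<noteq> k" using N(2) by auto
    then consider "i < j" "h < k" | "j < i" "h < k" | "i < j" "k < h" | "j < i" "k < h" by linarith
    then show ?thesis using main l t by cases blast+
  next
    case (T i j h k)
    \<comment> \<open>Swapping rows or columns of the square preserves the type, and these four
      symmetries act simply transitively on the letters, so 1 can be moved to the first place. The
      same count, 24 labellings modulo 4, explains the six groups.\<close>
    have sym: "A.T_type j i k h" "A.T_type h k i j" "A.T_type k h j i"
      using T(3) by (simp_all add: A.T_type_def insert_commute)
    have main: ?thesis if "labels 1 a b c" "A.T_type 1 a b c" for a b c
    proof -
      interpret labels 1 a b c by fact
      have "V \<subseteq> T_image" using T_type_imp_in_T_image[OF bic _ that(2)] by blast
      then have "V = T_group a b" using T_image_maximal iso T_group_eq by simp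
      moreover have "a \<in> {2, 3, 4}" "b \<in> {2, 3, 4}"
        using mem(2,3) neq(1,2) by auto
      ultimately show ?thesis using neq by blast
    qed
    have l: "labels i j h k" "labels j i k h" "labels h k i j" "labels k h j i"
      using T by (auto simp: labels_def)
    have "1 \<in> {i, j, h, k}" using 1 unfolding T(1) .
    then show ?thesis using main l T(3) sym by blast
  qed
qed

lemma pairs_eq: "{(i, j). 1 \<le> i \<and> i < j \<and> j \<le> (4::nat)} = {(1, 2), (1, 3), (1, 4), (2, 3), (2, 4), (3, 4)}"
  by auto

text \<open>Six pairs contribute four sign graphs each, and the families are disjoint because a
  subgroup determines its pair.\<close>

lemma card_S4_subgroups: "card {U. \<exists>i j. 1 \<le> i \<and> i < j \<and> j \<le> 4 \<and> U \<in> S4_subgroups_of_N i j} = 24"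
proof -
  let ?P = "{(i, j). 1 \<le> i \<and> i < j \<and> j \<le> (4::nat)}"
  have "{U. \<exists>i j. 1 \<le> i \<and> i < j \<and> j \<le> 4 \<and> U \<in> S4_subgroups_of_N i j}
    = (\<Union>(i, j)\<in>?P. S4_subgroups_of_N i j)" by auto
  also have "card \<dots> = (\<Sum>p\<in>?P. card (case p of (i, j) \<Rightarrow> S4_subgroups_of_N i j))"
  proof (rule card_UN_disjoint)
    show "finite ?P" by (simp add: pairs_eq)
    show "\<forall>p\<in>?P. finite (case p of (i, j) \<Rightarrow> S4_subgroups_of_N i j)"
    proof clarsimp
      fix i j :: nat assume "1 \<le> i" "i < j" "j \<le> 4"
      then obtain h k where "labels i j h k" "h < k" by (rule labels_of_pair)
      then show "finite (S4_subgroups_of_N i j)"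
        using labels.card_S4_subgroups_of_N by (simp add: card_ge_0_finite)
    qed
    have eq: "i = i' \<and> j = j'"
      if ij: "1 \<le> i" "i < j" "j \<le> 4" and ij': "1 \<le> i'" "i' < j'" "j' \<le> 4"
        and U: "U \<in> S4_subgroups_of_N i j" "U \<in> S4_subgroups_of_N i' j'" for i j i' j' U
    proof -
      obtain h k where l: "labels i j h k" "h < k" using ij by (rule labels_of_pair)
      obtain h' k' where l': "labels i' j' h' k'" "h' < k'" using ij' by (rule labels_of_pair)
      have "{i, j} = {i', j'}"
        using labels.S4_subgroups_of_N_moved[OF l U(1)] labels.S4_subgroups_of_N_moved[OF l' U(2)] by simp
      then show ?thesis using ij(2) ij'(2) by (auto simp: doubleton_eq_iff)
    qed
    then show "\<forall>p\<in>?P. \<forall>q\<in>?P. p \<noteq> q \<longrightarrow>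
      (case p of (i, j) \<Rightarrow> S4_subgroups_of_N i j) \<inter> (case q of (i, j) \<Rightarrow> S4_subgroups_of_N i j) = {}"
      by blast
  qed
  also have "\<dots> = (\<Sum>p\<in>?P. 4)"
  proof (rule sum.cong[OF refl])
    fix p assume "p \<in> ?P"
    then obtain i j where p: "p = (i, j)" "1 \<le> i" "i < j" "j \<le> 4" by auto
    obtain h k where "labels i j h k" "h < k" using p(2-4) by (rule labels_of_pair)
    then show "card (case p of (i, j) \<Rightarrow> S4_subgroups_of_N i j) = 4"
      using labels.card_S4_subgroups_of_N p(1) by simp
  qed
  also have "\<dots> = 24" by (simp add: pairs_eq)
  finally show ?thesis .
qed

lemma card_T_groups: "card {T_group a b | a b. a \<in> {2, 3, 4} \<and> b \<in> {2, 3, 4} \<and> a \<noteq> b} = 6"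
proof -
  let ?P = "{(2, 3), (2, 4), (3, 2), (3, 4), (4, 2), (4, 3)} :: (nat \<times> nat) set"
  have P: "p \<in> ?P \<longleftrightarrow> fst p \<in> {2, 3, 4} \<and> snd p \<in> {2, 3, 4} \<and> fst p \<noteq> snd p" for p
    by (cases p) auto
  have "inj_on (\<lambda>p. T_group (fst p) (snd p)) ?P"
  proof (rule inj_onI)
    fix p q assume "p \<in> ?P" "q \<in> ?P" and eq: "T_group (fst p) (snd p) = T_group (fst q) (snd q)"
    then have pq: "fst p \<in> {2, 3, 4}" "snd p \<in> {2, 3, 4}" "fst p \<noteq> snd p"
      "fst q \<in> {2, 3, 4}" "snd q \<in> {2, 3, 4}" "fst q \<noteq> snd q" unfolding P by blast+
    obtain c where c: "labels 1 (fst p) (snd p) c" using pq(1-3) by (rule labels_1_of_pair)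
    obtain d where d: "labels 1 (fst q) (snd q) d" using pq(4-6) by (rule labels_1_of_pair)
    have "labels.T_image 1 (fst p) (snd p) c = labels.T_image 1 (fst q) (snd q) d"
      using eq labels.T_group_eq[OF c refl] labels.T_group_eq[OF d refl] by simp
    then have "{1, fst p} = {1, fst q}" "{1, snd p} = {1, snd q}"
      using labels.T_image_moves[OF c] labels.T_image_moves[OF d] by simp_all
    then show "p = q" using pq by (auto simp: doubleton_eq_iff prod_eq_iff)
  qed
  then have "card ((\<lambda>p. T_group (fst p) (snd p)) ` ?P) = card ?P" by (rule card_image)
  moreover have "{T_group a b | a b. a \<in> {2, 3, 4} \<and> b \<in> {2, 3, 4} \<and> a \<noteq> b} = (\<lambda>p. T_group (fst p) (snd p)) ` ?P"
    (is "?S = _")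
  proof (intro equalityI subsetI)
    fix U assume "U \<in> ?S"
    then obtain a b where ab: "a \<in> {2, 3, 4}" "b \<in> {2, 3, 4}" "a \<noteq> b" "U = T_group a b" by blast
    then have "(a, b) \<in> ?P" unfolding P by simp
    then show "U \<in> (\<lambda>p. T_group (fst p) (snd p)) ` ?P" by (rule image_eqI[rotated]) (simp add: ab(4))
  next
    fix U assume "U \<in> (\<lambda>p. T_group (fst p) (snd p)) ` ?P"
    then obtain p where "p \<in> ?P" "U = T_group (fst p) (snd p)" by blast
    then show "U \<in> ?S" unfolding P by blast
  qed
  ultimately show ?thesis by simp
qed

theorem theorem6p8:
  shows "(\<forall>V. subgroup V (Sw 4 2) \<longrightarrow>
           ((bicompatible_subgroup 4 V \<and> Sw 4 2 \<lparr>carrier := V\<rparr> \<cong> sym_group 4)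
            \<longleftrightarrow>
            ((\<exists>i j. 1 \<le> i \<and> i < j \<and> j \<le> 4 \<and> V \<in> S4_subgroups_of_N i j)
             \<or> V = S4_tensor_1
             \<or> V = one_tensor_S4
             \<or> (\<exists>a\<in>{2, 3, 4}. \<exists>b\<in>{2, 3, 4}. a \<noteq> b \<and> V = T_group a b))))
         \<and> card {U. \<exists>i j. 1 \<le> i \<and> i < j \<and> j \<le> 4 \<and> U \<in> S4_subgroups_of_N i j} = 24
         \<and> card {T_group a b | a b. a \<in> {2, 3, 4} \<and> b \<in> {2, 3, 4} \<and> a \<noteq> b} = 6"
proof (intro conjI allI impI card_S4_subgroups card_T_groups)
  fix V
  show "(bicompatible_subgroup 4 V \<and> Sw 4 2 \<lparr>carrier := V\<rparr> \<cong> sym_group 4)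
     \<longleftrightarrow> ((\<exists>i j. 1 \<le> i \<and> i < j \<and> j \<le> 4 \<and> V \<in> S4_subgroups_of_N i j) \<or> V = S4_tensor_1
       \<or> V = one_tensor_S4 \<or> (\<exists>a\<in>{2, 3, 4}. \<exists>b\<in>{2, 3, 4}. a \<noteq> b \<and> V = T_group a b))"
    (is "?L \<longleftrightarrow> ?R")
  proof
    assume ?L then show ?R using bicompatible_S4_cases by blast
  next
    assume ?R
    then consider i j where "1 \<le> i" "i < j" "j \<le> 4" "V \<in> S4_subgroups_of_N i j"
      | "V = S4_tensor_1" | "V = one_tensor_S4"
      | a b where "a \<in> {2, 3, 4}" "b \<in> {2, 3, 4}" "a \<noteq> b" "V = T_group a b" by blast
    then show ?L
    proof cases
      case 1
      obtain h k where "labels i j h k" "h < k" using 1(1-3) by (rule labels_of_pair)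
      then show ?thesis using labels.S4_subgroups_of_N_bicompatible 1(4) by blast
    next
      case 4
      obtain c where "labels 1 a b c" using 4(1-3) by (rule labels_1_of_pair)
      then interpret labels 1 a b c .
      show ?thesis using T_image_bicompatible T_image_iso 4(4) T_group_eq by simp
    qed (use S4_tensor_1_bicompatible S4_tensor_1_iso one_tensor_S4_bicompatible one_tensor_S4_iso in simp_all)
  qed
qed

end
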